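(* Let $r>0$ and let $v$ be a multiplier system on $\Gamma=\mathrm{SL}_2(\mathbb Z)$ corresponding to the weight $r$. For all $f_1,f_2\in S_r(\Gamma,v)$ $$\bigl[c^K_{f_2}(i,\infty),\,c_{f_1}(\rho-1,\rho)\bigr]_{2-r}=-2i\,(f_1,f_2)_r:=-2i\int_{\Gamma\backslash\mathfrak H}f_1(\tau)\,\overline{f_2(\tau)}\,y^r\,\frac{dx\,dy}{y^2}\qquad(\tau=x+iy).$$
   Context: $\mathfrak H$, $\mathfrak H^-$ are the upper and lower half-planes; $\rho=e^{\pi i/3}$; $\mathbb P^1_{\mathbb R}=\mathbb R\cup\{\infty\}$. Powers of numbers in $\mathfrak H$ or $\mathfrak H^-$ use the principal argument. A multiplier system corresponding to $r\in\mathbb R$ is $v=v[p]$, $p\in\mathbb R$, $p\equiv r\bmod2$, with $v[p](\gamma)=\eta^{2p}(\gamma z)/\bigl((cz+d)^p\eta^{2p}(z)\bigr)$ for $\gamma=\begin{pmatrix}a&b\\c&d\end{pmatrix}\in\Gamma$, $\arg(cz+d)\in(-\pi,\pi]$, $\eta$ the Dedekind eta function. $S_r(\Gamma,v)$ is the space of holomorphic $f:\mathfrak H\to\mathbb C$ with $f(\gamma z)=v(\gamma)(cz+d)^rf(z)$ for all $\gamma\in\Gamma$ and $f(z)=O((\mathrm{Im}\,z)^{-a})$ for all $a>0$ as $\mathrm{Im}\,z\to\infty$. Eichler and Knopp cocycles: for $f\in S_r(\Gamma,v)$ and $z_1,z_2$ in $\mathfrak H$ or cusps, $c_f(z_1,z_2;t)=\int_{\tau=z_1}^{z_2}f(\tau)(\tau-t)^{r-2}d\tau$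 for $t\in\mathfrak H^-$, and $c^K_f(z_1,z_2;z)=\overline{c_f(z_1,z_2;\bar z)}=\int_{\tau=z_1}^{z_2}\overline{f(\tau)}\,(\bar\tau-z)^{r-2}\,d\bar\tau$ for $z\in\mathfrak H$. The bracket $[h,f]_k$ (used with $k=2-r$). Put $w=\frac{z-i}{z+i}$, $h^+(z)=(-i-z)^kh(z)$ for $h$ holomorphic on $\mathfrak H$, $f^-(t)=(i-t)^kf(t)$ for $f$ holomorphic on $\mathfrak H^-$. Suppose $f^-$ extends holomorphically to a neighborhood of $\mathfrak H^-\cup\mathbb P^1_{\mathbb R}$ in $\mathbb P^1_{\mathbb C}$, and, in case $k\in\mathbb Z_{\le0}$, that $f$ is a polynomial function of degree at most $|k|$. Write $f^-=\sum_{m\le0}d_mw^m$ (with $d_m=0$ for $m<k$ if $k\in\mathbb Z_{\le0}$), and put $\sigma_kf^-=\sum_{m\le 0}\frac{|m|!}{(k)_{|m|}}d_mw^{m-1}$, where $(k)_n$ is the Pochhammer symbol and, if $k\in\mathbb Z_{\le0}$, only $k\le m\le0$ occur. Then $$[h,f]_k=\frac1\pi\int_Ch^+(z)\,\sigma_kf^-(z)\,\frac{dz}{(z+i)^2}$$ with $C$ a positively oriented circle $|w|=c<1$ in the domain of $\sigma_kf^-$. (For $r\in\mathbb Z_{\ge2}$ both $c^K_{f_2}(i,\infty)$ and $c_{f_1}(\rho-1,\rho)$ are polynomial functions of degree at most $r-2$.) *)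

theory Defs
  imports "HOL-Complex_Analysis.Complex_Analysis" "HOL-Library.Landau_Symbols"
begin

definition upper_half_plane :: "complex set" where
  "upper_half_plane = {z. Im z > 0}"

definition lower_half_plane :: "complex set" where
  "lower_half_plane = {z. Im z < 0}"

definition rho :: complex where
  "rho = exp (of_real pi * \<i> / 3)"


section \<open>The modular group and multiplier systems\<close>

definition SL2Z :: "(int^2^2) set" where
  "SL2Z = {A. det A = 1}"

definition automorphy :: "int^2^2 \<Rightarrow> complex \<Rightarrow> complex" where
  "automorphy A z = of_int (A$2$1) * z + of_int (A$2$2)"

definition moebius :: "int^2^2 \<Rightarrow> complex \<Rightarrow> complex" where
  "moebius A z = (of_int (A$1$1) * z + of_int (A$1$2)) / automorphy A z"

text \<open>
  The holomorphic logarithm on the upper half-plane of the Dedekind eta function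
  \<open>exp (\<pi>iz/12) (\<Prod>n\<ge>1. 1 - exp (2\<pi>inz))\<close> that is real on the imaginary axis.
  Powers of eta are formed with this logarithm (the principal logarithm of the values of eta would
  not be continuous).
\<close>

definition log_eta :: "complex \<Rightarrow> complex" where
  "log_eta z = of_real pi * \<i> * z / 12 +
     (\<Sum>n. Ln (1 - exp (2 * of_real pi * \<i> * of_nat (Suc n) * z)))"

definition eta_power :: "real \<Rightarrow> complex \<Rightarrow> complex" where
  "eta_power s z = exp (of_real s * log_eta z)"

text \<open>
  In the Isabelle library \<open>Arg\<close> takes its values in \<open>(-\<pi>, \<pi>]\<close>, and the complex \<open>powr\<close> uses this
  argument. The value \<open>v A\<close> is given by the eta quotient at any point of the upper half-plane, the
  quotient being independent of that point.
\<close>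

definition is_eta_multiplier :: "real \<Rightarrow> (int^2^2 \<Rightarrow> complex) \<Rightarrow> bool" where
  "is_eta_multiplier p v \<longleftrightarrow>
     (\<forall>A\<in>SL2Z. \<forall>z\<in>upper_half_plane.
        v A = eta_power (2 * p) (moebius A z) /
              (automorphy A z powr of_real p * eta_power (2 * p) z))"

definition multiplier_system :: "real \<Rightarrow> (int^2^2 \<Rightarrow> complex) \<Rightarrow> bool" where
  "multiplier_system r v \<longleftrightarrow>
     (\<exists>p. (\<exists>n::int. p = r + 2 * of_int n) \<and> is_eta_multiplier p v)"


section \<open>Cusp forms and the Petersson scalar product\<close>

definition cusp_forms :: "real \<Rightarrow> (int^2^2 \<Rightarrow> complex) \<Rightarrow> (complex \<Rightarrow> complex) set" where
  "cusp_forms r v = {f.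
     f holomorphic_on upper_half_plane \<and>
     (\<forall>A\<in>SL2Z. \<forall>z\<in>upper_half_plane.
        f (moebius A z) = v A * automorphy A z powr of_real r * f z) \<and>
     (\<forall>a>0. f \<in> O[filtercomap Im at_top](\<lambda>z. of_real (Im z powr (- a))))}"

text \<open>
  The integral of an invariant function over the quotient of the upper half-plane by the modular
  group is the integral over the standard fundamental domain, whose boundary is a null set.
\<close>

definition fundamental_domain :: "complex set" where
  "fundamental_domain = {z. Im z > 0 \<and> \<bar>Re z\<bar> \<le> 1/2 \<and> norm z \<ge> 1}"

definition petersson :: "real \<Rightarrow> (complex \<Rightarrow> complex) \<Rightarrow> (complex \<Rightarrow> complex) \<Rightarrow> complex" where
  "petersson r f1 f2 =
     set_lebesgue_integral lborel fundamental_domain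
       (\<lambda>\<tau>. f1 \<tau> * cnj (f2 \<tau>) * of_real (Im \<tau> powr r) / of_real ((Im \<tau>)\<^sup>2))"


section \<open>The cocycles of Eichler and Knopp\<close>

datatype endpoint = Interior complex | Rational_Cusp rat | Cusp_Infinity

text \<open>
  Integrals up to a cusp are improper: the cusp is approached along a vertical half-line.
\<close>

primrec approach :: "endpoint \<Rightarrow> complex filter" where
  "approach (Interior z) = principal {z}"
| "approach (Rational_Cusp q) = filtermap (\<lambda>y. of_rat q + \<i> * of_real y) (at_right 0)"
| "approach Cusp_Infinity = filtermap (\<lambda>y. \<i> * of_real y) at_top"

text \<open>
  As the integrand is holomorphic on the upper half-plane, it suffices to integrate along segments.
\<close>

definition eichler_cocycle ::
    "real \<Rightarrow> (complex \<Rightarrow> complex) \<Rightarrow> endpoint \<Rightarrow> endpoint \<Rightarrow> complex \<Rightarrow> complex" where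
  "eichler_cocycle r f e1 e2 t =
     Lim (approach e1 \<times>\<^sub>F approach e2)
       (\<lambda>(z1, z2). contour_integral (linepath z1 z2) (\<lambda>\<tau>. f \<tau> * (\<tau> - t) powr of_real (r - 2)))"

definition knopp_cocycle ::
    "real \<Rightarrow> (complex \<Rightarrow> complex) \<Rightarrow> endpoint \<Rightarrow> endpoint \<Rightarrow> complex \<Rightarrow> complex" where
  "knopp_cocycle r f e1 e2 z = cnj (eichler_cocycle r f e1 e2 (cnj z))"

lemma eichler_cocycle_Interior:
  "eichler_cocycle r f (Interior z1) (Interior z2) t =
     contour_integral (linepath z1 z2) (\<lambda>\<tau>. f \<tau> * (\<tau> - t) powr of_real (r - 2))"
proof -
  let ?F = "\<lambda>(z1, z2). contour_integral (linepath z1 z2)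
                         (\<lambda>\<tau>. f \<tau> * (\<tau> - t) powr of_real (r - 2))"
  have "(?F \<longlongrightarrow> ?F (z1, z2)) (principal {(z1, z2)})"
    by (rule tendsto_principal_singleton)
  then have "Lim (principal {(z1, z2)}) ?F = ?F (z1, z2)"
    by (intro tendsto_Lim) (simp_all add: principal_eq_bot_iff)
  then show ?thesis
    by (simp add: eichler_cocycle_def principal_prod_principal)
qed


section \<open>The bracket\<close>

definition plus_part :: "real \<Rightarrow> (complex \<Rightarrow> complex) \<Rightarrow> complex \<Rightarrow> complex" where
  "plus_part k h z = (- \<i> - z) powr of_real k * h z"

definition minus_part :: "real \<Rightarrow> (complex \<Rightarrow> complex) \<Rightarrow> complex \<Rightarrow> complex" where
  "minus_part k f t = (\<i> - t) powr of_real k * f t"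

definition cayley :: "complex \<Rightarrow> complex" where
  "cayley z = (z - \<i>) / (z + \<i>)"

definition cayley_inv :: "complex \<Rightarrow> complex" where
  "cayley_inv w = \<i> * (1 + w) / (1 - w)"

text \<open>
  With \<open>w = cayley z\<close> the coordinate \<open>u = 1/w = (z + \<i>) / (z - \<i>)\<close> maps the lower half-plane onto
  the open unit disc (with \<open>z = - \<i>\<close> going to \<open>u = 0\<close>) and the real projective line onto the unit
  circle. Hence the holomorphic extension required of \<open>minus_part k f\<close>, and its expansion in
  nonpositive powers of \<open>w\<close>, are expressed as an extension to a neighbourhood of the closed unit
  disc and as a Taylor expansion at \<open>0\<close> in terms of \<open>u\<close>.
\<close>

definition bracket_defined :: "real \<Rightarrow> (complex \<Rightarrow> complex) \<Rightarrow> (complex \<Rightarrow> complex) \<Rightarrow> bool" where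
  "bracket_defined k h f \<longleftrightarrow>
     h holomorphic_on upper_half_plane \<and>
     f holomorphic_on lower_half_plane \<and>
     (\<exists>U g. open U \<and> cball 0 1 \<subseteq> U \<and> g holomorphic_on U \<and>
        (\<forall>t\<in>lower_half_plane. g ((t + \<i>) / (t - \<i>)) = minus_part k f t)) \<and>
     (k \<in> \<int>\<^sub>\<le>\<^sub>0 \<longrightarrow>
        (\<exists>P :: complex poly. real (degree P) \<le> \<bar>k\<bar> \<and> (\<forall>t\<in>lower_half_plane. f t = poly P t)))"

text \<open>
  \<open>minus_coeff k f n\<close> is the coefficient \<open>d\<^bsub>-n\<^esub>\<close> of \<open>w\<close> to the power \<open>- n\<close>; note that
  \<open>u \<mapsto> \<i> (u + 1) / (u - 1)\<close> is the inverse of the coordinate \<open>u\<close>.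
\<close>

definition minus_coeff :: "real \<Rightarrow> (complex \<Rightarrow> complex) \<Rightarrow> nat \<Rightarrow> complex" where
  "minus_coeff k f n =
     (deriv ^^ n) (\<lambda>u. minus_part k f (\<i> * (u + 1) / (u - 1))) 0 / fact n"

text \<open>
  If \<open>k\<close> is a nonpositive integer, then only the terms with \<open>n \<le> \<bar>k\<bar>\<close>, for which the Pochhammer
  symbol does not vanish, occur in \<open>sigma\<close>.
\<close>

definition sigma_coeff :: "real \<Rightarrow> (complex \<Rightarrow> complex) \<Rightarrow> nat \<Rightarrow> complex" where
  "sigma_coeff k f n =
     (if k \<in> \<int>\<^sub>\<le>\<^sub>0 \<and> real n > \<bar>k\<bar> then 0
      else fact n / pochhammer (of_real k) n * minus_coeff k f n)"

definition sigma :: "real \<Rightarrow> (complex \<Rightarrow> complex) \<Rightarrow> complex \<Rightarrow> complex" where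
  "sigma k f w = (\<Sum>n. sigma_coeff k f n * inverse w ^ (n + 1))"

text \<open>
  The circles \<open>\<bar>w\<bar> = c\<close> inside the unit disc that lie in the domain of \<open>sigma k f\<close>.
\<close>

definition sigma_radius :: "real \<Rightarrow> (complex \<Rightarrow> complex) \<Rightarrow> real \<Rightarrow> bool" where
  "sigma_radius k f c \<longleftrightarrow>
     0 < c \<and> c < 1 \<and> ereal (inverse c) < conv_radius (sigma_coeff k f)"

text \<open>
  If \<open>bracket_defined k h f\<close> holds, then there are circles as required, and all of them give the
  same integral; so the choice is immaterial.
\<close>

definition bracket :: "real \<Rightarrow> (complex \<Rightarrow> complex) \<Rightarrow> (complex \<Rightarrow> complex) \<Rightarrow> complex" where
  "bracket k h f =
     (1 / of_real pi) *
     contour_integral (cayley_inv \<circ> circlepath 0 (SOME c. sigma_radius k f c))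
       (\<lambda>z. plus_part k h z * sigma k f (cayley z) / (z + \<i>)\<^sup>2)"

end

theory Submission
  imports Defs
begin

text \<open>
  Write \<open>k = 2 - r\<close>. In the coordinates \<open>w\<close> and \<open>u = 1 / w\<close> the kernel \<open>(\<tau> - t)\<close> to the power \<open>- k\<close> is,
  up to factors depending on \<open>t\<close> alone and on \<open>\<tau>\<close> alone, the binomial series of
  \<open>(1 - u * cayley \<tau>)\<close> to the power \<open>- k\<close>. Its coefficients are exactly
  the Pochhammer quotients that \<open>sigma\<close> divides out, so that Cauchy's formula gives
  \<open>[h, f]\<^sub>k = (-2i)\<^sup>k \<integral> f1 h d\<tau>\<close> for the Eichler cocycle \<open>f\<close> of \<open>f1\<close> along the
  segment from \<open>rho - 1\<close> to \<open>rho\<close>.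

  For the Knopp cocycle \<open>h\<close> of \<open>f2\<close> let \<open>E \<tau>\<close> be the same integral with lower endpoint \<open>\<tau>\<close> in place
  of \<open>\<i>\<close>. Then \<open>f1 E d\<tau>\<close> is invariant under translation, and its exterior derivative is a constant
  multiple of the integrand of the Petersson product. By Stokes' theorem the Petersson product is
  the integral of \<open>f1 E d\<tau>\<close> along the lower arc of the fundamental domain. Replacing \<open>E\<close> by \<open>h\<close>
  does not change that integral: the difference is odd under the inversion, which reverses the arc.
\<close>

section \<open>Stokes' theorem on the fundamental domain\<close>

text \<open>All powers are principal, so no law of exponents is free: each time a base is factored,
  the arguments are located first, in a half-plane or through the sign of a sine. The constants then
  fit together. The density that Stokes' theorem produces contains (\<open>cnj \<tau>\<close> -
  \<tau>)^(r-2) = (-2i)^(r-2) y^(r-2), which cancels the factor (-2i)^(2-r) of the bracket; the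
  surviving -2i is the 2i in d(\<open>cnj \<tau>\<close>) d\<tau> = 2i dx dy, with the sign from
  lowering the lower endpoint of E. E is handled as h minus the integral from \<i> to \<tau>.
  Inversion fixes \<i>, so that second piece transforms without an additive constant; translation
  moves \<i>, and there the constant has to be found by a limit at the cusp. For k a nonpositive
  integer, \<open>sigma\<close> discards all terms beyond |k|, although the moments of the kernel
  continue. The formula for the bracket survives because the Taylor coefficients of h^+ vanish
  beyond |k|, which is proved separately for the Knopp cocycle.\<close>

lemma lborel_complex_shear:
  fixes g :: "real \<Rightarrow> real"
  assumes [measurable]: "g \<in> borel_measurable borel"
  shows "(lborel :: complex measure) =
    distr (lborel \<Otimes>\<^sub>M lborel) borel (\<lambda>(x, t). Complex x (g x + t))"
proof (rule lborel_eqI)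
  let ?f = "\<lambda>(x, t). Complex x (g x + t)"
  have [measurable]: "?f \<in> borel_measurable (lborel \<Otimes>\<^sub>M lborel)"
    unfolding Complex_eq by measurable
  fix l u :: complex
  assume le: "\<And>b. b \<in> Basis \<Longrightarrow> l \<bullet> b \<le> u \<bullet> b"
  from le[of 1] le[of \<i>] have re: "Re l \<le> Re u" and im: "Im l \<le> Im u"
    by (auto simp: Basis_complex_def)
  let ?A = "?f -` box l u \<inter> space (lborel \<Otimes>\<^sub>M lborel)"
  have A: "?A \<in> sets (lborel \<Otimes>\<^sub>M lborel)"
    by measurable
  \<comment> \<open>The function \<open>g\<close> merely translates each vertical slice, so the
    slice keeps the height of the box.\<close>
  have slice: "Pair x -` ?A = (if x \<in> {Re l<..<Re u} then {Im l - g x<..<Im u - g x} else {})" for x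
    by (auto simp: in_box_complex_iff space_pair_measure)
  have "emeasure (distr (lborel \<Otimes>\<^sub>M lborel) borel ?f) (box l u) = emeasure (lborel \<Otimes>\<^sub>M lborel) ?A"
    by (subst emeasure_distr) auto
  also have "\<dots> = (\<integral>\<^sup>+ x. emeasure lborel (Pair x -` ?A) \<partial>lborel)"
    by (rule lborel.emeasure_pair_measure_alt[OF A])
  also have "\<dots> = (\<integral>\<^sup>+ x. ennreal (Im u - Im l) * indicator {Re l<..<Re u} x \<partial>lborel)"
    unfolding slice using im by (intro nn_integral_cong) (auto simp: indicator_def)
  also have "\<dots> = ennreal (Im u - Im l) * ennreal (Re u - Re l)"
    using re by (subst nn_integral_cmult_indicator) auto
  also have "\<dots> = (\<Prod>b\<in>Basis. (u - l) \<bullet> b)"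
    using re im by (simp add: Basis_complex_def ennreal_mult mult.commute)
  finally show "emeasure (distr (lborel \<Otimes>\<^sub>M lborel) borel ?f) (box l u) = (\<Prod>b\<in>Basis. (u - l) \<bullet> b)" .
qed simp

section \<open>The lower arc of the fundamental domain\<close>

text \<open>The parameter is the real part and not the angle: the coordinates (x, t), for the point
  \<open>unit_arc x + \<i> * of_real t\<close>, then straighten the fundamental domain to
  [-1/2, 1/2] x [0, infinity) with Jacobian 1.\<close>

definition unit_arc :: "real \<Rightarrow> complex" where
  "unit_arc x = Complex x (sqrt (1 - x\<^sup>2))"

definition unit_arc_deriv :: "real \<Rightarrow> complex" where
  "unit_arc_deriv x = Complex 1 (- x / sqrt (1 - x\<^sup>2))"

lemma Re_unit_arc [simp]: "Re (unit_arc x) = x" and Re_unit_arc_deriv [simp]: "Re (unit_arc_deriv x) = 1"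
  by (simp_all add: unit_arc_def unit_arc_deriv_def)

lemma one_minus_square_ge:
  fixes x :: real
  assumes "x \<in> {-1/2..1/2}"
  shows "3/4 \<le> 1 - x\<^sup>2"
proof -
  have "x\<^sup>2 \<le> (1/2)\<^sup>2"
    by (rule power2_le_iff_abs_le[THEN iffD2]) (use assms in auto)
  then show ?thesis by (simp add: power2_eq_square)
qed

text \<open>The minimum is sqrt 3 / 2; the simpler bound 1/2 still lets the arc slide down by any
  amount below 1/2 inside the upper half-plane, so that t = 0 becomes an interior point of the range
  of t.\<close>

lemma Im_unit_arc_ge:
  assumes "x \<in> {-1/2..1/2}"
  shows "1/2 \<le> Im (unit_arc x)"
proof -
  have "sqrt ((1/2)\<^sup>2) \<le> sqrt (1 - x\<^sup>2)"
    using one_minus_square_ge[OF assms] by (intro real_sqrt_le_mono) (simp add: power2_eq_square)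
  then show ?thesis by (simp add: unit_arc_def)
qed

lemma unit_arc_has_vector_derivative:
  assumes "x \<in> {-1/2..1/2}"
  shows "(unit_arc has_vector_derivative unit_arc_deriv x) (at x within S)"
proof -
  have "((\<lambda>x. of_real x + \<i> * of_real (sqrt (1 - x\<^sup>2))) has_vector_derivative
         of_real 1 + \<i> * of_real (- x / sqrt (1 - x\<^sup>2))) (at x within S)"
    by (intro derivative_intros has_vector_derivative_of_real)
       (use one_minus_square_ge[OF assms] in \<open>auto intro!: derivative_eq_intros simp: field_simps\<close>)
  then show ?thesis
    by (simp add: unit_arc_def[abs_def] unit_arc_deriv_def Complex_eq)
qed

lemma continuous_on_unit_arc: "continuous_on {-1/2..1/2} unit_arc"
  using unit_arc_has_vector_derivative by (meson continuous_on_vector_derivative)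

lemma continuous_on_unit_arc_deriv: "continuous_on {-1/2..1/2} unit_arc_deriv"
  unfolding unit_arc_deriv_def[abs_def] Complex_eq
  by (intro continuous_intros) (use one_minus_square_ge in fastforce)

lemma unit_arc_in_fundamental_domain_iff:
  assumes "x \<in> {-1/2..1/2}"
  shows "Complex x (sqrt (1 - x\<^sup>2) + t) \<in> fundamental_domain \<longleftrightarrow> t \<ge> 0"
proof -
  have p: "sqrt (1 - x\<^sup>2) > 0" using one_minus_square_ge[OF assms] by simp
  let ?y = "sqrt (1 - x\<^sup>2) + t"
  have *: "norm (Complex x y) \<ge> 1 \<longleftrightarrow> y \<ge> sqrt (1 - x\<^sup>2)" if "y > 0" for y
  proof -
    have "norm (Complex x y) \<ge> 1 \<longleftrightarrow> 1 - x\<^sup>2 \<le> y\<^sup>2"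
      by (simp add: cmod_def) (auto simp: algebra_simps)
    also have "\<dots> \<longleftrightarrow> sqrt (1 - x\<^sup>2) \<le> sqrt (y\<^sup>2)"
      by (rule real_sqrt_le_iff[symmetric])
    finally show ?thesis using that by simp
  qed
  \<comment> \<open>The norm criterion holds only above the real axis: for very negative t the point
    lies below it, possibly with norm greater than 1.\<close>
  show ?thesis
  proof (cases "?y > 0")
    case True
    then show ?thesis using *[OF True] assms by (auto simp: fundamental_domain_def)
  next
    case False
    then have "\<not> t \<ge> 0" using p by linarith
    then show ?thesis using False by (simp add: fundamental_domain_def)
  qed
qed

lemma fundamental_domain_subset: "fundamental_domain \<subseteq> upper_half_plane"
  by (auto simp: fundamental_domain_def upper_half_plane_def)

text \<open>The strict inequality is harmless: a real z in the strip has norm at most 1/2, so the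
  other conditions already exclude the real axis.\<close>

lemma closed_fundamental_domain: "closed fundamental_domain"
proof -
  have "fundamental_domain = {z. Im z \<ge> 0} \<inter> {z. \<bar>Re z\<bar> \<le> 1/2} \<inter> {z. norm z \<ge> 1}"
  proof safe
    fix z assume z: "0 \<le> Im z" "\<bar>Re z\<bar> \<le> 1/2" "1 \<le> norm z"
    have "Im z \<noteq> 0" using z by (auto simp: cmod_eq_Re)
    then show "z \<in> fundamental_domain" using z by (simp add: fundamental_domain_def)
  qed (auto simp: fundamental_domain_def)
  also have "closed \<dots>"
    by (intro closed_Int closed_Collect_le continuous_intros)
  finally show ?thesis .
qed

lemma unit_arc_add_in_upper_half_plane:
  assumes "x \<in> {-1/2..1/2}" "t > -1/2"
  shows "unit_arc x + \<i> * of_real t \<in> upper_half_plane"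
  using Im_unit_arc_ge[OF assms(1)] assms(2) by (simp add: upper_half_plane_def)

lemma unit_arc_add_in_fundamental_domain_iff:
  assumes "x \<in> {-1/2..1/2}"
  shows "unit_arc x + \<i> * of_real t \<in> fundamental_domain \<longleftrightarrow> t \<ge> 0"
proof -
  have "unit_arc x + \<i> * of_real t = Complex x (sqrt (1 - x\<^sup>2) + t)"
    by (simp add: unit_arc_def complex_eq_iff)
  then show ?thesis using unit_arc_in_fundamental_domain_iff[OF assms] by simp
qed

section \<open>Integration in the straightened coordinates\<close>

text \<open>This is the majorant in the direction of t: the point over x has imaginary part at least
  1/2 + t, so a bound M / y^2 turns into this function. Its primitive -1 / (1/2 + t), for M = 1,
  runs from -2 to 0.\<close>

lemma set_integrable_inverse_square_shift:
  "integrable lborel (\<lambda>t::real. indicator {0..} t * (M / (1/2 + t)\<^sup>2))"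
proof -
  have "set_integrable lborel (einterval 0 \<infinity>) (\<lambda>t. 1 / (1/2 + t)\<^sup>2)"
  proof (rule interval_integral_FTC_nonneg(1))
    show "((\<lambda>t. - (1 / (1/2 + t))) has_real_derivative 1 / (1/2 + x)\<^sup>2) (at x)" if "0 < ereal x" for x
      using that by (auto intro!: derivative_eq_intros simp: power2_eq_square field_simps)
    show "isCont (\<lambda>t. 1 / (1/2 + t)\<^sup>2) x" if "0 < ereal x" for x :: real
      using that by (intro continuous_intros) auto
    show "(((\<lambda>t::real. - (1 / (1/2 + t))) \<circ> real_of_ereal) \<longlongrightarrow> - 2) (at_right 0)"
      unfolding zero_ereal_def ereal_tendsto_simps by (auto intro!: tendsto_eq_intros)
    show "(((\<lambda>t::real. - (1 / (1/2 + t))) \<circ> real_of_ereal) \<longlongrightarrow> 0) (at_left \<infinity>)"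
      unfolding ereal_tendsto_simps by real_asymp
  qed auto
  then have int: "integrable lborel (\<lambda>t::real. M * (indicator {0<..} t * (1 / (1/2 + t)\<^sup>2)))"
    by (intro integrable_mult_right) (simp add: set_integrable_def zero_ereal_def einterval_def greaterThan_def)
  have ae: "AE t in lborel. M * (indicator {0<..} t * (1 / (1/2 + t)\<^sup>2)) =
      indicator {0..} t * (M / (1/2 + t)\<^sup>2)" 
    using AE_lborel_singleton[of "0::real"] by eventually_elim (auto simp: indicator_def)
  show ?thesis
    by (rule integrable_cong_AE_imp[OF int _ ae]) measurable
qed

lemma integrable_on_sheared_fundamental_domain:
  fixes b :: "complex \<Rightarrow> complex"
  assumes b: "continuous_on upper_half_plane b"
    and bound: "\<And>\<tau>. \<tau> \<in> fundamental_domain \<Longrightarrow> norm (b \<tau>) \<le> M / (Im \<tau>)\<^sup>2"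
  defines "k \<equiv> (\<lambda>x t. indicator {-1/2..1/2} x *\<^sub>R indicator {0..} t *\<^sub>R b (unit_arc x + \<i> * of_real t))"
  shows "integrable (lborel \<Otimes>\<^sub>M lborel) (case_prod k)"
    and "set_lebesgue_integral lborel fundamental_domain b = integral\<^sup>L (lborel \<Otimes>\<^sub>M lborel) (case_prod k)"
proof -
  \<comment> \<open>For |x| > 1 the function \<open>sqrt\<close> takes a negative argument and
    returns a negative real, so this is a shear of the whole plane; the indicator of the domain
    discards those x.\<close>
  let ?\<Psi> = "\<lambda>(x, t). Complex x (sqrt (1 - x\<^sup>2) + t)"
  let ?g = "\<lambda>\<tau>. indicator fundamental_domain \<tau> *\<^sub>R b \<tau>"
  have g [measurable]: "?g \<in> borel_measurable borel"
    using b closed_fundamental_domain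
    by (intro borel_measurable_continuous_on_indicator)
       (auto intro: continuous_on_subset[OF _ fundamental_domain_subset])
  have \<Psi> [measurable]: "?\<Psi> \<in> borel_measurable (lborel \<Otimes>\<^sub>M lborel)"
    unfolding Complex_eq by measurable
  have k: "case_prod k = (\<lambda>p. ?g (?\<Psi> p))"
  proof
    fix p :: "real \<times> real"
    obtain x t where p: "p = (x, t)" by force
    have eq: "unit_arc x + \<i> * of_real t = Complex x (sqrt (1 - x\<^sup>2) + t)"
      by (simp add: unit_arc_def complex_eq_iff)
    show "case_prod k p = ?g (?\<Psi> p)"
    proof (cases "x \<in> {-1/2..1/2}")
      case True
      then show ?thesis using unit_arc_in_fundamental_domain_iff[OF True, of t]
        by (simp add: p k_def eq indicator_def)
    next
      case False
      then have "Complex x (sqrt (1 - x\<^sup>2) + t) \<notin> fundamental_domain"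
        by (auto simp: fundamental_domain_def)
      then show ?thesis using False by (simp add: p k_def)
    qed
  qed
  have km [measurable]: "case_prod k \<in> borel_measurable (lborel \<Otimes>\<^sub>M lborel)"
    unfolding k by measurable
  let ?G = "\<lambda>(x::real, t::real). indicator {-1/2..1/2} x * (indicator {0..} t * (M / (1/2 + t)\<^sup>2))"
  \<comment> \<open>The bound at \<i>, whose imaginary part is 1, forces M to be
    nonnegative.\<close>
  have M0: "M \<ge> 0"
  proof -
    have "\<i> \<in> fundamental_domain" by (simp add: fundamental_domain_def)
    from order_trans[OF norm_ge_zero bound[OF this]] show ?thesis by simp
  qed
  have "integrable (lborel \<Otimes>\<^sub>M lborel) ?G"
  proof (rule lborel_pair.Fubini_integrable)
    have eq: "(\<lambda>x. \<integral>t. norm (?G (x, t)) \<partial>lborel) =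
      (\<lambda>x. norm (indicator {-1/2..1/2} x :: real) * (\<integral>t. norm (indicator {0..} t * (M / (1/2 + t)\<^sup>2)) \<partial>lborel))"
      by (simp only: prod.case norm_mult integral_mult_right_zero)
    show "integrable lborel (\<lambda>x. \<integral>t. norm (?G (x, t)) \<partial>lborel)"
      unfolding eq by (intro integrable_mult_left integrable_norm) auto
    show "AE x in lborel. integrable lborel (\<lambda>t. ?G (x, t))"
      unfolding prod.case by (intro AE_I2 integrable_mult_right set_integrable_inverse_square_shift)
  qed measurable
  then show int: "integrable (lborel \<Otimes>\<^sub>M lborel) (case_prod k)"
  proof (rule Bochner_Integration.integrable_bound)
    show "AE p in lborel \<Otimes>\<^sub>M lborel. norm (case_prod k p) \<le> norm (?G p)"
    proof (rule AE_I2)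
      fix p :: "real \<times> real"
      obtain x t where p: "p = (x, t)" by force
      show "norm (case_prod k p) \<le> norm (?G p)"
      proof (cases "x \<in> {-1/2..1/2} \<and> t \<ge> 0")
        case True
        then have x: "x \<in> {-1/2..1/2}" and t: "t \<ge> 0" by auto
        let ?\<tau> = "unit_arc x + \<i> * of_real t"
        have "norm (b ?\<tau>) \<le> M / (Im ?\<tau>)\<^sup>2"
          using unit_arc_add_in_fundamental_domain_iff[OF x, of t] t by (intro bound) simp
        also have "\<dots> \<le> M / (1/2 + t)\<^sup>2"
          using Im_unit_arc_ge[OF x] t M0
          by (intro divide_left_mono power_mono mult_pos_pos) auto
        finally show ?thesis using x t M0 by (simp add: p k_def)
      qed (auto simp: p k_def indicator_def)
    qed
  qed measurable
  have "set_lebesgue_integral lborel fundamental_domain b = integral\<^sup>L lborel ?g"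
    by (simp add: set_lebesgue_integral_def)
  also have "\<dots> = integral\<^sup>L (distr (lborel \<Otimes>\<^sub>M lborel) borel ?\<Psi>) ?g"
    by (rule arg_cong[where f = "\<lambda>M. integral\<^sup>L M ?g"], rule lborel_complex_shear) measurable
  also have "\<dots> = integral\<^sup>L (lborel \<Otimes>\<^sub>M lborel) (\<lambda>p. ?g (?\<Psi> p))"
    by (rule integral_distr) measurable
  finally show "set_lebesgue_integral lborel fundamental_domain b = integral\<^sup>L (lborel \<Otimes>\<^sub>M lborel) (case_prod k)"
    by (simp only: k)
qed

text \<open>
  Stokes' theorem for the one-form \<open>J d\<tau>\<close>. Sliding the bottom arc upwards by \<open>t\<close> turns the region
  into a rectangle, on which the statement becomes a differentiation under the integral sign.
\<close>

lemma stokes_fundamental_domain: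
  fixes J a b :: "complex \<Rightarrow> complex"
  assumes J: "\<And>\<tau>. \<tau> \<in> upper_half_plane \<Longrightarrow> (J has_derivative (\<lambda>h. a \<tau> * h + b \<tau> * cnj h)) (at \<tau>)"
    and a: "continuous_on upper_half_plane a" and b: "continuous_on upper_half_plane b"
    and per: "\<And>y. y > 0 \<Longrightarrow> J (Complex (1/2) y) = J (Complex (-1/2) y)"
    and J_bound: "\<And>\<tau>. \<tau> \<in> fundamental_domain \<Longrightarrow> norm (J \<tau>) \<le> M / Im \<tau>"
    and b_bound: "\<And>\<tau>. \<tau> \<in> fundamental_domain \<Longrightarrow> norm (b \<tau>) \<le> M / (Im \<tau>)\<^sup>2"
  shows "integral {-1/2..1/2} (\<lambda>x. J (unit_arc x) * unit_arc_deriv x) =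
         2 * \<i> * set_lebesgue_integral lborel fundamental_domain b"
proof -
  define I :: "real set" where "I = {-1/2..1/2}"
  \<comment> \<open>An open neighbourhood of [0, infinity): derivatives in t are two-sided, even at
    t = 0 where the boundary arc lies.\<close>
  define U :: "real set" where "U = {-1/2<..}"
  define p where "p = (\<lambda>x t. unit_arc x + \<i> * of_real t)"
  note H = unit_arc_add_in_upper_half_plane
  have pH: "p x t \<in> upper_half_plane" if "x \<in> I" "t \<in> U" for x t
    using that H[of x t] by (simp add: p_def I_def U_def)
  have J_cont: "continuous_on upper_half_plane J"
    using J by (meson continuous_at_imp_continuous_on has_derivative_continuous)
  have p_cont: "continuous_on (U \<times> I) (\<lambda>(t, x). p x t)"
    unfolding p_def split_beta I_def
    by (intro continuous_intros continuous_on_compose2[OF continuous_on_unit_arc]) auto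
  have cont: "continuous_on (U \<times> I) (\<lambda>(t, x). F (p x t))"
    if "continuous_on upper_half_plane F" for F :: "complex \<Rightarrow> complex"
    using continuous_on_compose2[OF that p_cont] pH by (force simp: split_beta)
  have arc'_cont: "continuous_on (U \<times> I) (\<lambda>(t, x). unit_arc_deriv x)"
    unfolding split_beta I_def
    by (intro continuous_intros continuous_on_compose2[OF continuous_on_unit_arc_deriv]) auto
  have slice: "continuous_on I (\<lambda>x. F t x)" if "continuous_on (U \<times> I) (\<lambda>(t, x). F t x)" "t \<in> U"
    for F :: "real \<Rightarrow> real \<Rightarrow> complex" and t
  proof -
    have "continuous_on I (\<lambda>x. (\<lambda>(t, x). F t x) (t, x))"
      by (rule continuous_on_compose2[OF that(1)]) (use that(2) in \<open>auto intro!: continuous_intros\<close>)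
    then show ?thesis by simp
  qed
  define B where "B = (\<lambda>t. integral I (\<lambda>x. J (p x t) * unit_arc_deriv x))"
  define b' where "b' = (\<lambda>t. integral I (\<lambda>x. b (p x t)))"
  have IJ: "I = cbox (-1/2) (1/2)" by (simp add: I_def)
  have dB: "(B has_vector_derivative - 2 * \<i> * b' t) (at t)" if t: "t \<in> U" for t
  proof -
    let ?D = "\<lambda>t x. (a (p x t) * \<i> - b (p x t) * \<i>) * unit_arc_deriv x"
    have "(B has_vector_derivative integral I (?D t)) (at t within U)"
      unfolding B_def IJ
    proof (rule leibniz_rule_vector_derivative)
      fix s x assume s: "s \<in> U" and x: "x \<in> cbox (-1/2) (1/2 :: real)"
      have "((\<lambda>t. p x t) has_vector_derivative \<i>) (at s within U)"
        unfolding p_def by (auto intro!: derivative_eq_intros)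
      moreover have "(J has_derivative (\<lambda>h. a (p x s) * h + b (p x s) * cnj h)) (at (p x s) within p x ` U)"
        using J pH x s by (auto simp: IJ intro: has_derivative_at_withinI)
      ultimately have "((J \<circ> (\<lambda>t. p x t)) has_vector_derivative a (p x s) * \<i> + b (p x s) * cnj \<i>) (at s within U)"
        by (rule vector_derivative_diff_chain_within)
      then have "((\<lambda>t. J (p x t)) has_vector_derivative a (p x s) * \<i> - b (p x s) * \<i>) (at s within U)"
        by (simp add: o_def)
      then show "((\<lambda>t. J (p x t) * unit_arc_deriv x) has_vector_derivative ?D s x) (at s within U)"
        by (rule has_vector_derivative_mult_left)
    next
      fix s assume "s \<in> U"
      then show "(\<lambda>x. J (p x s) * unit_arc_deriv x) integrable_on cbox (-1/2) (1/2)"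
        using cont[OF J_cont] arc'_cont
        by (intro integrable_continuous continuous_intros slice[unfolded IJ]) (auto simp: IJ)
    next
      show "continuous_on (U \<times> cbox (-1/2) (1/2)) (\<lambda>(t, x). ?D t x)"
        using cont[OF a] cont[OF b] arc'_cont unfolding split_beta IJ by (intro continuous_intros)
    qed (use t in \<open>auto simp: U_def\<close>)
    moreover have "integral I (?D t) = - 2 * \<i> * b' t"
    proof -
      let ?E = "\<lambda>x. \<i> * (a (p x t) * unit_arc_deriv x + b (p x t) * cnj (unit_arc_deriv x))"
      \<comment> \<open>The x-derivative of J along the slid arc, times \<i>. Its integral is the
        difference of J at the two vertical sides, which periodicity makes 0.\<close>
      have "(?E has_integral (\<i> * J (p (1/2) t) - \<i> * J (p (-1/2) t))) {-1/2..1/2}"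
      proof (rule fundamental_theorem_of_calculus)
        fix x assume x: "x \<in> {-1/2..1/2 :: real}"
        have "((\<lambda>x. p x t) has_vector_derivative unit_arc_deriv x) (at x within {-1/2..1/2})"
          unfolding p_def using unit_arc_has_vector_derivative[OF x, of "{-1/2..1/2}"]
          by (auto intro!: derivative_eq_intros)
        moreover have "(J has_derivative (\<lambda>h. a (p x t) * h + b (p x t) * cnj h))
            (at (p x t) within (\<lambda>x. p x t) ` {-1/2..1/2})"
          using J pH x t by (auto simp: I_def intro: has_derivative_at_withinI)
        ultimately have "((J \<circ> (\<lambda>x. p x t)) has_vector_derivative
            a (p x t) * unit_arc_deriv x + b (p x t) * cnj (unit_arc_deriv x)) (at x within {-1/2..1/2})"
          by (rule vector_derivative_diff_chain_within)
        then show "((\<lambda>x. \<i> * J (p x t)) has_vector_derivative ?E x) (at x within {-1/2..1/2})"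
          by (intro has_vector_derivative_mult_right) (simp add: o_def)
      qed simp
      moreover have "J (p (1/2) t) = J (p (-1/2) t)"
      proof -
        have "Im (p (1/2) t) > 0" using pH[of "1/2" t] t by (simp add: I_def upper_half_plane_def)
        moreover have "p (1/2) t = Complex (1/2) (Im (p (1/2) t))" "p (-1/2) t = Complex (-1/2) (Im (p (1/2) t))"
          by (simp_all add: p_def unit_arc_def complex_eq_iff)
        ultimately show ?thesis using per by metis
      qed
      ultimately have E: "(?E has_integral 0) I" by (simp add: I_def)
      have "(\<lambda>x. b (p x t)) integrable_on I"
        unfolding IJ using cont[OF b] t by (intro integrable_continuous slice[unfolded IJ]) (auto simp: IJ)
      then have "((\<lambda>x. (- 2 * \<i>) * b (p x t)) has_integral (- 2 * \<i>) * b' t) I"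
        unfolding b'_def by (intro has_integral_mult_right integrable_integral)
      from has_integral_add[OF E this]
      have "((\<lambda>x. ?E x + (- 2 * \<i>) * b (p x t)) has_integral - 2 * \<i> * b' t) I" by simp
      \<comment> \<open>Subtracting the total derivative \<open>?E\<close> from the t-derivative
        \<open>?D\<close> cancels the terms with \<open>a\<close> and leaves -\<i> b times (z +
        \<open>cnj z\<close>) for z = \<open>unit_arc_deriv x\<close>. That sum is 2, because the
        arc is parametrised by its real part.\<close>
      moreover have "?E x + (- 2 * \<i>) * b (p x t) = ?D t x" for x
        by (simp add: complex_eq_iff algebra_simps)
      ultimately have "(?D t has_integral - 2 * \<i> * b' t) I" by simp
      then show ?thesis by (rule integral_unique)
    qed
    moreover have "at t within U = at t"
      using t by (intro at_within_open) (auto simp: U_def)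
    ultimately show ?thesis by simp
  qed
  have b'_cont: "continuous_on U b'"
    unfolding b'_def IJ using cont[OF b] unfolding IJ by (rule integral_continuous_on_param)
  define k where "k = (\<lambda>x t. indicator {-1/2..1/2} x *\<^sub>R indicator {0..} t *\<^sub>R b (unit_arc x + \<i> * of_real t))"
  have k: "integrable (lborel \<Otimes>\<^sub>M lborel) (case_prod k)"
     and Fk: "set_lebesgue_integral lborel fundamental_domain b = integral\<^sup>L (lborel \<Otimes>\<^sub>M lborel) (case_prod k)"
    using integrable_on_sheared_fundamental_domain[OF b b_bound] unfolding k_def by auto
  have inner: "(\<integral>x. k x t \<partial>lborel) = indicator {0..} t *\<^sub>R b' t" for t
  proof (cases "t \<ge> 0")
    case True
    then have t: "t \<in> U" by (simp add: U_def)
    have "set_integrable lborel {-1/2..1/2} (\<lambda>x. b (p x t))"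
      by (intro borel_integrable_atLeastAtMost' slice[unfolded I_def] cont[OF b, unfolded I_def] t)
    from set_borel_integral_eq_integral(2)[OF this] show ?thesis
      using True by (simp add: k_def set_lebesgue_integral_def p_def b'_def I_def)
  qed (simp add: k_def)
  have k': "integrable lborel (\<lambda>t. indicator {0..} t *\<^sub>R b' t)"
    using lborel_pair.integrable_snd[OF k] by (simp add: inner)
  \<comment> \<open>The fundamental theorem is applied on the open half-line, whereas the region
    contains t = 0; a null set separates them.\<close>
  have ae: "AE t in lborel. indicator {0..} t *\<^sub>R b' t = indicator {0<..} t *\<^sub>R b' t"
    using AE_lborel_singleton[of "0::real"] by eventually_elim (auto simp: indicator_def)
  have m: "(\<lambda>t. indicator {0<..} t *\<^sub>R b' t) \<in> borel_measurable lborel"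
    using borel_measurable_continuous_on_indicator[of "{0<..}" b'] continuous_on_subset[OF b'_cont]
    by (auto simp: U_def)
  have k'': "integrable lborel (\<lambda>t. indicator {0<..} t *\<^sub>R b' t)"
    by (rule integrable_cong_AE_imp[OF k' m ae])
  have "(LBINT t=0..\<infinity>. - 2 * \<i> * b' t) = 0 - B 0"
  proof (rule interval_integral_FTC_integrable)
    show "(B has_vector_derivative - 2 * \<i> * b' t) (at t)" if "0 < ereal t" for t
      using that by (intro dB) (simp add: U_def)
    show "isCont (\<lambda>t. - 2 * \<i> * b' t) t" if "0 < ereal t" for t
    proof -
      have "isCont b' t"
        using b'_cont that by (intro continuous_on_interior[of U]) (auto simp: U_def interior_open)
      then show ?thesis by (intro continuous_intros)
    qed
    have "einterval 0 \<infinity> = {0<..}" by (auto simp: einterval_def)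
    then show "set_integrable lborel (einterval 0 \<infinity>) (\<lambda>t. - 2 * \<i> * b' t)"
      using k'' by (intro set_integrable_mult_right) (simp add: set_integrable_def)
    have "isCont B 0" using dB[of 0] has_vector_derivative_continuous by (auto simp: U_def)
    then show "((B \<circ> real_of_ereal) \<longlongrightarrow> B 0) (at_right 0)"
      unfolding zero_ereal_def ereal_tendsto_simps by (simp add: isCont_def filterlim_at_split)
    obtain N where N: "\<And>x. x \<in> I \<Longrightarrow> norm (unit_arc_deriv x) \<le> N"
    proof -
      have "bounded (unit_arc_deriv ` I)"
        unfolding I_def by (intro compact_imp_bounded compact_continuous_image continuous_on_unit_arc_deriv) auto
      then show ?thesis using that by (auto simp: bounded_iff)
    qed
    \<comment> \<open>The arc slid by t lies above height t, so the decay of J makes the upper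
      boundary term vanish in the limit.\<close>
    have "eventually (\<lambda>t. norm (B t) \<le> M * N / t) at_top"
      using eventually_gt_at_top[of 0]
    proof eventually_elim
      case (elim t)
      have t: "t \<in> U" using elim by (simp add: U_def)
      have le: "norm (J (p x t) * unit_arc_deriv x) \<le> M / t * N" if x: "x \<in> I" for x
      proof -
        have F: "p x t \<in> fundamental_domain"
          using unit_arc_add_in_fundamental_domain_iff[of x t] x elim by (simp add: p_def I_def)
        have M0: "0 \<le> M"
          using order_trans[OF norm_ge_zero J_bound[OF F]] pH[OF x t]
          by (simp add: upper_half_plane_def zero_le_divide_iff)
        have "Im (p x t) \<ge> t" using Im_unit_arc_ge[of x] x by (simp add: p_def I_def)
        then have "M / Im (p x t) \<le> M / t" using elim M0 by (intro divide_left_mono) auto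
        then show ?thesis
          using J_bound[OF F] N[OF x] elim M0 unfolding norm_mult by (intro mult_mono) auto
      qed
      have "norm (B t) \<le> M / t * N * (1/2 - (-1/2))"
        unfolding B_def I_def
        by (rule integral_bound) (use slice[OF cont[OF J_cont] t] slice[OF arc'_cont t] le in
          \<open>auto simp: I_def intro!: continuous_intros\<close>)
      then show ?case by simp
    qed
    moreover have "((\<lambda>t. M * N / t) \<longlongrightarrow> 0) at_top"
      by real_asymp
    ultimately have "(B \<longlongrightarrow> 0) at_top"
      by (rule Lim_null_comparison)
    then show "((B \<circ> real_of_ereal) \<longlongrightarrow> 0) (at_left \<infinity>)"
      unfolding ereal_tendsto_simps .
  qed simp
  moreover have "(LBINT t=0..\<infinity>. - 2 * \<i> * b' t) = - 2 * \<i> * (LBINT t:{0<..}. b' t)"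
    unfolding interval_lebesgue_integral_0_infty by (rule set_integral_mult_right)
  moreover have "(LBINT t:{0<..}. b' t) = (\<integral>t. indicator {0..} t *\<^sub>R b' t \<partial>lborel)"
    unfolding set_lebesgue_integral_def
    by (rule integral_cong_AE[OF m _ _]) (use k' ae in \<open>auto elim: eventually_mono\<close>)
  moreover have "\<dots> = integral\<^sup>L (lborel \<Otimes>\<^sub>M lborel) (case_prod k)"
    using lborel_pair.integral_snd[OF k] by (simp add: inner)
  ultimately have "B 0 = 2 * \<i> * set_lebesgue_integral lborel fundamental_domain b"
    by (simp add: Fk algebra_simps)
  then show ?thesis by (simp add: B_def p_def I_def)
qed

section \<open>The bracket with an integral over a segment\<close>

text \<open>Both arguments lie in (0, pi), so their difference lies in (-pi, pi) and is the
  principal argument of the quotient.\<close>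

lemma powr_divide_upper:
  fixes x y s :: complex
  assumes "Im x > 0" "Im y > 0"
  shows "(x / y) powr s = x powr s / y powr s"
proof -
  have nz: "x \<noteq> 0" "y \<noteq> 0" using assms by auto
  have "Ln (x / y) = Ln x - Ln y"
    by (rule Ln_unique) (use Im_Ln_pos_lt_imp[OF assms(1)] Im_Ln_pos_lt_imp[OF assms(2)] nz in \<open>auto simp: exp_diff\<close>)
  then show ?thesis using nz by (simp add: powr_def exp_diff right_diff_distrib)
qed

text \<open>Both arguments lie in (-pi/2, pi/2), so their sum is still principal.\<close>

lemma powr_mult_Re_pos:
  fixes x y s :: complex
  assumes "Re x > 0" "Re y > 0"
  shows "(x * y) powr s = x powr s * y powr s"
proof -
  have nz: "x \<noteq> 0" "y \<noteq> 0" using assms by auto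
  have "Ln (x * y) = Ln x + Ln y"
    by (rule Ln_unique) (use Re_Ln_pos_lt_imp[OF assms(1)] Re_Ln_pos_lt_imp[OF assms(2)] nz in \<open>auto simp: exp_add\<close>)
  then show ?thesis using nz by (simp add: powr_def exp_add distrib_left)
qed

lemma contour_integral_linepath_has_field_derivative:
  fixes F F' :: "complex \<Rightarrow> complex \<Rightarrow> complex"
  assumes "open U" "convex U" "u \<in> U"
    and F: "\<And>u s. u \<in> U \<Longrightarrow> s \<in> closed_segment a b \<Longrightarrow> ((\<lambda>u. F u s) has_field_derivative F' u s) (at u)"
    and F_cont: "\<And>u. u \<in> U \<Longrightarrow> continuous_on (closed_segment a b) (F u)"
    and F'_cont: "continuous_on (U \<times> closed_segment a b) (\<lambda>(u, s). F' u s)"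
  shows "((\<lambda>u. contour_integral (linepath a b) (F u)) has_field_derivative
           contour_integral (linepath a b) (F' u)) (at u)"
proof -
  have seg: "linepath a b x \<in> closed_segment a b" if "x \<in> {0..1}" for x
    using that by (simp add: linepath_in_path)
  have ci: "contour_integral (linepath a b) G = integral (cbox 0 1) (\<lambda>x. G (linepath a b x) * (b - a))" for G
    by (simp add: contour_integral_integral)
  have "((\<lambda>u. integral (cbox 0 1) (\<lambda>x. F u (linepath a b x) * (b - a))) has_field_derivative
           integral (cbox 0 1) (\<lambda>x. F' u (linepath a b x) * (b - a))) (at u within U)"
  proof (rule leibniz_rule_field_derivative)
    show "((\<lambda>u. F u (linepath a b x) * (b - a)) has_field_derivative F' u (linepath a b x) * (b - a)) (at u within U)"
      if "u \<in> U" "x \<in> cbox 0 1" for u x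
      using F[OF that(1) seg, of x] that by (auto intro: DERIV_cmult_right has_field_derivative_at_within)
    show "(\<lambda>x. F u (linepath a b x) * (b - a)) integrable_on cbox 0 1" if "u \<in> U" for u
      by (intro integrable_continuous continuous_intros continuous_on_compose2[OF F_cont[OF that] continuous_on_linepath])
         (use seg in auto)
    have "continuous_on (U \<times> cbox 0 1) (\<lambda>p. (fst p, linepath a b (snd p)))"
      unfolding linepath_def by (intro continuous_intros)
    then have "continuous_on (U \<times> cbox 0 1) (\<lambda>p. (\<lambda>(u, s). F' u s) (fst p, linepath a b (snd p)))"
      by (rule continuous_on_compose2[OF F'_cont]) (use seg in auto)
    then show "continuous_on (U \<times> cbox 0 1) (\<lambda>(u, x). F' u (linepath a b x) * (b - a))"
      by (auto simp: split_beta intro!: continuous_intros)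
  qed (use assms in auto)
  then show ?thesis
    unfolding at_within_open[OF assms(3,1)] ci .
qed

section \<open>The coordinates w and u on the two half-planes\<close>

text \<open>The inverse of the coordinate u = (t + \<i>) / (t - \<i>), in the form in which it
  occurs inside \<open>minus_coeff\<close>.\<close>

definition lower_point :: "complex \<Rightarrow> complex" where
  "lower_point u = \<i> * (u + 1) / (u - 1)"

lemma Im_lower_point:
  assumes "u \<noteq> 1"
  shows "Im (lower_point u) = ((norm u)\<^sup>2 - 1) / (norm (u - 1))\<^sup>2"
proof -
  have "Re (u - 1) \<noteq> 0 \<or> Im (u - 1) \<noteq> 0" using assms by (auto simp: complex_eq_iff)
  then have "(Re u - 1)\<^sup>2 + (Im u)\<^sup>2 \<noteq> 0" by (auto simp: sum_power2_eq_zero_iff)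
  then show ?thesis
    by (simp add: lower_point_def Im_divide cmod_power2) (simp add: power2_eq_square algebra_simps)
qed

lemma lower_point_in_lower_half_plane:
  assumes "norm u < 1"
  shows "lower_point u \<in> lower_half_plane"
proof -
  have "u \<noteq> 1" using assms by auto
  moreover have "(norm u)\<^sup>2 < 1" using assms by (simp add: abs_square_less_1)
  ultimately show ?thesis
    by (simp add: lower_half_plane_def Im_lower_point divide_less_0_iff)
qed

lemma norm_cayley_less:
  assumes "Im z > 0"
  shows "norm (cayley z) < 1"
proof -
  have "(norm (z - \<i>))\<^sup>2 < (norm (z + \<i>))\<^sup>2"
    using assms by (simp only: cmod_power2) (simp add: power2_eq_square algebra_simps)
  then have "norm (z - \<i>) < norm (z + \<i>)"
    by (rule power2_less_imp_less) simp
  then show ?thesis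
    by (simp add: cayley_def norm_divide divide_less_eq_1)
qed

lemma plus_i_nonzero: "Im z > 0 \<Longrightarrow> z + \<i> \<noteq> 0"
  by (auto simp: complex_eq_iff)

lemma cayley_inv_cayley:
  assumes "Im z > 0"
  shows "cayley_inv (cayley z) = z"
proof -
  have nz: "z + \<i> \<noteq> 0" by (rule plus_i_nonzero[OF assms])
  have "1 + cayley z = 2 * z / (z + \<i>)" "1 - cayley z = 2 * \<i> / (z + \<i>)"
    using nz by (simp_all add: cayley_def divide_simps)
  then show ?thesis using nz by (simp add: cayley_inv_def)
qed

lemma cayley_cayley_inv:
  assumes "w \<noteq> 1"
  shows "cayley (cayley_inv w) = w"
  using assms by (simp add: cayley_def cayley_inv_def field_simps)

text \<open>Conjugation exchanges the two half-planes and carries w to u, so facts about one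
  coordinate give those about the other. At w = 1 both sides are 0 by the convention for division by
  0.\<close>

lemma cnj_cayley_inv: "cnj (cayley_inv w) = lower_point (cnj w)"
proof (cases "w = 1")
  case False
  then have "1 - cnj w \<noteq> 0" "cnj w - 1 \<noteq> 0" by (auto simp: complex_cnj_cancel_iff complex_eq_iff)
  then show ?thesis by (simp add: cayley_inv_def lower_point_def field_simps)
qed (simp add: cayley_inv_def lower_point_def)

lemma cayley_inv_in_upper_half_plane:
  assumes "norm w < 1"
  shows "cayley_inv w \<in> upper_half_plane"
proof -
  have "lower_point (cnj w) \<in> lower_half_plane"
    using assms by (intro lower_point_in_lower_half_plane) simp
  then show ?thesis
    by (simp add: cnj_cayley_inv[symmetric] lower_half_plane_def upper_half_plane_def)
qed

lemma lower_quotient: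
  assumes "t \<in> lower_half_plane"
  shows "norm ((t + \<i>) / (t - \<i>)) < 1" "lower_point ((t + \<i>) / (t - \<i>)) = t"
proof -
  have t: "Im (cnj t) > 0" using assms by (simp add: lower_half_plane_def)
  have "cnj (cayley (cnj t)) = (t + \<i>) / (t - \<i>)" by (simp add: cayley_def)
  then show "norm ((t + \<i>) / (t - \<i>)) < 1" "lower_point ((t + \<i>) / (t - \<i>)) = t"
    using norm_cayley_less[OF t] cayley_inv_cayley[OF t] cnj_cayley_inv[of "cayley (cnj t)"]
    by (metis complex_mod_cnj, simp)
qed

section \<open>Factorisation of the kernel\<close>

text \<open>The factor depending on \<tau> alone in (\<tau> - t) / (\<i> - t) = ((\<tau> + \<i>) /
  (2\<i>)) (1 - u \<open>cayley \<tau>\<close>), raised to the power -k. The base has real part (Im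
  \<tau> + 1) / 2.\<close>

definition kernel_factor :: "real \<Rightarrow> complex \<Rightarrow> complex" where
  "kernel_factor k \<tau> = ((\<tau> + \<i>) / (2 * \<i>)) powr of_real (- k)"

text \<open>Both \<tau> - t and \<i> - t lie in the upper half-plane, which splits the power of
  their quotient; both factors of the quotient have positive real part, since |u
  \<open>cayley \<tau>\<close>| < 1, which splits it a second time.\<close>

lemma kernel_minus_part:
  assumes \<tau>: "Im \<tau> > 0" and u: "norm u < 1"
  shows "(\<i> - lower_point u) powr of_real k * (\<tau> - lower_point u) powr of_real (- k) =
         kernel_factor k \<tau> * (1 - u * cayley \<tau>) powr of_real (- k)"
proof -
  let ?t = "lower_point u"
  have t: "Im ?t < 0" using lower_point_in_lower_half_plane[OF u] by (simp add: lower_half_plane_def)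
  have u1: "u - 1 \<noteq> 0" using u by auto
  have nz: "\<i> - ?t \<noteq> 0" using t by (auto simp: complex_eq_iff)
  have "norm (u * cayley \<tau>) \<le> 1 * norm (cayley \<tau>)"
    unfolding norm_mult using u by (intro mult_right_mono) auto
  then have "norm (u * cayley \<tau>) < 1"
    using norm_cayley_less[OF \<tau>] by simp
  then have Re2: "Re (1 - u * cayley \<tau>) > 0"
    using complex_Re_le_cmod[of "u * cayley \<tau>"] by simp
  have Re1: "Re ((\<tau> + \<i>) / (2 * \<i>)) > 0" using \<tau> by (simp add: Re_divide)
  have "(\<tau> - ?t) / (\<i> - ?t) = ((\<tau> + \<i>) / (2 * \<i>)) * (1 - u * cayley \<tau>)"
  proof -
    have e1: "\<i> - ?t = - 2 * \<i> / (u - 1)" using u1 by (simp add: lower_point_def field_simps)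
    have e2: "\<tau> - ?t = (\<tau> * (u - 1) - \<i> * (u + 1)) / (u - 1)" using u1 by (simp add: lower_point_def field_simps)
    have e3: "(\<tau> + \<i>) * (1 - u * cayley \<tau>) = - (\<tau> * (u - 1) - \<i> * (u + 1))"
      using plus_i_nonzero[OF \<tau>] by (simp add: cayley_def field_simps)
    have "(\<tau> - ?t) / (\<i> - ?t) = - (\<tau> * (u - 1) - \<i> * (u + 1)) / (2 * \<i>)"
      unfolding e1 e2 using u1 by (simp, simp add: algebra_simps)
    then show ?thesis unfolding e3[symmetric] by simp
  qed
  then have "(\<tau> - ?t) powr of_real (- k) / (\<i> - ?t) powr of_real (- k) =
      kernel_factor k \<tau> * (1 - u * cayley \<tau>) powr of_real (- k)"
    using powr_divide_upper[of "\<tau> - ?t" "\<i> - ?t" "of_real (- k)"] powr_mult_Re_pos[OF Re1 Re2] \<tau> t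
    by (simp add: kernel_factor_def)
  moreover have "(\<tau> - ?t) powr of_real (- k) / (\<i> - ?t) powr of_real (- k) =
      (\<i> - ?t) powr of_real k * (\<tau> - ?t) powr of_real (- k)"
    using nz by (simp add: powr_minus field_simps)
  ultimately show ?thesis by simp
qed

text \<open>The weight in \<open>plus_part\<close> undoes the kernel factor up to a constant. The
  numbers -\<i> - \<tau> and -2\<i> are the negatives of \<tau> + \<i> and 2\<i>, both in the upper
  half-plane, so both logarithms shift by the same -\<i> pi.\<close>

lemma kernel_factor_mult:
  assumes "Im \<tau> > 0"
  shows "kernel_factor k \<tau> * (- \<i> - \<tau>) powr of_real k = (- 2 * \<i>) powr of_real k"
proof -
  have Im: "Im (\<tau> + \<i>) > 0" using assms by simp
  have nz: "\<tau> + \<i> \<noteq> 0" using plus_i_nonzero[OF assms] .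
  have L: "Ln (- \<i> - \<tau>) = Ln (\<tau> + \<i>) - \<i> * pi" "Ln (- (\<i> * 2)) = Ln (\<i> * 2) - \<i> * pi"
    using Ln_minus[OF nz] Ln_minus[of "\<i> * 2"] Im by (auto simp: algebra_simps)
  have "kernel_factor k \<tau> = (\<tau> + \<i>) powr of_real (- k) / (2 * \<i>) powr of_real (- k)"
    unfolding kernel_factor_def by (rule powr_divide_upper) (use Im in auto)
  moreover have "- \<i> - \<tau> \<noteq> 0" using assms by (auto simp: complex_eq_iff)
  ultimately show ?thesis using nz
    by (simp add: powr_def L exp_diff[symmetric] exp_add[symmetric] algebra_simps)
qed

lemma continuous_on_cayley: "continuous_on upper_half_plane cayley"
  unfolding cayley_def[abs_def] upper_half_plane_def
  by (intro continuous_intros) (use plus_i_nonzero in auto)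

lemma continuous_on_kernel_factor: "continuous_on upper_half_plane (kernel_factor k)"
  unfolding kernel_factor_def[abs_def]
  by (intro continuous_intros) (auto simp: upper_half_plane_def Re_divide complex_eq_iff)

lemma closed_segment_in_upper_half_plane:
  assumes "a \<in> upper_half_plane" "b \<in> upper_half_plane"
  shows "closed_segment a b \<subseteq> upper_half_plane"
proof -
  have "convex upper_half_plane"
    unfolding upper_half_plane_def by (simp add: convex_halfspace_Im_gt)
  then show ?thesis using assms by (rule closed_segment_subset[rotated 2])
qed

text \<open>Compactness gives a margin q < 1. It is the room in which the integral extends beyond
  |u| = 1 and in which a circle |w| = c with q < c < 1 can be placed.\<close>

lemma cayley_segment_bound:
  assumes "a \<in> upper_half_plane" "b \<in> upper_half_plane"
  obtains q where "0 < q" "q < 1" "\<And>\<tau>. \<tau> \<in> closed_segment a b \<Longrightarrow> norm (cayley \<tau>) \<le> q"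
proof -
  note seg = closed_segment_in_upper_half_plane[OF assms]
  have "continuous_on (closed_segment a b) (\<lambda>\<tau>. norm (cayley \<tau>))"
    by (intro continuous_intros continuous_on_subset[OF continuous_on_cayley seg])
  from continuous_attains_sup[OF compact_segment _ this]
  obtain x where x: "x \<in> closed_segment a b"
      "\<And>\<tau>. \<tau> \<in> closed_segment a b \<Longrightarrow> norm (cayley \<tau>) \<le> norm (cayley x)" by auto
  have "norm (cayley x) < 1"
    using x(1) seg norm_cayley_less by (auto simp: upper_half_plane_def)
  \<comment> \<open>The maximum with 1/2 keeps q positive even for the one-point segment at \<i>,
    where \<open>cayley\<close> vanishes.\<close>
  then show ?thesis
    using x(2) by (intro that[of "max (1/2) (norm (cayley x))"]) (auto intro: le_max_iff_disj[THEN iffD2])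
qed

section \<open>Moments of the kernel and their generating function\<close>

text \<open>What remains of the Taylor coefficients of f^- when the binomial coefficients (k)_n / n!
  are divided out; these are the coefficients of \<open>sigma\<close>.\<close>

definition kernel_moment :: "real \<Rightarrow> complex \<Rightarrow> complex \<Rightarrow> (complex \<Rightarrow> complex) \<Rightarrow> nat \<Rightarrow> complex" where
  "kernel_moment k a b \<phi> n =
     contour_integral (linepath a b) (\<lambda>\<tau>. \<phi> \<tau> * kernel_factor k \<tau> * cayley \<tau> ^ n)"

text \<open>On the unit disc this is f^- in the coordinate u, but in this form it stays meaningful
  for |u| < 1/q: it is the extension that \<open>bracket_defined\<close> asks for.\<close>

definition kernel_generating :: "real \<Rightarrow> complex \<Rightarrow> complex \<Rightarrow> (complex \<Rightarrow> complex) \<Rightarrow> complex \<Rightarrow> complex" where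
  "kernel_generating k a b \<phi> u =
     contour_integral (linepath a b) (\<lambda>\<tau>. \<phi> \<tau> * kernel_factor k \<tau> * (1 - u * cayley \<tau>) powr of_real (- k))"

context
  fixes k q :: real and a b :: complex and \<phi> :: "complex \<Rightarrow> complex"
  assumes ab: "a \<in> upper_half_plane" "b \<in> upper_half_plane"
    and \<phi>: "continuous_on (closed_segment a b) \<phi>"
    and q: "0 < q" "\<And>\<tau>. \<tau> \<in> closed_segment a b \<Longrightarrow> norm (cayley \<tau>) \<le> q"
begin

lemmas kernel_segment = closed_segment_in_upper_half_plane[OF ab]

lemma continuous_on_kernel_integrand:
  "continuous_on (closed_segment a b) (\<lambda>\<tau>. \<phi> \<tau> * kernel_factor k \<tau>)"
  "continuous_on (closed_segment a b) cayley"
  by (intro continuous_intros \<phi> continuous_on_subset[OF continuous_on_kernel_factor kernel_segment]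
        continuous_on_subset[OF continuous_on_cayley kernel_segment])+

lemma Re_kernel_pos:
  assumes "u \<in> ball 0 (1 / q)" "\<tau> \<in> closed_segment a b"
  shows "Re (1 - u * cayley \<tau>) > 0"
proof -
  have "norm (u * cayley \<tau>) \<le> norm u * q"
    unfolding norm_mult using q(2)[OF assms(2)] by (intro mult_left_mono) auto
  also have "\<dots> < 1" using assms(1) q(1) by (simp add: field_simps)
  finally show ?thesis using complex_Re_le_cmod[of "u * cayley \<tau>"] by simp
qed

text \<open>The n-th u-derivative of the integrand in closed form: each differentiation of the power
  -k - n contributes (k + n) \<open>cayley \<tau>\<close>, which builds up the Pochhammer symbol.
  The Taylor coefficients follow at u = 0 by differentiation under the integral.\<close>

definition kernel_derivative :: "nat \<Rightarrow> complex \<Rightarrow> complex \<Rightarrow> complex" where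
  "kernel_derivative n u \<tau> = \<phi> \<tau> * kernel_factor k \<tau> *
     (pochhammer (of_real k) n * cayley \<tau> ^ n * (1 - u * cayley \<tau>) powr (of_real (- k) - of_nat n))"

lemma continuous_on_kernel_derivative:
  "continuous_on (ball 0 (1 / q) \<times> closed_segment a b) (\<lambda>(u, \<tau>). kernel_derivative n u \<tau>)"
proof -
  have c: "continuous_on (ball 0 (1 / q) \<times> closed_segment a b) (\<lambda>p. cayley (snd p))"
    "continuous_on (ball 0 (1 / q) \<times> closed_segment a b) (\<lambda>p. \<phi> (snd p) * kernel_factor k (snd p))"
    by (rule continuous_on_compose2[OF continuous_on_kernel_integrand(2)] continuous_on_compose2[OF continuous_on_kernel_integrand(1)];
        auto intro!: continuous_intros)+
  have pos: "Re (1 - fst p * cayley (snd p)) > 0" if "p \<in> ball 0 (1 / q) \<times> closed_segment a b" for p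
    using that by (intro Re_kernel_pos) auto
  have p: "continuous_on (ball 0 (1 / q) \<times> closed_segment a b)
      (\<lambda>p. (1 - fst p * cayley (snd p)) powr (of_real (- k) - of_nat n))"
  proof (rule continuous_on_powr_complex)
    show "ball 0 (1 / q) \<times> closed_segment a b \<subseteq>
        {p. 0 \<le> Re (1 - fst p * cayley (snd p)) \<or> Im (1 - fst p * cayley (snd p)) \<noteq> 0}"
      using pos by (blast intro: less_imp_le)
    show "0 < Re (of_real (- k) - of_nat n :: complex)"
      if "p \<in> ball 0 (1 / q) \<times> closed_segment a b" "1 - fst p * cayley (snd p) = 0" for p
      using pos[OF that(1)] unfolding that(2) by simp
  qed (intro continuous_intros c)+
  show ?thesis
    unfolding kernel_derivative_def split_beta
    by (intro c p continuous_on_mult continuous_on_power continuous_on_const)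
qed

lemma continuous_on_kernel_derivative_slice:
  assumes "u \<in> ball 0 (1 / q)"
  shows "continuous_on (closed_segment a b) (kernel_derivative n u)"
proof -
  have "continuous_on (closed_segment a b) (\<lambda>\<tau>. (\<lambda>(u, \<tau>). kernel_derivative n u \<tau>) (u, \<tau>))"
    by (rule continuous_on_compose2[OF continuous_on_kernel_derivative]) (use assms in \<open>auto intro!: continuous_intros\<close>)
  then show ?thesis by simp
qed

lemma kernel_derivative_has_field_derivative:
  assumes "u \<in> ball 0 (1 / q)"
  shows "((\<lambda>u. contour_integral (linepath a b) (kernel_derivative n u)) has_field_derivative
           contour_integral (linepath a b) (kernel_derivative (Suc n) u)) (at u)"
proof (rule contour_integral_linepath_has_field_derivative[where U = "ball 0 (1 / q)"])
  fix u \<tau> :: complex assume u: "u \<in> ball 0 (1 / q)" and \<tau>: "\<tau> \<in> closed_segment a b"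
  have "1 - u * cayley \<tau> \<notin> \<real>\<^sub>\<le>\<^sub>0"
    using Re_kernel_pos[OF u \<tau>] by (auto simp: complex_nonpos_Reals_iff)
  then have "((\<lambda>u. (1 - u * cayley \<tau>) powr (of_real (- k) - of_nat n)) has_field_derivative
      ((of_real (- k) - of_nat n) * (1 - u * cayley \<tau>) powr (of_real (- k) - of_nat n - 1) * (- cayley \<tau>))) (at u)"
    by (intro DERIV_chain2[OF has_field_derivative_powr]) (auto intro!: derivative_eq_intros)
  from DERIV_cmult[OF DERIV_cmult[OF this]]
  show "((\<lambda>u. kernel_derivative n u \<tau>) has_field_derivative kernel_derivative (Suc n) u \<tau>) (at u)"
    unfolding kernel_derivative_def
    by (rule DERIV_cong) (simp add: pochhammer_Suc algebra_simps)
qed (use assms continuous_on_kernel_derivative continuous_on_kernel_derivative_slice in auto)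

lemma kernel_generating_eq: "kernel_generating k a b \<phi> u = contour_integral (linepath a b) (kernel_derivative 0 u)"
  by (simp add: kernel_generating_def kernel_derivative_def[abs_def])

lemma kernel_generating_holomorphic: "kernel_generating k a b \<phi> holomorphic_on ball 0 (1 / q)"
  unfolding kernel_generating_eq[abs_def]
  unfolding holomorphic_on_open[OF open_ball] using kernel_derivative_has_field_derivative by blast

lemma higher_deriv_kernel_generating:
  assumes "u \<in> ball 0 (1 / q)"
  shows "(deriv ^^ n) (kernel_generating k a b \<phi>) u = contour_integral (linepath a b) (kernel_derivative n u)"
  using assms
proof (induction n arbitrary: u)
  case 0
  then show ?case by (simp add: kernel_generating_eq)
next
  case (Suc n)
  have "((deriv ^^ n) (kernel_generating k a b \<phi>) has_field_derivative
      contour_integral (linepath a b) (kernel_derivative (Suc n) u)) (at u)"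
    by (rule has_field_derivative_transform_within_open[OF kernel_derivative_has_field_derivative[OF Suc.prems]
          open_ball Suc.prems]) (simp add: Suc.IH)
  then show ?case by (simp add: DERIV_imp_deriv)
qed

lemma higher_deriv_kernel_generating_0:
  "(deriv ^^ n) (kernel_generating k a b \<phi>) 0 = pochhammer (of_real k) n * kernel_moment k a b \<phi> n"
proof -
  have "(deriv ^^ n) (kernel_generating k a b \<phi>) 0 = contour_integral (linepath a b) (kernel_derivative n 0)"
    using q(1) by (intro higher_deriv_kernel_generating) simp
  also have "kernel_derivative n 0 = (\<lambda>\<tau>. pochhammer (of_real k) n * (\<phi> \<tau> * kernel_factor k \<tau> * cayley \<tau> ^ n))"
    by (simp add: kernel_derivative_def fun_eq_iff)
  also have "contour_integral (linepath a b) \<dots> = pochhammer (of_real k) n * kernel_moment k a b \<phi> n"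
    unfolding kernel_moment_def
    by (intro contour_integral_lmul contour_integrable_continuous_linepath continuous_intros continuous_on_kernel_integrand)
  finally show ?thesis .
qed

lemma minus_part_eq_kernel_generating:
  assumes f: "\<And>t. t \<in> lower_half_plane \<Longrightarrow>
      f t = contour_integral (linepath a b) (\<lambda>\<tau>. \<phi> \<tau> * (\<tau> - t) powr of_real (- k))"
    and u: "norm u < 1"
  shows "minus_part k f (lower_point u) = kernel_generating k a b \<phi> u"
proof -
  let ?t = "lower_point u"
  have t: "Im ?t < 0" using lower_point_in_lower_half_plane[OF u] by (simp add: lower_half_plane_def)
  have "continuous_on (closed_segment a b) (\<lambda>\<tau>. (\<tau> - ?t) powr of_real (- k))"
    by (intro continuous_intros) (use kernel_segment t in \<open>auto simp: upper_half_plane_def complex_eq_iff\<close>)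
  then have "minus_part k f ?t = contour_integral (linepath a b)
      (\<lambda>\<tau>. (\<i> - ?t) powr of_real k * (\<phi> \<tau> * (\<tau> - ?t) powr of_real (- k)))"
    using f[OF lower_point_in_lower_half_plane[OF u]]
    by (simp add: minus_part_def contour_integral_lmul contour_integrable_continuous_linepath
         continuous_on_mult \<phi> del: of_real_minus)
  also have "\<dots> = kernel_generating k a b \<phi> u"
    unfolding kernel_generating_def
  proof (rule contour_integral_eq)
    fix \<tau> assume "\<tau> \<in> path_image (linepath a b)"
    then have "Im \<tau> > 0" using kernel_segment by (auto simp: upper_half_plane_def)
    from kernel_minus_part[OF this u, of k]
    show "(\<i> - ?t) powr of_real k * (\<phi> \<tau> * (\<tau> - ?t) powr of_real (- k)) =
       \<phi> \<tau> * kernel_factor k \<tau> * (1 - u * cayley \<tau>) powr of_real (- k)"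
      by (metis mult.assoc mult.commute)
  qed
  finally show ?thesis .
qed

lemma minus_coeff_eq_kernel_moment:
  assumes f: "\<And>t. t \<in> lower_half_plane \<Longrightarrow>
      f t = contour_integral (linepath a b) (\<lambda>\<tau>. \<phi> \<tau> * (\<tau> - t) powr of_real (- k))"
    and q1: "q < 1"
  shows "minus_coeff k f n = pochhammer (of_real k) n / fact n * kernel_moment k a b \<phi> n"
proof -
  have "(deriv ^^ n) (\<lambda>u. minus_part k f (lower_point u)) 0 = (deriv ^^ n) (kernel_generating k a b \<phi>) 0"
  proof (rule higher_deriv_transform_within_open[where S = "ball 0 1"])
    show hol: "kernel_generating k a b \<phi> holomorphic_on ball 0 1"
      using q1 q(1) by (intro holomorphic_on_subset[OF kernel_generating_holomorphic] subset_ball) simp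
    show eq: "minus_part k f (lower_point u) = kernel_generating k a b \<phi> u" if "u \<in> ball 0 1" for u
      using that by (intro minus_part_eq_kernel_generating f) auto
    show "(\<lambda>u. minus_part k f (lower_point u)) holomorphic_on ball 0 1"
      by (rule holomorphic_transform[OF hol]) (simp add: eq)
  qed auto
  then show ?thesis
    unfolding minus_coeff_def lower_point_def[symmetric] by (simp add: higher_deriv_kernel_generating_0)
qed

text \<open>With this geometric bound the series in 1/w with the moments as coefficients has radius
  of convergence at least 1/q > 1 as soon as q < 1.\<close>

lemma kernel_moment_bound:
  obtains A where "A \<ge> 0" "\<And>n. norm (kernel_moment k a b \<phi> n) \<le> A * q ^ n"
proof -
  have "bounded ((\<lambda>\<tau>. \<phi> \<tau> * kernel_factor k \<tau>) ` closed_segment a b)"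
    by (intro compact_imp_bounded compact_continuous_image continuous_on_kernel_integrand compact_segment)
  then obtain B where B: "\<And>\<tau>. \<tau> \<in> closed_segment a b \<Longrightarrow> norm (\<phi> \<tau> * kernel_factor k \<tau>) \<le> B"
    by (auto simp: bounded_iff)
  have B0: "B \<ge> 0" using order_trans[OF norm_ge_zero B[of a]] by simp
  have "norm (kernel_moment k a b \<phi> n) \<le> (B * q ^ n) * norm (b - a)" for n
    unfolding kernel_moment_def
  proof (rule contour_integral_bound_linepath)
    show "(\<lambda>\<tau>. \<phi> \<tau> * kernel_factor k \<tau> * cayley \<tau> ^ n) contour_integrable_on linepath a b"
      by (intro contour_integrable_continuous_linepath continuous_intros continuous_on_kernel_integrand)
    show "norm (\<phi> \<tau> * kernel_factor k \<tau> * cayley \<tau> ^ n) \<le> B * q ^ n" if "\<tau> \<in> closed_segment a b" for \<tau>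
      unfolding norm_mult[of "\<phi> \<tau> * kernel_factor k \<tau>"] norm_power
      using that B B0 q by (intro mult_mono power_mono) auto
  qed (use B0 q in auto)
  then show ?thesis
    using B0 by (intro that[of "B * norm (b - a)"]) (auto simp: algebra_simps)
qed

end

section \<open>The bracket as a pairing of Taylor coefficients\<close>

lemma nonpos_Ints_realE:
  assumes "k \<in> \<int>\<^sub>\<le>\<^sub>0"
  obtains m :: nat where "k = - real m"
proof -
  from assms obtain j :: int where "k = of_int j" "j \<le> 0" by (auto simp: nonpos_Ints_def)
  then show ?thesis by (intro that[of "nat (- j)"]) simp
qed

text \<open>For w = \<open>cayley z\<close> one has dw = 2\<i> dz / (z + \<i>)^2, so the measure in
  the definition of the bracket is dw / (2\<i>).\<close>

lemma contour_integral_cayley_inv_circlepath: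
  assumes c: "0 < c" "c < 1"
    and g: "(\<lambda>w. g (cayley_inv w)) contour_integrable_on circlepath 0 c"
  shows "contour_integral (cayley_inv \<circ> circlepath 0 c) (\<lambda>z. g z / (z + \<i>)\<^sup>2) =
         contour_integral (circlepath 0 c) (\<lambda>w. g (cayley_inv w)) / (2 * \<i>)"
proof -
  have ne1: "w \<noteq> 1" if "w \<in> ball 0 1" for w :: complex using that by auto
  have der: "(cayley_inv has_field_derivative 2 * \<i> / (1 - w)\<^sup>2) (at w)" if "w \<in> ball 0 1" for w
    unfolding cayley_inv_def[abs_def] using ne1[OF that]
    by (auto intro!: derivative_eq_intros simp: power2_eq_square divide_simps) (simp add: algebra_simps)
  have "cayley_inv holomorphic_on ball 0 1"
    unfolding holomorphic_on_open[OF open_ball] using der by blast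
  then have an: "cayley_inv analytic_on ball 0 1" by (simp add: analytic_on_open)
  have img: "path_image (circlepath 0 c) \<subseteq> ball 0 1" using c by auto
  have "contour_integral (cayley_inv \<circ> circlepath 0 c) (\<lambda>z. g z / (z + \<i>)\<^sup>2) =
      contour_integral (circlepath 0 c) (\<lambda>w. deriv cayley_inv w * (g (cayley_inv w) / (cayley_inv w + \<i>)\<^sup>2))"
    by (rule contour_integral_comp_analyticW[OF an _ img]) simp
  also have "\<dots> = contour_integral (circlepath 0 c) (\<lambda>w. g (cayley_inv w) / (2 * \<i>))"
  proof (rule contour_integral_eq)
    fix w assume "w \<in> path_image (circlepath 0 c)"
    then have w: "w \<in> ball 0 1" using img by auto
    have e: "cayley_inv w + \<i> = 2 * \<i> / (1 - w)"
      using ne1[OF w] by (simp add: cayley_inv_def field_simps)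
    show "deriv cayley_inv w * (g (cayley_inv w) / (cayley_inv w + \<i>)\<^sup>2) = g (cayley_inv w) / (2 * \<i>)"
      unfolding e DERIV_imp_deriv[OF der[OF w]] using ne1[OF w]
      by (simp add: power_divide power_mult_distrib)
  qed
  also have "\<dots> = contour_integral (circlepath 0 c) (\<lambda>w. g (cayley_inv w)) / (2 * \<i>)"
    by (rule contour_integral_div[OF g])
  finally show ?thesis .
qed

text \<open>The prefactor 1/pi and the Jacobian 1/(2\<i>) combine to 1/(2 pi \<i>), so termwise
  integration is Cauchy's formula for the Taylor coefficients of h^+ in w. The sum contains no
  radius, hence the circle picked by \<open>SOME\<close> leaves no trace.\<close>

lemma bracket_sums:
  assumes h: "h holomorphic_on upper_half_plane"
    and ex: "\<exists>c. sigma_radius k f c"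
  defines "H \<equiv> (\<lambda>w. plus_part k h (cayley_inv w))"
  shows "H holomorphic_on ball 0 1"
    and "(\<lambda>n. sigma_coeff k f n * ((deriv ^^ n) H 0 / fact n)) sums bracket k h f"
proof -
  have ne1: "w \<noteq> 1" if "w \<in> ball 0 1" for w :: complex using that by auto
  have ci_hol: "cayley_inv holomorphic_on ball 0 1"
    unfolding cayley_inv_def[abs_def] by (intro holomorphic_intros) (use ne1 in auto)
  have up: "cayley_inv ` ball 0 1 \<subseteq> upper_half_plane"
    using cayley_inv_in_upper_half_plane by auto
  have "plus_part k h holomorphic_on upper_half_plane"
    unfolding plus_part_def[abs_def]
    by (intro holomorphic_intros h) (auto simp: upper_half_plane_def complex_nonpos_Reals_iff)
  from holomorphic_on_compose_gen[OF ci_hol this up]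
  show H: "H holomorphic_on ball 0 1" by (simp add: H_def o_def)
  define c where "c = (SOME c. sigma_radius k f c)"
  have "sigma_radius k f c" using ex unfolding c_def by (rule someI_ex)
  then have c: "0 < c" "c < 1" and cr: "ereal (inverse c) < conv_radius (sigma_coeff k f)"
    by (auto simp: sigma_radius_def)
  \<comment> \<open>\<open>sigma\<close> has exponents n + 1; one factor 1/w is moved to H, so that
    a genuine power series in 1/w is left.\<close>
  let ?s = "\<lambda>N w. \<Sum>n<N. sigma_coeff k f n * inverse w ^ n"
  have H_cont: "continuous_on (sphere 0 c) H"
    using c by (intro holomorphic_on_imp_continuous_on holomorphic_on_subset[OF H]) auto
  have "uniform_limit (sphere 0 c) (\<lambda>N w. \<Sum>n<N. sigma_coeff k f n * (inverse w - 0) ^ n)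
      (\<lambda>w. \<Sum>n. sigma_coeff k f n * (inverse w - 0) ^ n) sequentially"
    by (rule uniform_limit_compose'[OF powser_uniform_limit[OF cr, of 0]]) (use c in \<open>auto simp: norm_inverse\<close>)
  then have "uniform_limit (sphere 0 c) ?s (\<lambda>w. \<Sum>n. sigma_coeff k f n * inverse w ^ n) sequentially"
    by simp
  moreover have "bounded ((\<lambda>w. \<Sum>n. sigma_coeff k f n * inverse w ^ n) ` sphere 0 c)"
  proof (rule compact_imp_bounded, rule compact_continuous_image)
    have "continuous_on (sphere 0 c) (\<lambda>w. (\<Sum>n. sigma_coeff k f n * (inverse w - 0) ^ n))"
      by (rule continuous_on_compose2[OF powser_continuous_suminf[OF cr, of 0]])
         (use c in \<open>auto intro!: continuous_intros simp: norm_inverse\<close>)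
    then show "continuous_on (sphere 0 c) (\<lambda>w. \<Sum>n. sigma_coeff k f n * inverse w ^ n)" by simp
  qed simp
  moreover have Hc: "continuous_on (sphere 0 c) (\<lambda>w. H w * inverse w)"
    using c by (intro continuous_intros H_cont) auto
  moreover have "bounded ((\<lambda>w. H w * inverse w) ` sphere 0 c)"
    by (intro compact_imp_bounded compact_continuous_image Hc) simp
  ultimately have ul: "uniform_limit (sphere 0 c) (\<lambda>N w. (H w * inverse w) * ?s N w)
      (\<lambda>w. (H w * inverse w) * (\<Sum>n. sigma_coeff k f n * inverse w ^ n)) sequentially"
    by (intro uniform_lim_mult uniform_limit_const)
  have trm: "((\<lambda>w. (H w * inverse w) * ?s N w) has_contour_integral
      (\<Sum>n<N. sigma_coeff k f n * (2 * of_real pi * \<i> / fact n * (deriv ^^ n) H 0))) (circlepath 0 c)" for N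
  proof -
    have "continuous_on (cball 0 c) H" "H holomorphic_on ball 0 c"
      using c by (auto intro!: holomorphic_on_imp_continuous_on holomorphic_on_subset[OF H])
    then have "((\<lambda>w. H w / (w - 0) ^ Suc n) has_contour_integral
        (2 * of_real pi * \<i> / fact n * (deriv ^^ n) H 0)) (circlepath 0 c)" for n
      using Cauchy_has_contour_integral_higher_derivative_circlepath[of 0 c H 0 n] c
      by simp
    then have "((\<lambda>w. \<Sum>n<N. sigma_coeff k f n * (H w / (w - 0) ^ Suc n)) has_contour_integral
      (\<Sum>n<N. sigma_coeff k f n * (2 * of_real pi * \<i> / fact n * (deriv ^^ n) H 0))) (circlepath 0 c)"
      by (intro has_contour_integral_sum has_contour_integral_lmul) auto
    moreover have "(\<Sum>n<N. sigma_coeff k f n * (H w / (w - 0) ^ Suc n)) = (H w * inverse w) * ?s N w" for w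
      unfolding sum_distrib_left by (intro sum.cong) (auto simp: field_simps)
    ultimately show ?thesis by simp
  qed
  have eq: "(H w * inverse w) * (\<Sum>n. sigma_coeff k f n * inverse w ^ n) = H w * sigma k f w"
    if "w \<in> path_image (circlepath 0 c)" for w
  proof -
    have nw: "norm (inverse w) = inverse c" using that c by (auto simp: norm_inverse)
    have "summable (\<lambda>n. sigma_coeff k f n * inverse w ^ n)"
      using cr by (intro summable_in_conv_radius) (simp add: nw)
    from suminf_mult2[OF this, of "inverse w"]
    show ?thesis by (simp add: sigma_def mult_ac)
  qed
  have ev: "\<forall>\<^sub>F N in sequentially. (\<lambda>w. (H w * inverse w) * ?s N w) contour_integrable_on circlepath 0 c"
    using has_contour_integral_integrable[OF trm] by (rule always_eventually[OF allI])
  have "(\<lambda>w. (H w * inverse w) * (\<Sum>n. sigma_coeff k f n * inverse w ^ n)) contour_integrable_on circlepath 0 c"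
    by (rule contour_integral_uniform_limit_circlepath(1)[OF ev ul]) (use c in auto)
  then have int: "(\<lambda>w. H w * sigma k f (cayley (cayley_inv w))) contour_integrable_on circlepath 0 c"
  proof (rule contour_integrable_eq)
    fix w assume w: "w \<in> path_image (circlepath 0 c)"
    then have "w \<noteq> 1" using c by auto
    then show "(H w * inverse w) * (\<Sum>n. sigma_coeff k f n * inverse w ^ n) = H w * sigma k f (cayley (cayley_inv w))"
      unfolding eq[OF w] by (simp add: cayley_cayley_inv)
  qed
  have "(\<lambda>N. contour_integral (circlepath 0 c) (\<lambda>w. (H w * inverse w) * ?s N w)) \<longlonglongrightarrow>
      contour_integral (circlepath 0 c) (\<lambda>w. (H w * inverse w) * (\<Sum>n. sigma_coeff k f n * inverse w ^ n))"
    by (rule contour_integral_uniform_limit_circlepath(2)[OF ev ul]) (use c in auto)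
  also have "contour_integral (circlepath 0 c) (\<lambda>w. (H w * inverse w) * (\<Sum>n. sigma_coeff k f n * inverse w ^ n))
     = contour_integral (circlepath 0 c) (\<lambda>w. H w * sigma k f w)"
    by (rule contour_integral_eq) (rule eq)
  finally have lim: "(\<lambda>N. \<Sum>n<N. sigma_coeff k f n * (2 * of_real pi * \<i> / fact n * (deriv ^^ n) H 0)) \<longlonglongrightarrow>
      contour_integral (circlepath 0 c) (\<lambda>w. H w * sigma k f w)"
    unfolding contour_integral_unique[OF trm] .
  have "bracket k h f = (1 / of_real pi) * (contour_integral (circlepath 0 c) (\<lambda>w. H w * sigma k f (cayley (cayley_inv w))) / (2 * \<i>))"
    unfolding bracket_def c_def[symmetric] H_def
    by (simp only: contour_integral_cayley_inv_circlepath[OF c, where g = "\<lambda>z. plus_part k h z * sigma k f (cayley z)", OF int[unfolded H_def]])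
  also have "contour_integral (circlepath 0 c) (\<lambda>w. H w * sigma k f (cayley (cayley_inv w))) =
      contour_integral (circlepath 0 c) (\<lambda>w. H w * sigma k f w)"
  proof (rule contour_integral_eq)
    fix w assume "w \<in> path_image (circlepath 0 c)"
    then have "w \<noteq> 1" using c by auto
    then show "H w * sigma k f (cayley (cayley_inv w)) = H w * sigma k f w" by (simp add: cayley_cayley_inv)
  qed
  finally have br: "bracket k h f = contour_integral (circlepath 0 c) (\<lambda>w. H w * sigma k f w) / (2 * of_real pi * \<i>)"
    by (simp add: field_simps)
  have "(\<lambda>N. (\<Sum>n<N. sigma_coeff k f n * (2 * of_real pi * \<i> / fact n * (deriv ^^ n) H 0)) / (2 * of_real pi * \<i>)) \<longlonglongrightarrow> bracket k h f"
    unfolding br by (intro tendsto_intros lim) auto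
  also have "(\<lambda>N. (\<Sum>n<N. sigma_coeff k f n * (2 * of_real pi * \<i> / fact n * (deriv ^^ n) H 0)) / (2 * of_real pi * \<i>)) =
      (\<lambda>N. \<Sum>n<N. sigma_coeff k f n * ((deriv ^^ n) H 0 / fact n))"
    unfolding sum_divide_distrib by (intro ext sum.cong) auto
  finally show "(\<lambda>n. sigma_coeff k f n * ((deriv ^^ n) H 0 / fact n)) sums bracket k h f"
    by (simp add: sums_def)
qed

text \<open>For k = -m the kernel is itself a polynomial of degree m in t; this supplies the
  polynomial condition of \<open>bracket_defined\<close>.\<close>

lemma contour_integral_poly_kernel:
  assumes "continuous_on (closed_segment a b) \<phi>"
  shows "\<exists>P. degree P \<le> m \<and> (\<forall>t. contour_integral (linepath a b) (\<lambda>\<tau>. \<phi> \<tau> * (\<tau> - t) ^ m) = poly P t)"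
proof -
  define C where "C = (\<lambda>j. of_nat (m choose j) * contour_integral (linepath a b) (\<lambda>\<tau>. \<phi> \<tau> * \<tau> ^ (m - j)))"
  define P where "P = (\<Sum>j\<le>m. monom ((-1) ^ j * C j) j)"
  have "degree P \<le> m"
    unfolding P_def by (intro degree_sum_le) (auto intro: order_trans[OF degree_monom_le])
  moreover have "contour_integral (linepath a b) (\<lambda>\<tau>. \<phi> \<tau> * (\<tau> - t) ^ m) = poly P t" for t
  proof -
    have eq: "(\<lambda>\<tau>. \<phi> \<tau> * (\<tau> - t) ^ m) = (\<lambda>\<tau>. \<Sum>j\<le>m. (of_nat (m choose j) * (-t) ^ j) * (\<phi> \<tau> * \<tau> ^ (m - j)))"
    proof
      fix \<tau>
      have "(\<tau> - t) ^ m = (\<Sum>j\<le>m. of_nat (m choose j) * (-t) ^ j * \<tau> ^ (m - j))"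
        using binomial_ring[of "-t" \<tau> m] by simp
      then show "\<phi> \<tau> * (\<tau> - t) ^ m = (\<Sum>j\<le>m. (of_nat (m choose j) * (-t) ^ j) * (\<phi> \<tau> * \<tau> ^ (m - j)))"
        by (simp add: sum_distrib_left mult_ac)
    qed
    have "contour_integral (linepath a b) (\<lambda>\<tau>. \<phi> \<tau> * (\<tau> - t) ^ m) =
        (\<Sum>j\<le>m. (of_nat (m choose j) * (-t) ^ j) * contour_integral (linepath a b) (\<lambda>\<tau>. \<phi> \<tau> * \<tau> ^ (m - j)))"
      unfolding eq
      by (intro contour_integral_unique has_contour_integral_sum has_contour_integral_lmul
           has_contour_integral_integral contour_integrable_continuous_linepath continuous_intros assms) auto
    also have "\<dots> = poly P t"
      unfolding P_def C_def poly_sum poly_monom by (intro sum.cong) (auto simp: power_minus[of t])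
    finally show ?thesis .
  qed
  ultimately show ?thesis by blast
qed

text \<open>The sum of the products of Taylor coefficients of h^+ and moments is a termwise integral
  of the power series of h^+ at w = \<open>cayley \<tau>\<close>. Summing inside the integral
  restores h^+, and its weight cancels \<open>kernel_factor\<close>. The hypothesis
  \<open>h_poly\<close> bridges the truncation of \<open>sigma\<close>.\<close>

lemma bracket_of_segment_integral:
  assumes ab: "a \<in> upper_half_plane" "b \<in> upper_half_plane"
    and \<phi>: "continuous_on (closed_segment a b) \<phi>"
    and f: "\<And>t. t \<in> lower_half_plane \<Longrightarrow>
      f t = contour_integral (linepath a b) (\<lambda>\<tau>. \<phi> \<tau> * (\<tau> - t) powr of_real (- k))"
    and f_hol: "f holomorphic_on lower_half_plane"
    and h: "h holomorphic_on upper_half_plane"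
    and h_poly: "\<And>m n. k = - real m \<Longrightarrow> m < n \<Longrightarrow> (deriv ^^ n) (\<lambda>w. plus_part k h (cayley_inv w)) 0 = 0"
  shows "bracket_defined k h f"
    and "bracket k h f = (- 2 * \<i>) powr of_real k * contour_integral (linepath a b) (\<lambda>\<tau>. \<phi> \<tau> * h \<tau>)"
proof -
  obtain q where q: "0 < q" "q < 1" "\<And>\<tau>. \<tau> \<in> closed_segment a b \<Longrightarrow> norm (cayley \<tau>) \<le> q"
    using cayley_segment_bound[OF ab] by blast
  note seg = closed_segment_in_upper_half_plane[OF ab]
  let ?G = "kernel_generating k a b \<phi>"
  let ?M = "kernel_moment k a b \<phi>"
  show "bracket_defined k h f"
    unfolding bracket_defined_def
  proof (intro conjI h f_hol impI)
    have "?G holomorphic_on ball 0 (1 / q)"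
      by (rule kernel_generating_holomorphic[OF ab \<phi> q(1,3)])
    moreover have "?G ((t + \<i>) / (t - \<i>)) = minus_part k f t" if t: "t \<in> lower_half_plane" for t
      using minus_part_eq_kernel_generating[OF ab \<phi> q(1,3) f lower_quotient(1)[OF t]] lower_quotient(2)[OF t]
      by simp
    moreover have "1 < 1 / q" using q by simp
    then have "cball 0 1 \<subseteq> ball (0::complex) (1 / q)" by auto
    ultimately show "\<exists>U g. open U \<and> cball 0 1 \<subseteq> U \<and> g holomorphic_on U \<and>
        (\<forall>t\<in>lower_half_plane. g ((t + \<i>) / (t - \<i>)) = minus_part k f t)"
      by (intro exI[of _ "ball 0 (1 / q)"] exI[of _ ?G]) auto
  next
    assume "k \<in> \<int>\<^sub>\<le>\<^sub>0"
    then obtain m where m: "k = - real m" by (rule nonpos_Ints_realE)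
    obtain P where P: "degree P \<le> m" "\<And>t. contour_integral (linepath a b) (\<lambda>\<tau>. \<phi> \<tau> * (\<tau> - t) ^ m) = poly P t"
      using contour_integral_poly_kernel[OF \<phi>] by blast
    have "f t = poly P t" if t: "t \<in> lower_half_plane" for t
    proof -
      have "f t = contour_integral (linepath a b) (\<lambda>\<tau>. \<phi> \<tau> * (\<tau> - t) ^ m)"
        unfolding f[OF t]
      proof (rule contour_integral_eq)
        fix \<tau> assume "\<tau> \<in> path_image (linepath a b)"
        then have "\<tau> - t \<noteq> 0" using seg t by (auto simp: upper_half_plane_def lower_half_plane_def)
        then show "\<phi> \<tau> * (\<tau> - t) powr of_real (- k) = \<phi> \<tau> * (\<tau> - t) ^ m" by (simp add: m)
      qed
      then show ?thesis by (simp add: P)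
    qed
    then show "\<exists>P. real (degree P) \<le> \<bar>k\<bar> \<and> (\<forall>t\<in>lower_half_plane. f t = poly P t)"
      using P(1) by (intro exI[of _ P]) (auto simp: m)
  qed
  have sc: "sigma_coeff k f n = (if k \<in> \<int>\<^sub>\<le>\<^sub>0 \<and> real n > \<bar>k\<bar> then 0 else ?M n)" for n
  proof (cases "k \<in> \<int>\<^sub>\<le>\<^sub>0 \<and> real n > \<bar>k\<bar>")
    case False
    \<comment> \<open>The symbol (k)_n vanishes only for k = -j with j < n, which is the case
      already split off.\<close>
    have "pochhammer (of_real k) n \<noteq> (0 :: complex)"
    proof
      assume "pochhammer (of_real k) n = (0 :: complex)"
      then obtain j where j: "j < n" "of_real k = - (of_nat j :: complex)" by (auto simp: pochhammer_eq_0_iff)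
      then have "k = - real j" by (metis of_real_eq_iff of_real_minus of_real_of_nat_eq)
      then show False using False j(1) by auto
    qed
    then show ?thesis
      using False by (auto simp: sigma_coeff_def minus_coeff_eq_kernel_moment[OF ab \<phi> q(1,3) f q(2)])
  qed (simp add: sigma_coeff_def)
  obtain A where A: "A \<ge> 0" "\<And>n. norm (?M n) \<le> A * q ^ n"
    using kernel_moment_bound[OF ab \<phi> q(1,3)] by blast
  have "ereal (1 / q) \<le> conv_radius (sigma_coeff k f)"
  proof (rule conv_radius_geI_ex')
    fix r assume r: "0 < r" "ereal r < ereal (1 / q)"
    then have rq: "r * q < 1" using q(1) by (simp add: field_simps)
    show "summable (\<lambda>n. sigma_coeff k f n * of_real r ^ n)"
    proof (rule summable_comparison_test')
      show "summable (\<lambda>n. A * (r * q) ^ n)"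
        using r q(1) rq by (intro summable_mult summable_geometric) auto
      show "norm (sigma_coeff k f n * of_real r ^ n) \<le> A * (r * q) ^ n" if "n \<ge> 0" for n
      proof -
        have "norm (sigma_coeff k f n) \<le> A * q ^ n" using A q(1) by (auto simp: sc)
        then have "norm (sigma_coeff k f n) * r ^ n \<le> (A * q ^ n) * r ^ n"
          using r by (intro mult_right_mono) auto
        then show ?thesis using r by (simp add: norm_mult norm_power power_mult_distrib mult_ac)
      qed
    qed
  qed
  \<comment> \<open>Any c between q and 1 is admissible, since 1/c is then below the radius of
    convergence.\<close>
  moreover have "\<exists>c. q < c \<and> c < 1" using q(2) by (rule dense)
  ultimately have "\<exists>c. sigma_radius k f c"
  proof (elim exE conjE)
    fix c assume le: "ereal (1 / q) \<le> conv_radius (sigma_coeff k f)" and c: "q < c" "c < 1"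
    have "inverse c < 1 / q" using q(1) c by (simp add: field_simps)
    then have "ereal (inverse c) < ereal (1 / q)" by simp
    then have "ereal (inverse c) < conv_radius (sigma_coeff k f)" using le by (rule less_le_trans)
    then show ?thesis using c q(1) by (intro exI[of _ c]) (auto simp: sigma_radius_def)
  qed
  define H where "H = (\<lambda>w. plus_part k h (cayley_inv w))"
  define coef where "coef = (\<lambda>n. (deriv ^^ n) H 0 / fact n)"
  have H: "H holomorphic_on ball 0 1" and br: "(\<lambda>n. sigma_coeff k f n * coef n) sums bracket k h f"
    using bracket_sums[OF h \<open>\<exists>c. sigma_radius k f c\<close>] by (simp_all add: H_def coef_def)
  \<comment> \<open>Beyond |k| the left factor is 0 by truncation while the moment need not be;
    there the vanishing of \<open>coef n\<close> restores equality.\<close>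
  have "sigma_coeff k f n * coef n = coef n * ?M n" for n
  proof (cases "k \<in> \<int>\<^sub>\<le>\<^sub>0 \<and> real n > \<bar>k\<bar>")
    case True
    then obtain m where m: "k = - real m" using nonpos_Ints_realE by blast
    have "coef n = 0" unfolding coef_def H_def using h_poly[OF m, of n] True m by simp
    then show ?thesis by simp
  qed (auto simp: sc)
  with br have br': "(\<lambda>n. coef n * ?M n) sums bracket k h f" by (simp only:)
  have sums: "(\<lambda>n. coef n * w ^ n) sums H w" if "norm w < 1" for w
    using holomorphic_power_series[OF H, of w] that by (simp add: coef_def)
  have "conv_radius coef \<ge> ereal 1"
  proof (rule conv_radius_geI_ex')
    fix r assume "0 < r" "ereal r < ereal 1"
    then show "summable (\<lambda>n. coef n * of_real r ^ n)"
      by (intro sums_summable[OF sums]) simp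
  qed
  then have cr: "ereal q < conv_radius coef" using q(2) by (meson ereal_less(3) less_le_trans less_ereal.simps(1))
  have "uniform_limit (cball 0 q) (\<lambda>N w. \<Sum>n<N. coef n * (w - 0) ^ n) (\<lambda>w. \<Sum>n. coef n * (w - 0) ^ n) sequentially"
    by (rule powser_uniform_limit[OF cr])
  then have "uniform_limit (closed_segment a b) (\<lambda>N \<tau>. \<Sum>n<N. coef n * (cayley \<tau> - 0) ^ n)
      (\<lambda>\<tau>. \<Sum>n. coef n * (cayley \<tau> - 0) ^ n) sequentially"
    by (rule uniform_limit_compose') (use q(3) in auto)
  then have ul: "uniform_limit (closed_segment a b) (\<lambda>N \<tau>. \<Sum>n<N. coef n * cayley \<tau> ^ n)
      (\<lambda>\<tau>. \<Sum>n. coef n * cayley \<tau> ^ n) sequentially" by simp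
  have lim: "(\<Sum>n. coef n * cayley \<tau> ^ n) = plus_part k h \<tau>" if "\<tau> \<in> closed_segment a b" for \<tau>
  proof -
    have "Im \<tau> > 0" using that seg by (auto simp: upper_half_plane_def)
    then show ?thesis
      using sums_unique[OF sums[OF norm_cayley_less]] by (simp add: H_def cayley_inv_cayley)
  qed
  let ?k = "\<lambda>\<tau>. \<phi> \<tau> * kernel_factor k \<tau>"
  note cont = continuous_on_kernel_integrand[OF ab \<phi> q(1,3)]
  have "continuous_on (closed_segment a b) (\<lambda>\<tau>. \<Sum>n. coef n * (cayley \<tau> - 0) ^ n)"
    by (rule continuous_on_compose2[OF powser_continuous_suminf[OF cr] cont(2)]) (use q(3) in auto)
  then have "bounded ((\<lambda>\<tau>. \<Sum>n. coef n * cayley \<tau> ^ n) ` closed_segment a b)"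
    by (intro compact_imp_bounded compact_continuous_image compact_segment) simp
  moreover have "bounded (?k ` closed_segment a b)"
    by (intro compact_imp_bounded compact_continuous_image compact_segment cont)
  ultimately have ul': "uniform_limit (closed_segment a b) (\<lambda>N \<tau>. ?k \<tau> * (\<Sum>n<N. coef n * cayley \<tau> ^ n))
      (\<lambda>\<tau>. ?k \<tau> * (\<Sum>n. coef n * cayley \<tau> ^ n)) sequentially"
    by (intro uniform_lim_mult uniform_limit_const ul)
  have part: "((\<lambda>\<tau>. ?k \<tau> * (\<Sum>n<N. coef n * cayley \<tau> ^ n)) has_contour_integral (\<Sum>n<N. coef n * ?M n)) (linepath a b)" for N
  proof -
    have "((\<lambda>\<tau>. \<Sum>n<N. coef n * (?k \<tau> * cayley \<tau> ^ n)) has_contour_integral (\<Sum>n<N. coef n * ?M n)) (linepath a b)"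
      unfolding kernel_moment_def
      by (intro has_contour_integral_sum has_contour_integral_lmul has_contour_integral_integral
           contour_integrable_continuous_linepath continuous_intros cont) auto
    then show ?thesis by (simp add: sum_distrib_left mult_ac)
  qed
  have ev: "\<forall>\<^sub>F N in sequentially. (\<lambda>\<tau>. ?k \<tau> * (\<Sum>n<N. coef n * cayley \<tau> ^ n)) contour_integrable_on linepath a b"
    using has_contour_integral_integrable[OF part] by (rule always_eventually[OF allI])
  have "(\<lambda>N. contour_integral (linepath a b) (\<lambda>\<tau>. ?k \<tau> * (\<Sum>n<N. coef n * cayley \<tau> ^ n))) \<longlonglongrightarrow>
      contour_integral (linepath a b) (\<lambda>\<tau>. ?k \<tau> * (\<Sum>n. coef n * cayley \<tau> ^ n))"
    by (rule contour_integral_uniform_limit(2)[where B = "norm (b - a)", OF ev]) (use ul' in auto)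
  then have "(\<lambda>n. coef n * ?M n) sums contour_integral (linepath a b) (\<lambda>\<tau>. ?k \<tau> * (\<Sum>n. coef n * cayley \<tau> ^ n))"
    unfolding sums_def contour_integral_unique[OF part] .
  then have "bracket k h f = contour_integral (linepath a b) (\<lambda>\<tau>. ?k \<tau> * (\<Sum>n. coef n * cayley \<tau> ^ n))"
    using br' by (rule sums_unique2[rotated])
  also have "\<dots> = contour_integral (linepath a b) (\<lambda>\<tau>. (- 2 * \<i>) powr of_real k * (\<phi> \<tau> * h \<tau>))"
  proof (rule contour_integral_eq)
    fix \<tau> assume "\<tau> \<in> path_image (linepath a b)"
    then have \<tau>: "\<tau> \<in> closed_segment a b" by simp
    then have "Im \<tau> > 0" using seg by (auto simp: upper_half_plane_def)
    from kernel_factor_mult[OF this, of k]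
    show "?k \<tau> * (\<Sum>n. coef n * cayley \<tau> ^ n) = (- 2 * \<i>) powr of_real k * (\<phi> \<tau> * h \<tau>)"
      unfolding lim[OF \<tau>] plus_part_def by (metis mult.assoc mult.commute)
  qed
  also have "\<dots> = (- 2 * \<i>) powr of_real k * contour_integral (linepath a b) (\<lambda>\<tau>. \<phi> \<tau> * h \<tau>)"
    by (intro contour_integral_lmul contour_integrable_continuous_linepath continuous_intros \<phi>
         continuous_on_subset[OF holomorphic_on_imp_continuous_on[OF h] seg])
  finally show "bracket k h f = (- 2 * \<i>) powr of_real k * contour_integral (linepath a b) (\<lambda>\<tau>. \<phi> \<tau> * h \<tau>)" .
qed

section \<open>Cocycles as functions of both endpoints\<close>

lemma open_upper_half_plane: "open upper_half_plane" and open_lower_half_plane: "open lower_half_plane"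
  and convex_upper_half_plane: "convex upper_half_plane" and convex_lower_half_plane: "convex lower_half_plane"
  unfolding upper_half_plane_def lower_half_plane_def
  by (simp_all add: open_halfspace_Im_gt open_halfspace_Im_lt convex_halfspace_Im_gt convex_halfspace_Im_lt)

lemma i_in_upper_half_plane: "\<i> \<in> upper_half_plane"
  by (simp add: upper_half_plane_def)

text \<open>The whole segment moves with s; a primitive on the convex set leaves a dependence on the
  endpoints only.\<close>

lemma linepath_integral_has_field_derivative:
  assumes S: "open S" "convex S" "a \<in> S" and g: "g holomorphic_on S" and s: "s \<in> S"
  shows "((\<lambda>s. contour_integral (linepath a s) g) has_field_derivative g s) (at s)"
proof -
  obtain G where G: "\<And>x. x \<in> S \<Longrightarrow> (G has_field_derivative g x) (at x within S)"
    using holomorphic_convex_primitive'[OF S(2,1) g] by blast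
  have eq: "contour_integral (linepath b x) g = G x - G b" if "b \<in> S" "x \<in> S" for b x
  proof (rule contour_integral_unique)
    have "path_image (linepath b x) \<subseteq> S" using that S(2) by (simp add: closed_segment_subset)
    from contour_integral_primitive[OF G _ this]
    show "(g has_contour_integral G x - G b) (linepath b x)" by simp
  qed
  have "((\<lambda>s. G s - G a) has_field_derivative g s) (at s)"
    using G[OF s] S(1) s by (auto intro!: derivative_eq_intros simp: at_within_open[OF s S(1)])
  then show ?thesis
    by (rule has_field_derivative_transform_within_open[OF _ S(1) s]) (simp add: eq S(3))
qed

text \<open>The variables s and t stay independent because the integral is holomorphic in each.
  Setting t = \<open>cnj s\<close> gives a function that is not holomorphic; moving s up to the cusp
  gives the cocycle from \<i> to infinity. The exponent is a separate parameter, as differentiation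
  in t lowers it by 1.\<close>

definition partial_cocycle :: "(complex \<Rightarrow> complex) \<Rightarrow> real \<Rightarrow> complex \<Rightarrow> complex \<Rightarrow> complex" where
  "partial_cocycle f q s t = contour_integral (linepath \<i> s) (\<lambda>z. f z * (z - t) powr of_real q)"

lemma upper_minus_lower_not_nonpos:
  assumes "z \<in> upper_half_plane" "t \<in> lower_half_plane"
  shows "z - t \<notin> \<real>\<^sub>\<le>\<^sub>0"
  using assms by (auto simp: upper_half_plane_def lower_half_plane_def complex_nonpos_Reals_iff)

lemma cocycle_kernel_holomorphic:
  assumes "f holomorphic_on upper_half_plane" "t \<in> lower_half_plane"
  shows "(\<lambda>z. f z * (z - t) powr of_real q) holomorphic_on upper_half_plane"
  using assms upper_minus_lower_not_nonpos by (intro holomorphic_intros) auto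

lemma continuous_on_cocycle_kernel:
  assumes "continuous_on A f" "A \<subseteq> upper_half_plane"
  shows "continuous_on (lower_half_plane \<times> A) (\<lambda>(t, z). f z * (z - t) powr of_real q)"
proof -
  have "continuous_on (lower_half_plane \<times> A) (\<lambda>p. f (snd p))"
    by (rule continuous_on_compose2[OF assms(1)]) (auto intro!: continuous_intros)
  moreover have "Im (snd p - fst p) > 0" if "p \<in> lower_half_plane \<times> A" for p
    using that assms(2) by (fastforce simp: lower_half_plane_def upper_half_plane_def)
  then have "continuous_on (lower_half_plane \<times> A) (\<lambda>p. (snd p - fst p) powr complex_of_real q)"
    by (intro continuous_on_powr_complex continuous_intros) (force, fastforce)
  ultimately show ?thesis by (simp add: split_beta continuous_on_mult)
qed

lemma segment_cocycle_has_field_derivative: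
  assumes f: "continuous_on (closed_segment a b) f"
    and ab: "a \<in> upper_half_plane" "b \<in> upper_half_plane" and t: "t \<in> lower_half_plane"
  shows "((\<lambda>t. contour_integral (linepath a b) (\<lambda>z. f z * (z - t) powr of_real q)) has_field_derivative
     - of_real q * contour_integral (linepath a b) (\<lambda>z. f z * (z - t) powr of_real (q - 1))) (at t)"
proof -
  note seg = closed_segment_in_upper_half_plane[OF ab]
  have c: "continuous_on (lower_half_plane \<times> closed_segment a b) (\<lambda>(t, z). f z * (z - t) powr of_real q)" for q
    by (rule continuous_on_cocycle_kernel[OF f seg])
  have slice: "continuous_on (closed_segment a b) (\<lambda>z. f z * (z - t) powr of_real q)" if "t \<in> lower_half_plane" for t q
  proof -
    have "continuous_on (closed_segment a b) (\<lambda>z. (\<lambda>(t, z). f z * (z - t) powr of_real q) (t, z))"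
      by (rule continuous_on_compose2[OF c]) (use that in \<open>auto intro!: continuous_intros\<close>)
    then show ?thesis by simp
  qed
  have "((\<lambda>t. contour_integral (linepath a b) (\<lambda>z. f z * (z - t) powr of_real q)) has_field_derivative
     contour_integral (linepath a b) (\<lambda>z. - of_real q * (f z * (z - t) powr of_real (q - 1)))) (at t)"
  proof (rule contour_integral_linepath_has_field_derivative[OF open_lower_half_plane convex_lower_half_plane t])
    fix t z assume t: "t \<in> lower_half_plane" and z: "z \<in> closed_segment a b"
    have "z - t \<notin> \<real>\<^sub>\<le>\<^sub>0" using seg z t by (intro upper_minus_lower_not_nonpos) auto
    then have "((\<lambda>t. (z - t) powr of_real q) has_field_derivative of_real q * (z - t) powr (of_real q - 1) * (- 1)) (at t)"
      by (intro DERIV_chain2[OF has_field_derivative_powr]) (auto intro!: derivative_eq_intros)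
    from DERIV_cmult[OF this, of "f z"]
    show "((\<lambda>t. f z * (z - t) powr of_real q) has_field_derivative - of_real q * (f z * (z - t) powr of_real (q - 1))) (at t)"
      by (rule DERIV_cong) simp
  next
    show "continuous_on (lower_half_plane \<times> closed_segment a b) (\<lambda>(t, z). - of_real q * (f z * (z - t) powr of_real (q - 1)))"
      using continuous_on_mult_left[OF c[of "q - 1"], of "- of_real q"] by (simp add: split_beta)
  qed (rule slice)
  also have "contour_integral (linepath a b) (\<lambda>z. - of_real q * (f z * (z - t) powr of_real (q - 1))) =
      - of_real q * contour_integral (linepath a b) (\<lambda>z. f z * (z - t) powr of_real (q - 1))"
    by (intro contour_integral_lmul contour_integrable_continuous_linepath slice t)
  finally show ?thesis .
qed

context
  fixes f :: "complex \<Rightarrow> complex"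
  assumes f: "f holomorphic_on upper_half_plane"
begin

lemma partial_cocycle_has_field_derivative_upper:
  assumes "s \<in> upper_half_plane" "t \<in> lower_half_plane"
  shows "((\<lambda>s. partial_cocycle f q s t) has_field_derivative f s * (s - t) powr of_real q) (at s)"
  unfolding partial_cocycle_def
  by (intro linepath_integral_has_field_derivative[OF open_upper_half_plane convex_upper_half_plane i_in_upper_half_plane]
       cocycle_kernel_holomorphic f assms)

lemma partial_cocycle_has_field_derivative_lower:
  assumes s: "s \<in> upper_half_plane" and t: "t \<in> lower_half_plane"
  shows "((\<lambda>t. partial_cocycle f q s t) has_field_derivative - of_real q * partial_cocycle f (q - 1) s t) (at t)"
  unfolding partial_cocycle_def
  by (rule segment_cocycle_has_field_derivative[OF _ i_in_upper_half_plane s t])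
     (rule continuous_on_subset[OF holomorphic_on_imp_continuous_on[OF f]
        closed_segment_in_upper_half_plane[OF i_in_upper_half_plane s]])

text \<open>Applied to the exponent q - 1, this makes the t-derivative jointly continuous, which
  turns the two separate derivatives into a total one.\<close>

lemma continuous_on_partial_cocycle:
  "continuous_on (upper_half_plane \<times> lower_half_plane) (\<lambda>(s, t). partial_cocycle f q s t)"
proof -
  let ?X = "upper_half_plane \<times> lower_half_plane"
  let ?K = "\<lambda>(t, z). f z * (z - t) powr of_real q"
  have seg: "linepath \<i> s x \<in> upper_half_plane" if "s \<in> upper_half_plane" "x \<in> {0..1}" for s x
    using closed_segment_in_upper_half_plane[OF i_in_upper_half_plane that(1)] linepath_in_path[OF that(2)] by blast
  have c: "continuous_on (?X \<times> cbox 0 1) (\<lambda>p. (snd (fst p), linepath \<i> (fst (fst p)) (snd p)))"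
    unfolding linepath_def by (intro continuous_intros)
  have "continuous_on (?X \<times> cbox 0 1) (\<lambda>p. ?K (snd (fst p), linepath \<i> (fst (fst p)) (snd p)))"
    by (rule continuous_on_compose2[OF continuous_on_cocycle_kernel[OF holomorphic_on_imp_continuous_on[OF f] order_refl] c])
       (use seg in auto)
  then have "continuous_on (?X \<times> cbox 0 1) (\<lambda>(p, x). ?K (snd p, linepath \<i> (fst p) x) * (fst p - \<i>))"
    by (auto simp: split_beta intro!: continuous_intros)
  then have "continuous_on ?X (\<lambda>p. integral (cbox 0 1) (\<lambda>x. ?K (snd p, linepath \<i> (fst p) x) * (fst p - \<i>)))"
    by (rule integral_continuous_on_param)
  then show ?thesis
    by (simp add: partial_cocycle_def contour_integral_integral split_beta)
qed

text \<open>The chain rule along s = \<tau>, t = \<open>cnj \<tau>\<close>. The term from the moving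
  endpoint is the evaluated kernel; its conjugate will be the density of the Petersson
  product.\<close>

lemma partial_cocycle_diagonal_has_derivative:
  assumes \<tau>: "\<tau> \<in> upper_half_plane"
  shows "((\<lambda>\<tau>. partial_cocycle f q \<tau> (cnj \<tau>)) has_derivative
    (\<lambda>h. f \<tau> * (\<tau> - cnj \<tau>) powr of_real q * h - of_real q * partial_cocycle f (q - 1) \<tau> (cnj \<tau>) * cnj h)) (at \<tau>)"
proof -
  let ?X = "upper_half_plane \<times> lower_half_plane"
  let ?D = "\<lambda>s t. - of_real q * partial_cocycle f (q - 1) s t"
  have ct: "cnj \<tau> \<in> lower_half_plane" using \<tau> by (simp add: upper_half_plane_def lower_half_plane_def)
  have X: "(\<tau>, cnj \<tau>) \<in> ?X" "open ?X"
    using \<tau> ct by (auto intro: open_Times open_upper_half_plane open_lower_half_plane)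
  have "((\<lambda>(s, t). partial_cocycle f q s t) has_derivative
      (\<lambda>(h, k). f \<tau> * (\<tau> - cnj \<tau>) powr of_real q * h + blinfun_apply (blinfun_mult_right (?D \<tau> (cnj \<tau>))) k))
      (at (\<tau>, cnj \<tau>) within ?X)"
  proof (rule has_derivative_partialsI)
    show "((\<lambda>s. partial_cocycle f q s (cnj \<tau>)) has_derivative (*) (f \<tau> * (\<tau> - cnj \<tau>) powr of_real q)) (at \<tau> within upper_half_plane)"
      using partial_cocycle_has_field_derivative_upper[OF \<tau> ct] has_derivative_at_withinI
      unfolding has_field_derivative_def by blast
    show "((\<lambda>t. partial_cocycle f q s t) has_derivative blinfun_apply (blinfun_mult_right (?D s t))) (at t within lower_half_plane)"
      if "s \<in> upper_half_plane" "t \<in> lower_half_plane" for s t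
      using has_derivative_at_withinI[OF partial_cocycle_has_field_derivative_lower[OF that, unfolded has_field_derivative_def]]
      by (simp only: blinfun_mult_right.rep_eq)
    have "continuous_on ?X (\<lambda>p. (\<lambda>(s, t). partial_cocycle f (q - 1) s t) p)"
      by (rule continuous_on_partial_cocycle)
    then have "continuous_on ?X (\<lambda>p. blinfun_mult_right (- of_real q * (\<lambda>(s, t). partial_cocycle f (q - 1) s t) p))"
      by (intro bounded_linear.continuous_on[OF bounded_linear_blinfun_mult_right] continuous_intros)
    then show "continuous (at (\<tau>, cnj \<tau>) within ?X) (\<lambda>(s, t). blinfun_mult_right (?D s t))"
      using X(1) unfolding continuous_on_eq_continuous_within split_beta by (simp only:)
  qed (use ct convex_lower_half_plane in auto)
  then have d: "((\<lambda>(s, t). partial_cocycle f q s t) has_derivative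
      (\<lambda>(h, k). f \<tau> * (\<tau> - cnj \<tau>) powr of_real q * h + ?D \<tau> (cnj \<tau>) * k)) (at (\<tau>, cnj \<tau>))"
    by (simp only: at_within_open[OF X] blinfun_mult_right.rep_eq)
  have "((\<lambda>\<tau>. (\<tau>, cnj \<tau>)) has_derivative (\<lambda>h. (h, cnj h))) (at \<tau>)"
    by (intro has_derivative_Pair has_derivative_ident bounded_linear.has_derivative[OF bounded_linear_cnj])
  from has_derivative_compose[OF this d]
  show ?thesis by (simp add: split_beta)
qed

end

section \<open>Decay of cusp forms and convergence at the cusp\<close>

lemma cusp_form_decay:
  assumes "f \<in> cusp_forms r v" "a > 0"
  obtains C Y where "C \<ge> 0" "Y \<ge> 1" "\<And>z. Im z \<ge> Y \<Longrightarrow> norm (f z) \<le> C * Im z powr (- a)"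
proof -
  have "f \<in> O[filtercomap Im at_top](\<lambda>z. of_real (Im z powr (- a)))"
    using assms by (auto simp: cusp_forms_def)
  then obtain c where c: "c > 0" "eventually (\<lambda>z. norm (f z) \<le> c * norm (of_real (Im z powr (- a)) :: complex)) (filtercomap Im at_top)"
    by (elim landau_o.bigE)
  from c(2) obtain P where P: "eventually P at_top" "\<And>z. P (Im z) \<Longrightarrow> norm (f z) \<le> c * norm (of_real (Im z powr (- a)) :: complex)"
    by (auto simp: eventually_filtercomap)
  from P(1) obtain Y where Y: "\<And>y. y \<ge> Y \<Longrightarrow> P y" by (auto simp: eventually_at_top_linorder)
  show ?thesis
  proof (rule that[of c "max 1 Y"])
    fix z assume "Im z \<ge> max 1 Y"
    then show "norm (f z) \<le> c * Im z powr (- a)" using P(2)[OF Y, of z] by simp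
  qed (use c in auto)
qed

text \<open>A convex set around the fundamental domain, which is not convex itself: a segment from a
  point of the domain to a point on the imaginary axis of height at least 1 stays inside.\<close>

definition half_strip :: "complex set" where
  "half_strip = {z. \<bar>Re z\<bar> \<le> 1/2 \<and> Im z \<ge> 1/2}"

lemma half_strip_subset: "half_strip \<subseteq> upper_half_plane"
  by (auto simp: half_strip_def upper_half_plane_def)

lemma convex_half_strip: "convex half_strip"
proof -
  have eq: "half_strip = {z. Re z \<ge> -1/2} \<inter> {z. Re z \<le> 1/2} \<inter> {z. Im z \<ge> 1/2}"
    by (auto simp: half_strip_def)
  show ?thesis
    unfolding eq by (intro convex_Int convex_halfspace_Re_ge convex_halfspace_Re_le convex_halfspace_Im_ge)
qed

lemma fundamental_domain_subset_half_strip: "fundamental_domain \<subseteq> half_strip"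
proof
  fix z assume z: "z \<in> fundamental_domain"
  then have z': "Im z > 0" "\<bar>Re z\<bar> \<le> 1/2" "1 \<le> norm z" by (auto simp: fundamental_domain_def)
  have "(Re z)\<^sup>2 \<le> (1/2)\<^sup>2" using z'(2) by (intro power2_le_iff_abs_le[THEN iffD2]) simp_all
  moreover have "1 \<le> (Re z)\<^sup>2 + (Im z)\<^sup>2"
    unfolding cmod_power2[symmetric] using z'(3) by (rule one_le_power)
  ultimately have "(1/2)\<^sup>2 \<le> (Im z)\<^sup>2" by (simp add: power2_eq_square)
  then have "1/2 \<le> Im z" by (rule power2_le_imp_le) (use z' in auto)
  then show "z \<in> half_strip" using z' by (simp add: half_strip_def)
qed

lemma cusp_form_bound_half_strip:
  assumes f: "f \<in> cusp_forms r v" and a: "a > 0"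
  obtains C where "C \<ge> 0" "\<And>z. z \<in> half_strip \<Longrightarrow> norm (f z) \<le> C * Im z powr (- a)"
proof -
  obtain C Y where CY: "C \<ge> 0" "Y \<ge> 1" "\<And>z. Im z \<ge> Y \<Longrightarrow> norm (f z) \<le> C * Im z powr (- a)"
    using cusp_form_decay[OF f a] by blast
  have hol: "f holomorphic_on upper_half_plane" using f by (simp add: cusp_forms_def)
  let ?K = "cbox (Complex (-1/2) (1/2)) (Complex (1/2) Y)"
  have K: "?K \<subseteq> upper_half_plane" by (auto simp: in_cbox_complex_iff upper_half_plane_def)
  have "bounded (f ` ?K)"
    by (intro compact_imp_bounded compact_continuous_image compact_cbox
        continuous_on_subset[OF holomorphic_on_imp_continuous_on[OF hol] K])
  then obtain B where B: "\<And>z. z \<in> ?K \<Longrightarrow> norm (f z) \<le> B" by (auto simp: bounded_iff)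
  \<comment> \<open>Below height Y compactness bounds f by B, and (Y / Im z)^a is at least 1 there;
    hence the second constant.\<close>
  show ?thesis
  proof (rule that[of "max C (\<bar>B\<bar> * Y powr a)"])
    fix z assume z: "z \<in> half_strip"
    show "norm (f z) \<le> max C (\<bar>B\<bar> * Y powr a) * Im z powr (- a)"
    proof (cases "Im z \<ge> Y")
      case True
      from CY(3)[OF this] show ?thesis
        by (rule order_trans) (intro mult_right_mono, auto)
    next
      case False
      have pos: "Im z > 0" using z by (simp add: half_strip_def)
      have "z \<in> ?K" using z False by (auto simp: half_strip_def in_cbox_complex_iff)
      then have "norm (f z) \<le> \<bar>B\<bar> * 1" using B by fastforce
      also have "1 \<le> (Y / Im z) powr a"
        using False pos a by (intro ge_one_powr_ge_zero) (auto simp: field_simps)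
      also have "(Y / Im z) powr a = Y powr a * Im z powr (- a)"
        using pos CY(2) by (simp add: powr_divide powr_minus field_simps)
      finally have "norm (f z) \<le> (\<bar>B\<bar> * Y powr a) * Im z powr (- a)" by (simp add: mult_left_mono mult.assoc)
      then show ?thesis by (rule order_trans) (intro mult_right_mono, auto)
    qed
  qed (use CY in auto)
qed

text \<open>Negative exponents are controlled by the lower bound 1/2, which gives 1 / |z| at most 2;
  the base 2B covers both signs.\<close>

lemma norm_powr_le:
  fixes z :: complex
  assumes "1/2 \<le> norm z" "norm z \<le> B" "1 \<le> B"
  shows "norm (z powr of_real q) \<le> (2 * B) powr \<bar>q\<bar>"
proof -
  have "norm (z powr of_real q) = norm z powr q" by (simp add: norm_powr_real_powr')
  also have "\<dots> \<le> (2 * B) powr \<bar>q\<bar>"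
  proof (cases "q \<ge> 0")
    case True
    then show ?thesis using assms by (auto intro!: powr_mono2)
  next
    case False
    have "norm z powr q = (1 / norm z) powr \<bar>q\<bar>"
      using False assms by (simp add: powr_divide powr_minus_divide)
    also have "\<dots> \<le> (2 * B) powr \<bar>q\<bar>"
    proof (rule powr_mono2)
      have "1 / norm z \<le> 2" using assms by (simp add: divide_le_eq)
      then show "1 / norm z \<le> 2 * B" using assms by linarith
    qed auto
    finally show ?thesis .
  qed
  finally show ?thesis .
qed

lemma norm_minus_ge_Im:
  assumes "z \<in> upper_half_plane" "t \<in> lower_half_plane"
  shows "Im z \<le> norm (z - t)"
  using abs_Im_le_cmod[of "z - t"] assms by (simp add: upper_half_plane_def lower_half_plane_def)

text \<open>The strip |Re z| at most 1 contains a vertical line and its translate by 1. The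
  dependence on t is explicit because t = \<open>cnj \<tau>\<close> will tend to infinity.\<close>

lemma cocycle_kernel_decay:
  assumes f: "f \<in> cusp_forms r v"
  obtains K Y where "K \<ge> 0" "Y \<ge> 1"
    "\<And>z t. \<lbrakk>t \<in> lower_half_plane; \<bar>Re z\<bar> \<le> 1; Im z \<ge> Y\<rbrakk> \<Longrightarrow>
       norm (f z * (z - t) powr of_real q) \<le> K * (2 + norm t) powr \<bar>q\<bar> / (Im z)\<^sup>2"
proof -
  let ?m = "\<bar>q\<bar>"
  \<comment> \<open>Of the decay exponent |q| + 2, the part |q| absorbs the growth of the kernel and
    2 is left for integrability.\<close>
  have "0 < ?m + 2" by simp
  then obtain C Y where CY: "C \<ge> 0" "Y \<ge> 1" "\<And>z. Im z \<ge> Y \<Longrightarrow> norm (f z) \<le> C * Im z powr (- (?m + 2))"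
    using cusp_form_decay[OF f] by blast
  show ?thesis
  proof (rule that[of "C * 2 powr ?m" Y])
    fix z t assume t: "t \<in> lower_half_plane" and z: "\<bar>Re z\<bar> \<le> 1" "Im z \<ge> Y"
    have y: "Im z \<ge> 1" using z CY by simp
    have ge: "1/2 \<le> norm (z - t)" using norm_minus_ge_Im[OF _ t, of z] y by (simp add: upper_half_plane_def)
    have "norm (z - t) \<le> norm z + norm t" by (rule norm_triangle_ineq4)
    also have "norm z \<le> \<bar>Re z\<bar> + \<bar>Im z\<bar>" by (rule cmod_le)
    also have "\<dots> \<le> 2 * Im z" using z y by simp
    also have "norm t \<le> norm t * Im z" using y by (simp add: mult_le_cancel_left1)
    finally have le: "norm (z - t) \<le> (2 + norm t) * Im z" by (simp add: algebra_simps)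
    have "1 * 1 \<le> (2 + norm t) * Im z" using y by (intro mult_mono) auto
    then have "norm ((z - t) powr of_real q) \<le> (2 * ((2 + norm t) * Im z)) powr ?m"
      by (intro norm_powr_le ge le) simp
    also have "\<dots> = 2 powr ?m * (2 + norm t) powr ?m * Im z powr ?m"
      using y by (simp add: powr_mult)
    finally have "norm (f z * (z - t) powr of_real q) \<le>
        (C * Im z powr (- (?m + 2))) * (2 powr ?m * (2 + norm t) powr ?m * Im z powr ?m)"
      unfolding norm_mult using CY(1) by (intro mult_mono CY(3) z) auto
    also have "\<dots> = C * 2 powr ?m * (2 + norm t) powr ?m * (Im z powr (- (?m + 2)) * Im z powr ?m)" by simp
    also have "Im z powr (- (?m + 2)) * Im z powr ?m = 1 / (Im z)\<^sup>2"
      using y by (simp add: powr_add[symmetric] powr_minus_divide)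
    finally show "norm (f z * (z - t) powr of_real q) \<le> C * 2 powr ?m * (2 + norm t) powr \<bar>q\<bar> / (Im z)\<^sup>2" by simp
  qed (use CY in auto)
qed

text \<open>A derivative of size B / x^2 allows an increment of at most B / y above height y. This
  yields a limit with a rate, and the limit is the one in the definition of the cocycle.\<close>

lemma partial_cocycle_converges:
  assumes f: "f \<in> cusp_forms r v"
  obtains K Y where "K \<ge> 0" "Y \<ge> 1"
    "\<And>y t. \<lbrakk>t \<in> lower_half_plane; y \<ge> Y\<rbrakk> \<Longrightarrow>
       norm (partial_cocycle f (r - 2) (\<i> * of_real y) t - eichler_cocycle r f (Interior \<i>) Cusp_Infinity t)
         \<le> K * (2 + norm t) powr \<bar>r - 2\<bar> / y"
proof -
  let ?q = "r - 2"
  let ?P = "partial_cocycle f (r - 2)"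
  have hol: "f holomorphic_on upper_half_plane" using f by (simp add: cusp_forms_def)
  obtain K Y where KY: "K \<ge> 0" "Y \<ge> 1"
    "\<And>z t. \<lbrakk>t \<in> lower_half_plane; \<bar>Re z\<bar> \<le> 1; Im z \<ge> Y\<rbrakk> \<Longrightarrow>
       norm (f z * (z - t) powr of_real ?q) \<le> K * (2 + norm t) powr \<bar>?q\<bar> / (Im z)\<^sup>2"
    using cocycle_kernel_decay[OF f] by blast
  let ?B = "\<lambda>t. K * (2 + norm t) powr \<bar>?q\<bar>"
  have diff: "norm (?P (\<i> * of_real y') t - ?P (\<i> * of_real y) t) \<le> ?B t / y"
    if t: "t \<in> lower_half_plane" and y: "Y \<le> y" "y \<le> y'" for t y y'
  proof (cases "y = y'")
    case True
    then show ?thesis using KY y by simp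
  next
    case False
    have up: "\<i> * of_real x \<in> upper_half_plane" if "x \<ge> y" for x
      using that y KY by (simp add: upper_half_plane_def)
    have d: "((\<lambda>x. ?P (\<i> * of_real x) t) has_vector_derivative
        \<i> * (f (\<i> * of_real x) * (\<i> * of_real x - t) powr of_real ?q)) (at x within S)" if "x \<ge> y" for x S
    proof -
      have "((\<lambda>x. \<i> * of_real x) has_vector_derivative \<i>) (at x within S)"
        by (auto intro!: derivative_eq_intros)
      from field_vector_diff_chain_within[OF this has_field_derivative_at_within[OF
          partial_cocycle_has_field_derivative_upper[OF hol up[OF that] t]]]
      show ?thesis by (simp only: o_def)
    qed
    have "norm (?P (\<i> * of_real y') t - ?P (\<i> * of_real y) t) \<le> - ?B t / y' - (- ?B t / y)"
    proof (rule differentiable_bound_general)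
      show "y < y'" using y False by simp
      show "continuous_on {y..y'} (\<lambda>x. ?P (\<i> * of_real x) t)"
        using d by (intro continuous_on_vector_derivative) auto
      show "continuous_on {y..y'} (\<lambda>x. - ?B t / x)"
        using y KY by (intro continuous_intros) auto
      show "((\<lambda>x. - ?B t / x) has_vector_derivative ?B t / x\<^sup>2) (at x)" if "y < x" for x
        unfolding has_real_derivative_iff_has_vector_derivative[symmetric]
        using that y KY by (auto intro!: derivative_eq_intros simp: power2_eq_square)
      show "((\<lambda>x. ?P (\<i> * of_real x) t) has_vector_derivative
        \<i> * (f (\<i> * of_real x) * (\<i> * of_real x - t) powr of_real ?q)) (at x)" if "y < x" for x
        using that by (intro d) simp
      show "norm (\<i> * (f (\<i> * of_real x) * (\<i> * of_real x - t) powr of_real ?q)) \<le> ?B t / x\<^sup>2" if "y < x" for x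
        using KY(3)[OF t, of "\<i> * of_real x"] that y by (simp add: norm_mult)
    qed
    also have "\<dots> \<le> ?B t / y" using KY y by simp
    finally show ?thesis .
  qed
  have conv: "\<exists>L. \<forall>y\<ge>Y. norm (?P (\<i> * of_real y) t - L) \<le> ?B t / y" if t: "t \<in> lower_half_plane" for t
  proof -
    \<comment> \<open>Completeness is applied along integer heights; the increment bound then
      extends the limit to all real heights.\<close>
    have "Cauchy (\<lambda>n. ?P (\<i> * of_real (real n)) t)"
    proof (rule metric_CauchyI)
      fix e :: real assume e: "e > 0"
      obtain N :: nat where N: "real N > max Y (?B t / e)" using reals_Archimedean2 by blast
      have N0: "real N > 0" using N KY by simp
      have lt: "?B t / real N < e" using N e N0 by (simp add: field_simps)
      have main: "dist (?P (\<i> * of_real (real m)) t) (?P (\<i> * of_real (real n)) t) < e"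
        if "N \<le> n" "n \<le> m" for m n
      proof -
        have "norm (?P (\<i> * of_real (real m)) t - ?P (\<i> * of_real (real n)) t) \<le> ?B t / real n"
          using that N by (intro diff t) auto
        also have "\<dots> \<le> ?B t / real N" using that N0 KY(1) by (intro divide_left_mono) auto
        finally show ?thesis using lt by (simp add: dist_norm)
      qed
      show "\<exists>M. \<forall>m\<ge>M. \<forall>n\<ge>M. dist (?P (\<i> * of_real (real m)) t) (?P (\<i> * of_real (real n)) t) < e"
      proof (intro exI[of _ N] allI impI)
        fix m n assume "N \<le> m" "N \<le> n"
        then show "dist (?P (\<i> * of_real (real m)) t) (?P (\<i> * of_real (real n)) t) < e"
          using main[of n m] main[of m n] by (cases "n \<le> m") (auto simp: dist_commute)
      qed
    qed
    then obtain L where L: "(\<lambda>n. ?P (\<i> * of_real (real n)) t) \<longlonglongrightarrow> L"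
      using Cauchy_convergent by (auto simp: convergent_def)
    have "norm (?P (\<i> * of_real y) t - L) \<le> ?B t / y" if y: "y \<ge> Y" for y
    proof -
      have "norm (L - ?P (\<i> * of_real y) t) \<le> ?B t / y"
      proof (rule tendsto_upperbound)
        show "(\<lambda>n. norm (?P (\<i> * of_real (real n)) t - ?P (\<i> * of_real y) t)) \<longlonglongrightarrow> norm (L - ?P (\<i> * of_real y) t)"
          by (intro tendsto_intros L)
        have "eventually (\<lambda>n. real n \<ge> y) sequentially"
          using filterlim_real_sequentially by (auto simp: filterlim_at_top)
        then show "eventually (\<lambda>n. norm (?P (\<i> * of_real (real n)) t - ?P (\<i> * of_real y) t) \<le> ?B t / y) sequentially"
          by eventually_elim (intro diff t y)
      qed simp
      then show ?thesis by (simp add: norm_minus_commute)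
    qed
    then show ?thesis by blast
  qed
  have "norm (?P (\<i> * of_real y) t - eichler_cocycle r f (Interior \<i>) Cusp_Infinity t) \<le> ?B t / y"
    if t: "t \<in> lower_half_plane" and y: "y \<ge> Y" for t y
  proof -
    obtain L where L: "\<And>y. y \<ge> Y \<Longrightarrow> norm (?P (\<i> * of_real y) t - L) \<le> ?B t / y"
      using conv[OF t] by blast
    have "((\<lambda>y. ?P (\<i> * of_real y) t - L) \<longlongrightarrow> 0) at_top"
    proof (rule Lim_null_comparison)
      show "eventually (\<lambda>y. norm (?P (\<i> * of_real y) t - L) \<le> ?B t / y) at_top"
        using eventually_ge_at_top[of Y] by eventually_elim (rule L)
      show "((\<lambda>y. ?B t / y) \<longlongrightarrow> 0) at_top" by real_asymp
    qed
    then have "((\<lambda>y. ?P (\<i> * of_real y) t) \<longlongrightarrow> L) at_top" by (simp add: LIM_zero_iff)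
    \<comment> \<open>With one endpoint fixed, the product filter is the filter of the single
      vertical line through \<i>.\<close>
    moreover have "approach (Interior \<i>) \<times>\<^sub>F approach Cusp_Infinity = filtermap (\<lambda>y. (\<i>, \<i> * of_real y)) at_top"
      by (simp add: prod_filter_principal_singleton filtermap_filtermap)
    ultimately have "eichler_cocycle r f (Interior \<i>) Cusp_Infinity t = L"
      unfolding eichler_cocycle_def
      by (intro tendsto_Lim) (auto simp: filtermap_bot_iff filterlim_filtermap partial_cocycle_def)
    then show ?thesis using L[OF y] by simp
  qed
  then show ?thesis using that KY(1,2) by blast
qed

section \<open>The cocycle with endpoint at infinity\<close>

abbreviation cusp_cocycle :: "real \<Rightarrow> (complex \<Rightarrow> complex) \<Rightarrow> complex \<Rightarrow> complex" where
  "cusp_cocycle r f \<equiv> eichler_cocycle r f (Interior \<i>) Cusp_Infinity"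

text \<open>The truncation heights start at 1: for n = 0 the height n itself would give a real
  endpoint.\<close>

lemma Suc_i_in_upper_half_plane: "\<i> * of_real (real (Suc n)) \<in> upper_half_plane"
  by (simp add: upper_half_plane_def)

lemma partial_cocycle_uniform_limit:
  assumes f: "f \<in> cusp_forms r v" and S: "S \<subseteq> lower_half_plane" "bounded S"
  shows "uniform_limit S (\<lambda>n. partial_cocycle f (r - 2) (\<i> * of_real (real (Suc n)))) (cusp_cocycle r f) sequentially"
proof -
  obtain K Y where KY: "K \<ge> 0" "Y \<ge> 1"
    "\<And>y t. \<lbrakk>t \<in> lower_half_plane; y \<ge> Y\<rbrakk> \<Longrightarrow>
       norm (partial_cocycle f (r - 2) (\<i> * of_real y) t - cusp_cocycle r f t) \<le> K * (2 + norm t) powr \<bar>r - 2\<bar> / y"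
    using partial_cocycle_converges[OF f] by blast
  obtain M where M: "\<And>t. t \<in> S \<Longrightarrow> norm t \<le> M" using S(2) by (auto simp: bounded_iff)
  define B where "B = K * (2 + M) powr \<bar>r - 2\<bar>"
  have lim: "(\<lambda>n. B / real (Suc n)) \<longlonglongrightarrow> 0" by real_asymp
  show ?thesis
  proof (rule uniform_limitI)
    fix e :: real assume "e > 0"
    with lim have "eventually (\<lambda>n. B / real (Suc n) < e) sequentially" by (rule order_tendstoD)
    moreover have "eventually (\<lambda>n. real n \<ge> Y) sequentially"
      using filterlim_real_sequentially by (auto simp: filterlim_at_top)
    ultimately show "eventually (\<lambda>n. \<forall>t\<in>S. dist (partial_cocycle f (r - 2) (\<i> * of_real (real (Suc n))) t) (cusp_cocycle r f t) < e) sequentially"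
    proof eventually_elim
      case (elim n)
      show ?case
      proof
        fix t assume t: "t \<in> S"
        have "norm (partial_cocycle f (r - 2) (\<i> * of_real (real (Suc n))) t - cusp_cocycle r f t)
            \<le> K * (2 + norm t) powr \<bar>r - 2\<bar> / real (Suc n)"
          using elim t S(1) by (intro KY(3)) auto
        also have "\<dots> \<le> B / real (Suc n)"
          unfolding B_def using M[OF t] KY(1) by (intro divide_right_mono mult_left_mono powr_mono2) auto
        finally show "dist (partial_cocycle f (r - 2) (\<i> * of_real (real (Suc n))) t) (cusp_cocycle r f t) < e"
          using elim(1) by (simp add: dist_norm)
      qed
    qed
  qed
qed

lemma cusp_cocycle_holomorphic:
  assumes f: "f \<in> cusp_forms r v"
  shows "cusp_cocycle r f holomorphic_on lower_half_plane"
proof (rule holomorphic_uniform_sequence[OF open_lower_half_plane])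
  have hol: "f holomorphic_on upper_half_plane" using f by (simp add: cusp_forms_def)
  show "partial_cocycle f (r - 2) (\<i> * of_real (real (Suc n))) holomorphic_on lower_half_plane" for n
    unfolding holomorphic_on_open[OF open_lower_half_plane]
    using partial_cocycle_has_field_derivative_lower[OF hol Suc_i_in_upper_half_plane] by blast
  fix t assume "t \<in> lower_half_plane"
  then obtain d where d: "d > 0" "cball t d \<subseteq> lower_half_plane"
    using open_lower_half_plane open_contains_cball by blast
  then show "\<exists>d>0. cball t d \<subseteq> lower_half_plane \<and>
      uniform_limit (cball t d) (\<lambda>n. partial_cocycle f (r - 2) (\<i> * of_real (real (Suc n)))) (cusp_cocycle r f) sequentially"
    using partial_cocycle_uniform_limit[OF f d(2)] by blast
qed

lemma knopp_cocycle_holomorphic: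
  assumes f: "f \<in> cusp_forms r v"
  shows "knopp_cocycle r f (Interior \<i>) Cusp_Infinity holomorphic_on upper_half_plane"
proof -
  have "cnj ` upper_half_plane = lower_half_plane"
    unfolding image_cnj_conv_vimage_cnj by (auto simp: upper_half_plane_def lower_half_plane_def)
  then have "cnj \<circ> cusp_cocycle r f \<circ> cnj holomorphic_on upper_half_plane"
    using cusp_cocycle_holomorphic[OF f] by (intro holomorphic_on_compose_cnj_cnj open_upper_half_plane) simp
  then show ?thesis by (simp add: knopp_cocycle_def[abs_def] o_def)
qed

lemma higher_deriv_cnj_cnj:
  assumes "f holomorphic_on ball 0 R" "w \<in> ball 0 R"
  shows "(deriv ^^ n) (\<lambda>w. cnj (f (cnj w))) w = cnj ((deriv ^^ n) f (cnj w))"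
  using assms(2)
proof (induction n arbitrary: w)
  case (Suc n)
  have "(deriv ^^ n) f holomorphic_on ball 0 R" by (intro holomorphic_higher_deriv assms(1)) simp
  then have "((deriv ^^ n) f has_field_derivative (deriv ^^ Suc n) f (cnj w)) (at (cnj w))"
    using Suc.prems by (simp add: holomorphic_derivI)
  then have "((\<lambda>w. cnj ((deriv ^^ n) f (cnj w))) has_field_derivative cnj ((deriv ^^ Suc n) f (cnj w))) (at w)"
    using has_field_derivative_cnj_cnj[of "(deriv ^^ n) f" _ w] by (simp add: o_def)
  then have "((deriv ^^ n) (\<lambda>w. cnj (f (cnj w))) has_field_derivative cnj ((deriv ^^ Suc n) f (cnj w))) (at w)"
    by (rule has_field_derivative_transform_within_open[OF _ open_ball Suc.prems]) (simp add: Suc.IH)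
  then show ?case by (simp add: DERIV_imp_deriv)
qed simp

text \<open>For r = m + 2 the function h^+ is a polynomial of degree at most m in w. This is seen on
  truncations of the integral: their n-th derivative at 0 has the factor (-m)_n, which is 0 for n >
  m. Uniform convergence carries the vanishing to the limit, and conjugation moves it to the upper
  half-plane.\<close>

lemma higher_deriv_plus_part_knopp_cocycle:
  assumes f: "f \<in> cusp_forms r v" and m: "2 - r = - real m" and n: "m < n"
  shows "(deriv ^^ n) (\<lambda>w. plus_part (2 - r) (knopp_cocycle r f (Interior \<i>) Cusp_Infinity) (cayley_inv w)) 0 = 0"
proof -
  let ?k = "2 - r"
  let ?P = "\<lambda>n. partial_cocycle f (r - 2) (\<i> * of_real (real (Suc n)))"
  have hol: "f holomorphic_on upper_half_plane" using f by (simp add: cusp_forms_def)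
  have f_seg: "continuous_on (closed_segment \<i> (\<i> * of_real (real (Suc n)))) f" for n
    by (rule continuous_on_subset[OF holomorphic_on_imp_continuous_on[OF hol]
          closed_segment_in_upper_half_plane[OF i_in_upper_half_plane Suc_i_in_upper_half_plane]])
  define G where "G = (\<lambda>u. minus_part ?k (cusp_cocycle r f) (lower_point u))"
  \<comment> \<open>On the closed disc of radius 1/2 the image is a compact part of the lower
    half-plane, where the truncations converge uniformly.\<close>
  have lp: "lower_point ` cball 0 (1/2) \<subseteq> lower_half_plane"
    using lower_point_in_lower_half_plane by auto
  have lp_hol: "lower_point holomorphic_on ball 0 1"
    unfolding lower_point_def[abs_def] by (intro holomorphic_intros) auto
  have lp_cont: "continuous_on (cball 0 (1/2)) lower_point"
    by (intro holomorphic_on_imp_continuous_on holomorphic_on_subset[OF lp_hol]) auto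
  have "minus_part ?k (cusp_cocycle r f) holomorphic_on lower_half_plane"
    unfolding minus_part_def[abs_def]
    by (intro holomorphic_intros cusp_cocycle_holomorphic[OF f])
       (auto simp: lower_half_plane_def complex_nonpos_Reals_iff)
  from holomorphic_on_compose_gen[OF lp_hol this]
  have G_hol: "G holomorphic_on ball 0 1"
    using lower_point_in_lower_half_plane by (force simp: G_def o_def)
  have "continuous_on (cball 0 (1/2)) (\<lambda>u. cusp_cocycle r f (lower_point u))"
    by (rule continuous_on_compose2[OF holomorphic_on_imp_continuous_on[OF cusp_cocycle_holomorphic[OF f]] lp_cont lp])
  then have b1: "bounded ((\<lambda>u. cusp_cocycle r f (lower_point u)) ` cball 0 (1/2))"
    by (intro compact_imp_bounded compact_continuous_image) auto
  have "continuous_on (cball 0 (1/2)) (\<lambda>u. (\<i> - lower_point u) powr of_real ?k)"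
    by (intro continuous_intros lp_cont) (use lp in \<open>force simp: lower_half_plane_def complex_eq_iff\<close>)+
  then have b2: "bounded ((\<lambda>u. (\<i> - lower_point u) powr of_real ?k) ` cball 0 (1/2))"
    by (intro compact_imp_bounded compact_continuous_image) auto
  have "bounded (lower_point ` cball 0 (1/2))"
    by (intro compact_imp_bounded compact_continuous_image lp_cont) simp
  from uniform_limit_compose'[OF partial_cocycle_uniform_limit[OF f lp this], of lower_point "cball 0 (1/2)"]
  have "uniform_limit (cball 0 (1/2)) (\<lambda>n u. ?P n (lower_point u)) (\<lambda>u. cusp_cocycle r f (lower_point u)) sequentially"
    by auto
  then have "uniform_limit (cball 0 (1/2)) (\<lambda>n u. minus_part ?k (?P n) (lower_point u)) G sequentially"
    unfolding minus_part_def G_def by (intro uniform_lim_mult uniform_limit_const b1 b2)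
  then have "uniform_limit (ball 0 (1/2)) (\<lambda>n u. minus_part ?k (?P n) (lower_point u)) G sequentially"
    by (rule uniform_limit_on_subset) auto
  moreover have eq: "minus_part ?k (?P n) (lower_point u) =
      kernel_generating ?k \<i> (\<i> * of_real (real (Suc n))) f u" if "u \<in> ball 0 (1/2)" for n u
  proof -
    obtain q where q: "0 < q" "\<And>\<tau>. \<tau> \<in> closed_segment \<i> (\<i> * of_real (real (Suc n))) \<Longrightarrow> norm (cayley \<tau>) \<le> q"
      using cayley_segment_bound[OF i_in_upper_half_plane Suc_i_in_upper_half_plane[of n]] by metis
    show ?thesis
      by (rule minus_part_eq_kernel_generating[OF i_in_upper_half_plane Suc_i_in_upper_half_plane f_seg q])
         (use that in \<open>auto simp: partial_cocycle_def\<close>)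
  qed
  ultimately have ul: "uniform_limit (ball 0 (1/2)) (\<lambda>n. kernel_generating ?k \<i> (\<i> * of_real (real (Suc n))) f) G sequentially"
    by (subst uniform_limit_cong'[symmetric]) auto
  have gen: "kernel_generating ?k \<i> (\<i> * of_real (real (Suc N))) f holomorphic_on ball 0 (1/2)"
    "(deriv ^^ n) (kernel_generating ?k \<i> (\<i> * of_real (real (Suc N))) f) 0 = 0" for N
  proof -
    let ?b = "\<i> * of_real (real (Suc N))"
    obtain q where q: "0 < q" "q < 1" "\<And>\<tau>. \<tau> \<in> closed_segment \<i> ?b \<Longrightarrow> norm (cayley \<tau>) \<le> q"
      using cayley_segment_bound[OF i_in_upper_half_plane Suc_i_in_upper_half_plane[of N]] by metis
    note k = i_in_upper_half_plane Suc_i_in_upper_half_plane f_seg q(1,3)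
    have "1/2 \<le> 1/q" using q by (simp add: field_simps)
    then show "kernel_generating ?k \<i> ?b f holomorphic_on ball 0 (1/2)"
      by (intro holomorphic_on_subset[OF kernel_generating_holomorphic[OF k]] subset_ball)
    have "complex_of_real ?k = - of_nat m" unfolding m by simp
    then show "(deriv ^^ n) (kernel_generating ?k \<i> ?b f) 0 = 0"
      using pochhammer_of_nat_eq_0_lemma[OF n, where ?'a = complex]
      by (simp only: higher_deriv_kernel_generating_0[OF k] mult_zero_left)
  qed
  have "(\<lambda>N. (deriv ^^ n) (kernel_generating ?k \<i> (\<i> * of_real (real (Suc N))) f) 0) \<longlonglongrightarrow> (deriv ^^ n) G 0"
    by (rule higher_deriv_complex_uniform_limit[OF ul]) (use gen(1) in auto)
  then have G0: "(deriv ^^ n) G 0 = 0" unfolding gen(2) by (simp add: LIMSEQ_const_iff)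
  have "(deriv ^^ n) (\<lambda>w. plus_part ?k (knopp_cocycle r f (Interior \<i>) Cusp_Infinity) (cayley_inv w)) 0 =
      (deriv ^^ n) (\<lambda>w. cnj (G (cnj w))) 0"
  proof (rule higher_deriv_cong_ev)
    show "eventually (\<lambda>w. plus_part ?k (knopp_cocycle r f (Interior \<i>) Cusp_Infinity) (cayley_inv w) = cnj (G (cnj w))) (nhds 0)"
      unfolding eventually_nhds
    proof (intro exI[of _ "ball 0 1"] conjI ballI)
      fix w :: complex assume "w \<in> ball 0 1"
      then have z: "Im (cayley_inv w) > 0" using cayley_inv_in_upper_half_plane[of w] by (simp add: upper_half_plane_def)
      have "cnj ((\<i> - cnj (cayley_inv w)) powr of_real ?k) = (- \<i> - cayley_inv w) powr of_real ?k"
        using z by (subst cnj_powr) auto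
      then show "plus_part ?k (knopp_cocycle r f (Interior \<i>) Cusp_Infinity) (cayley_inv w) = cnj (G (cnj w))"
        by (simp add: plus_part_def G_def minus_part_def knopp_cocycle_def cnj_cayley_inv[symmetric])
    qed auto
  qed simp
  also have "\<dots> = cnj ((deriv ^^ n) G (cnj 0))"
    by (rule higher_deriv_cnj_cnj[OF G_hol]) simp
  finally show ?thesis by (simp add: G0)
qed

section \<open>Invariance under translation and inversion\<close>

text \<open>The multiplier enters only through its modulus. One u serves all forms of the space, so
  f1 and the conjugated cocycle of f2 contribute u and \<open>cnj u\<close>.\<close>

lemma multiplier_system_translation:
  assumes "multiplier_system r v"
  obtains u where "norm u = 1"
    "\<And>f z. \<lbrakk>f \<in> cusp_forms r v; z \<in> upper_half_plane\<rbrakk> \<Longrightarrow> f (z + 1) = u * f z"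
proof -
  define A :: "int^2^2" where "A = vector [vector [1, 1], vector [0, 1]]"
  have A: "A$1$1 = 1" "A$1$2 = 1" "A$2$1 = 0" "A$2$2 = 1" by (simp_all add: A_def)
  then have SL: "A \<in> SL2Z" by (simp add: SL2Z_def det_2)
  have act: "automorphy A z = 1" "moebius A z = z + 1" for z by (simp_all add: automorphy_def moebius_def A)
  obtain p where p: "is_eta_multiplier p v" using assms by (auto simp: multiplier_system_def)
  \<comment> \<open>The product part of eta has period 1; only the linear term of its logarithm
    changes, by an imaginary amount.\<close>
  have log_eta: "log_eta (\<i> + 1) = log_eta \<i> + of_real (pi / 12) * \<i>"
  proof -
    have e: "exp (2 * of_real pi * \<i> * of_nat (Suc n) * (\<i> + 1)) = exp (2 * of_real pi * \<i> * of_nat (Suc n) * \<i>)" for n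
    proof -
      have eq: "2 * of_real pi * \<i> * of_nat (Suc n) * (\<i> + 1) =
          2 * of_real pi * \<i> * of_nat (Suc n) * \<i> + \<i> * (of_int (int (Suc n)) * (of_real pi * 2))"
        by (simp add: algebra_simps)
      show ?thesis unfolding eq by (rule exp_plus_2pin)
    qed
    show ?thesis unfolding log_eta_def e by (simp add: distrib_left add_divide_distrib)
  qed
  have "v A = eta_power (2 * p) (\<i> + 1) / eta_power (2 * p) \<i>"
    using p SL i_in_upper_half_plane unfolding is_eta_multiplier_def by (force simp: act)
  also have "\<dots> = exp (of_real (2 * p * pi / 12) * \<i>)"
    unfolding eta_power_def log_eta exp_diff[symmetric] by (simp add: algebra_simps)
  finally have v: "norm (v A) = 1" by (simp add: norm_exp_eq_Re)
  show ?thesis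
  proof (rule that[OF v])
    fix f z assume "f \<in> cusp_forms r v" "z \<in> upper_half_plane"
    then show "f (z + 1) = v A * f z" using SL by (force simp: cusp_forms_def act)
  qed
qed

lemma multiplier_system_inversion:
  assumes "multiplier_system r v"
  obtains u where "norm u = 1"
    "\<And>f z. \<lbrakk>f \<in> cusp_forms r v; z \<in> upper_half_plane\<rbrakk> \<Longrightarrow> f (- 1 / z) = u * z powr of_real r * f z"
proof -
  define A :: "int^2^2" where "A = vector [vector [0, - 1], vector [1, 0]]"
  have A: "A$1$1 = 0" "A$1$2 = - 1" "A$2$1 = 1" "A$2$2 = 0" by (simp_all add: A_def)
  then have SL: "A \<in> SL2Z" by (simp add: SL2Z_def det_2)
  have act: "automorphy A z = z" "moebius A z = - 1 / z" for z by (simp_all add: automorphy_def moebius_def A)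
  obtain p where p: "is_eta_multiplier p v" using assms by (auto simp: multiplier_system_def)
  \<comment> \<open>At the fixed point \<i> the eta quotient cancels, and a power of \<i> with real
    exponent has modulus 1.\<close>
  have "v A = eta_power (2 * p) (- 1 / \<i>) / (\<i> powr of_real p * eta_power (2 * p) \<i>)"
    using p SL i_in_upper_half_plane unfolding is_eta_multiplier_def by (force simp: act)
  also have "- 1 / \<i> = \<i>" by (simp add: field_simps)
  finally have "v A = 1 / \<i> powr of_real p" by (simp add: eta_power_def)
  then have v: "norm (v A) = 1" by (simp add: norm_divide norm_powr_real_powr')
  show ?thesis
  proof (rule that[OF v])
    fix f z assume "f \<in> cusp_forms r v" "z \<in> upper_half_plane"
    then show "f (- 1 / z) = v A * z powr of_real r * f z" using SL by (force simp: cusp_forms_def act)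
  qed
qed

section \<open>Transformation laws of the truncated and the full cocycle\<close>

lemma closed_segment_add_one:
  fixes a :: complex
  assumes "z \<in> closed_segment a (a + 1)"
  shows "\<exists>w. 0 \<le> w \<and> w \<le> 1 \<and> z = a + of_real w"
proof -
  obtain w where w: "0 \<le> w" "w \<le> 1" and z: "z = (1 - w) *\<^sub>R a + w *\<^sub>R (a + 1)"
    using assms unfolding closed_segment_def by blast
  have "z = a + of_real w" unfolding z scaleR_conv_of_real of_real_diff by (simp add: algebra_simps)
  with w show ?thesis by blast
qed

text \<open>The cusp may also be approached along the line Re z = 1: the horizontal connection has
  length 1, and the integrand there is of order 1 / y^2.\<close>

lemma Lim_partial_cocycle_translated:
  assumes f: "f \<in> cusp_forms r v" and t: "t \<in> lower_half_plane"
  shows "(\<lambda>n. partial_cocycle f (r - 2) (\<i> * of_real (real (Suc n))) t) \<longlonglongrightarrow> cusp_cocycle r f t"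
    and "(\<lambda>n. partial_cocycle f (r - 2) (\<i> * of_real (real (Suc n)) + 1) t) \<longlonglongrightarrow> cusp_cocycle r f t"
proof -
  let ?P = "\<lambda>z. partial_cocycle f (r - 2) z t"
  let ?y = "\<lambda>n. \<i> * of_real (real (Suc n))"
  have hol: "f holomorphic_on upper_half_plane" using f by (simp add: cusp_forms_def)
  have "uniform_limit {t} (\<lambda>n. partial_cocycle f (r - 2) (?y n)) (cusp_cocycle r f) sequentially"
    by (rule partial_cocycle_uniform_limit[OF f]) (use t in auto)
  then show lim: "(\<lambda>n. ?P (?y n)) \<longlonglongrightarrow> cusp_cocycle r f t"
    by (simp add: tendsto_uniform_limitI)
  obtain K Y where KY: "K \<ge> 0" "Y \<ge> 1"
    "\<And>z t. \<lbrakk>t \<in> lower_half_plane; \<bar>Re z\<bar> \<le> 1; Im z \<ge> Y\<rbrakk> \<Longrightarrow>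
       norm (f z * (z - t) powr of_real (r - 2)) \<le> K * (2 + norm t) powr \<bar>r - 2\<bar> / (Im z)\<^sup>2"
    using cocycle_kernel_decay[OF f] by blast
  let ?B = "K * (2 + norm t) powr \<bar>r - 2\<bar>"
  have "(\<lambda>n. ?P (?y n + 1) - ?P (?y n)) \<longlonglongrightarrow> 0"
  proof (rule Lim_null_comparison)
    have "eventually (\<lambda>n. real n \<ge> Y) sequentially"
      using filterlim_real_sequentially by (auto simp: filterlim_at_top)
    then show "eventually (\<lambda>n. norm (?P (?y n + 1) - ?P (?y n)) \<le> ?B / (real (Suc n))\<^sup>2) sequentially"
    proof eventually_elim
      case (elim n)
      have s: "0 \<le> Re z \<and> Re z \<le> 1 \<and> Im z = real (Suc n)" if z: "z \<in> closed_segment (?y n) (?y n + 1)" for z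
      proof -
        obtain w where "0 \<le> w" "w \<le> 1" "z = ?y n + of_real w"
          using closed_segment_add_one[OF z] by blast
        then show ?thesis using \<open>0 \<le> w\<close> \<open>w \<le> 1\<close> by simp
      qed
      have df: "(?P has_field_derivative f z * (z - t) powr of_real (r - 2)) (at z within closed_segment (?y n) (?y n + 1))"
        if z: "z \<in> closed_segment (?y n) (?y n + 1)" for z
        using s[OF z] by (intro has_field_derivative_at_within[OF
           partial_cocycle_has_field_derivative_upper[OF hol _ t]]) (simp add: upper_half_plane_def)
      have dn: "norm (f z * (z - t) powr of_real (r - 2)) \<le> ?B / (real (Suc n))\<^sup>2"
        if z: "z \<in> closed_segment (?y n) (?y n + 1)" for z
        using KY(3)[OF t, of z] s[OF z] elim by simp
      have "norm (?P (?y n + 1) - ?P (?y n)) \<le> ?B / (real (Suc n))\<^sup>2 * norm (?y n + 1 - ?y n)"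
        by (rule field_differentiable_bound[OF convex_closed_segment df dn ends_in_segment(2,1)])
      then show ?case by simp
    qed
    show "(\<lambda>n. ?B / (real (Suc n))\<^sup>2) \<longlonglongrightarrow> 0" by real_asymp
  qed
  from tendsto_add[OF this lim] show "(\<lambda>n. ?P (?y n + 1)) \<longlonglongrightarrow> cusp_cocycle r f t" by simp
qed

text \<open>Since (s + 1) - (t + 1) = s - t, the difference of the two truncated integrals has
  derivative 0 in s. Its constant need not be 0; letting s tend to the cusp expresses it through the
  full cocycles.\<close>

lemma cusp_cocycle_translation:
  assumes f: "f \<in> cusp_forms r v" and u: "\<And>z. z \<in> upper_half_plane \<Longrightarrow> f (z + 1) = u * f z"
    and s: "s \<in> upper_half_plane" and t: "t \<in> lower_half_plane"
  shows "cusp_cocycle r f (t + 1) - partial_cocycle f (r - 2) (s + 1) (t + 1) =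
         u * (cusp_cocycle r f t - partial_cocycle f (r - 2) s t)"
proof -
  let ?P = "partial_cocycle f (r - 2)"
  let ?y = "\<lambda>n. \<i> * of_real (real (Suc n))"
  have hol: "f holomorphic_on upper_half_plane" using f by (simp add: cusp_forms_def)
  have t1: "t + 1 \<in> lower_half_plane" using t by (simp add: lower_half_plane_def)
  have "\<exists>c. \<forall>s\<in>upper_half_plane. ?P (s + 1) (t + 1) - u * ?P s t = c"
  proof (rule has_field_derivative_zero_constant[OF convex_upper_half_plane])
    fix s assume s: "s \<in> upper_half_plane"
    then have s1: "s + 1 \<in> upper_half_plane" by (simp add: upper_half_plane_def)
    have "((\<lambda>s. ?P (s + 1) (t + 1)) has_field_derivative f (s + 1) * (s + 1 - (t + 1)) powr of_real (r - 2) * 1) (at s)"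
      by (rule DERIV_chain2[where f = "\<lambda>s. ?P s (t + 1)" and g = "\<lambda>s. s + 1", OF
            partial_cocycle_has_field_derivative_upper[OF hol s1 t1]]) (auto intro!: derivative_eq_intros)
    from DERIV_diff[OF this DERIV_cmult[OF partial_cocycle_has_field_derivative_upper[OF hol s t], of u]]
    show "((\<lambda>s. ?P (s + 1) (t + 1) - u * ?P s t) has_field_derivative 0) (at s within upper_half_plane)"
      by (rule has_field_derivative_at_within[OF DERIV_cong]) (simp add: u[OF s])
  qed
  then obtain c where c: "\<And>s. s \<in> upper_half_plane \<Longrightarrow> ?P (s + 1) (t + 1) - u * ?P s t = c" by blast
  have "(\<lambda>n. ?P (?y n + 1) (t + 1) - u * ?P (?y n) t) \<longlonglongrightarrow> cusp_cocycle r f (t + 1) - u * cusp_cocycle r f t"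
    by (intro tendsto_intros Lim_partial_cocycle_translated[OF f] t t1)
  moreover have "(\<lambda>n. ?P (?y n + 1) (t + 1) - u * ?P (?y n) t) = (\<lambda>n. c)"
    by (intro ext c Suc_i_in_upper_half_plane)
  ultimately have "cusp_cocycle r f (t + 1) - u * cusp_cocycle r f t = c"
    by (simp add: LIMSEQ_const_iff)
  then show ?thesis using c[OF s] by (simp add: algebra_simps)
qed

text \<open>The base is (s - t) / (s t). The arguments of s - t, s and t lie in (0, pi), (0, pi) and
  (-pi, 0), so their combination lies only in (-pi, 2 pi). The base is in the upper half-plane, so
  the sine of that angle is positive, which excludes [pi, 2 pi).\<close>

lemma powr_inversion_difference:
  assumes s: "s \<in> upper_half_plane" and t: "t \<in> lower_half_plane"
  shows "(- 1 / s - - 1 / t) powr q = (s - t) powr q / (s powr q * t powr q)"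
proof -
  have im: "Im s > 0" "Im t < 0" "Im (s - t) > 0" using s t by (auto simp: upper_half_plane_def lower_half_plane_def)
  then have nz: "s \<noteq> 0" "t \<noteq> 0" "s - t \<noteq> 0" by (auto simp: complex_eq_iff)
  have e: "- 1 / s - - 1 / t = (s - t) / (s * t)" using nz by (simp add: field_simps)
  let ?L = "Ln (s - t) - Ln s - Ln t"
  have ex: "exp ?L = - 1 / s - - 1 / t" unfolding e using nz by (simp add: exp_diff)
  have Lt: "- pi < Im (Ln t)" "Im (Ln t) < 0"
    using mpi_less_Im_Ln[OF nz(2)] Im_Ln_pos_le[OF nz(2)] Im_Ln_le_pi[OF nz(2)] im by auto
  have b: "- pi < Im ?L" "Im ?L < 2 * pi"
    using Im_Ln_pos_lt_imp[OF im(1)] Im_Ln_pos_lt_imp[OF im(3)] Lt by auto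
  have "Im (- 1 / s - - 1 / t) > 0"
  proof -
    have "Im (- 1 / s) > 0" using im(1) nz(1) by (auto simp: Im_divide sum_power2_gt_zero_iff complex_eq_iff)
    moreover have "Im (1 / t) > 0" using im(2) nz(2) by (auto simp: Im_divide sum_power2_gt_zero_iff complex_eq_iff divide_neg_pos)
    ultimately show ?thesis by simp
  qed
  then have "sin (Im ?L) > 0"
    unfolding ex[symmetric] by (simp only: Im_exp zero_less_mult_iff) (use exp_gt_zero[of "Re ?L"] in linarith)
  then have "Im ?L \<le> pi"
    using sin_le_zero[of "Im ?L"] b by linarith
  then have L: "Ln (- 1 / s - - 1 / t) = ?L"
    using b ex by (intro Ln_unique) auto
  have "- 1 / s - - 1 / t \<noteq> 0" unfolding e using nz by simp
  then have "(- 1 / s - - 1 / t) powr q = exp (q * ?L)"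
    by (simp only: powr_def L if_False)
  also have "\<dots> = (s - t) powr q / (s powr q * t powr q)"
    using nz by (simp add: powr_def exp_diff[symmetric] exp_add[symmetric] algebra_simps)
  finally show ?thesis .
qed

text \<open>The powers of s cancel between the weight of f, the kernel and the derivative 1 / s^2,
  so the difference is constant in s. At s = \<i>, the fixed point, both integrals are over a point
  and the constant is 0.\<close>

lemma partial_cocycle_inversion:
  assumes f: "f \<in> cusp_forms r v"
    and u: "\<And>z. z \<in> upper_half_plane \<Longrightarrow> f (- 1 / z) = u * z powr of_real r * f z"
    and s: "s \<in> upper_half_plane" and t: "t \<in> lower_half_plane"
  shows "partial_cocycle f (r - 2) (- 1 / s) (- 1 / t) = u / t powr of_real (r - 2) * partial_cocycle f (r - 2) s t"
proof -
  let ?P = "partial_cocycle f (r - 2)"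
  have hol: "f holomorphic_on upper_half_plane" using f by (simp add: cusp_forms_def)
  have t1: "- 1 / t \<in> lower_half_plane"
    using t by (auto simp: lower_half_plane_def Im_divide sum_power2_gt_zero_iff divide_neg_pos)
  have "\<exists>c. \<forall>s\<in>upper_half_plane. ?P (- 1 / s) (- 1 / t) - u / t powr of_real (r - 2) * ?P s t = c"
  proof (rule has_field_derivative_zero_constant[OF convex_upper_half_plane])
    fix s assume s: "s \<in> upper_half_plane"
    then have nz: "s \<noteq> 0" by (auto simp: upper_half_plane_def)
    have s1: "- 1 / s \<in> upper_half_plane"
      using s by (auto simp: upper_half_plane_def Im_divide sum_power2_gt_zero_iff)
    have "((\<lambda>s. - 1 / s) has_field_derivative 1 / s\<^sup>2) (at s)"
      using nz by (auto intro!: derivative_eq_intros simp: power2_eq_square)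
    from DERIV_chain2[where f = "\<lambda>s. ?P s (- 1 / t)", OF partial_cocycle_has_field_derivative_upper[OF hol s1 t1] this]
    have d: "((\<lambda>s. ?P (- 1 / s) (- 1 / t)) has_field_derivative
        f (- 1 / s) * (- 1 / s - - 1 / t) powr of_real (r - 2) * (1 / s\<^sup>2)) (at s)" .
    have "s powr of_real r = s powr of_real (r - 2) * s\<^sup>2"
      using nz by (simp add: powr_diff)
    then have "f (- 1 / s) * (- 1 / s - - 1 / t) powr of_real (r - 2) * (1 / s\<^sup>2) -
       u / t powr of_real (r - 2) * (f s * (s - t) powr of_real (r - 2)) = 0"
      unfolding u[OF s] powr_inversion_difference[OF s t] using nz by (simp add: powr_def)
    then show "((\<lambda>s. ?P (- 1 / s) (- 1 / t) - u / t powr of_real (r - 2) * ?P s t) has_field_derivative 0) (at s within upper_half_plane)"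
      by (intro has_field_derivative_at_within[OF DERIV_cong[OF
          DERIV_diff[OF d DERIV_cmult[OF partial_cocycle_has_field_derivative_upper[OF hol s t]]]]])
  qed
  then obtain c where c: "\<And>s. s \<in> upper_half_plane \<Longrightarrow> ?P (- 1 / s) (- 1 / t) - u / t powr of_real (r - 2) * ?P s t = c"
    by blast
  have "- 1 / \<i> = \<i>" by (simp add: field_simps)
  then have "c = 0"
    using c[OF i_in_upper_half_plane] by (simp add: partial_cocycle_def)
  then show ?thesis using c[OF s] by simp
qed

text \<open>Polynomial growth in the height is enough, as f1 decays faster than any power. The
  remainder is compared through the point of height Y on the imaginary axis: the tail above it
  converges at a known rate, and the rest is an integral over a segment in the half strip.\<close>

lemma cusp_cocycle_remainder_growth:
  assumes f: "f \<in> cusp_forms r v"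
  obtains K where "K \<ge> 0"
    "\<And>\<tau>. \<tau> \<in> half_strip \<Longrightarrow> norm (cusp_cocycle r f (cnj \<tau>) - partial_cocycle f (r - 2) \<tau> (cnj \<tau>))
       \<le> K * Im \<tau> powr (\<bar>r - 2\<bar> + 1)"
proof -
  let ?m = "\<bar>r - 2\<bar>"
  let ?P = "partial_cocycle f (r - 2)"
  have hol: "f holomorphic_on upper_half_plane" using f by (simp add: cusp_forms_def)
  obtain K Y where KY: "K \<ge> 0" "Y \<ge> 1"
    "\<And>y t. \<lbrakk>t \<in> lower_half_plane; y \<ge> Y\<rbrakk> \<Longrightarrow>
       norm (?P (\<i> * of_real y) t - cusp_cocycle r f t) \<le> K * (2 + norm t) powr ?m / y"
    using partial_cocycle_converges[OF f] by blast
  obtain C where C: "C \<ge> 0" "\<And>z. z \<in> half_strip \<Longrightarrow> norm (f z) \<le> C * Im z powr (- 1)"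
    using cusp_form_bound_half_strip[OF f zero_less_one] by blast
  define D where "D = 4 + 2 * Y"
  show ?thesis
  \<comment> \<open>With 1 and |\<tau>| both at most 2y, the factor 2 + |t| is at most 6y; the extra
    2 compares 1 with 2y.\<close>
  proof (rule that[of "K * 6 powr ?m * 2 + 2 * C * (2 * D) powr ?m * D"])
    fix \<tau> assume \<tau>: "\<tau> \<in> half_strip"
    define t where "t = cnj \<tau>"
    define y where "y = Im \<tau>"
    have \<tau>H: "\<tau> \<in> upper_half_plane" using \<tau> half_strip_subset by blast
    then have t: "t \<in> lower_half_plane" by (simp add: t_def upper_half_plane_def lower_half_plane_def)
    have y: "y \<ge> 1/2" using \<tau> by (simp add: y_def half_strip_def)
    have n: "norm \<tau> \<le> 2 * y" using cmod_le[of \<tau>] \<tau> by (simp add: y_def half_strip_def)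
    have nt: "norm t = norm \<tau>" by (simp add: t_def)
    \<comment> \<open>B bounds both |z - t| on the segment and its length. Since |\<tau>| is at most
      2y and 1 at most 2y, it is at most (4 + 2Y) y, whence D.\<close>
    define B where "B = 2 * norm \<tau> + Y"
    have Yy: "Y * 1 \<le> Y * (2 * y)" using y KY(2) by (intro mult_left_mono) auto
    have "D * y = 4 * y + Y * (2 * y)" by (simp add: D_def algebra_simps)
    then have B: "1 \<le> B" "B \<le> D * y"
      unfolding B_def using KY(2) n Yy norm_ge_zero[of \<tau>] by linarith+
    have pw: "y powr (?m + 1) = y powr ?m * y" using y by (simp add: powr_add)
    have "norm (?P (\<i> * of_real Y) t - cusp_cocycle r f t) \<le> K * (2 + norm t) powr ?m / Y"
      by (rule KY(3)[OF t order_refl])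
    also have "\<dots> \<le> K * (2 + norm t) powr ?m / 1"
      using KY by (intro divide_left_mono) auto
    also have "\<dots> \<le> K * (6 * y) powr ?m"
      using n nt y KY(1) by (simp add: mult_left_mono powr_mono2)
    also have "\<dots> = K * 6 powr ?m * (y powr ?m * 1)" using y by (simp add: powr_mult)
    also have "\<dots> \<le> K * 6 powr ?m * (y powr ?m * (2 * y))"
      using y KY(1) by (intro mult_left_mono) auto
    also have "\<dots> = K * 6 powr ?m * 2 * y powr (?m + 1)" by (simp add: pw)
    finally have 1: "norm (?P (\<i> * of_real Y) t - cusp_cocycle r f t) \<le> K * 6 powr ?m * 2 * y powr (?m + 1)" .
    have iY: "\<i> * of_real Y \<in> half_strip" using KY(2) by (simp add: half_strip_def)
    have seg: "closed_segment \<tau> (\<i> * of_real Y) \<subseteq> half_strip"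
      by (rule closed_segment_subset[OF \<tau> iY convex_half_strip])
    have seg': "z \<in> half_strip" "z \<in> upper_half_plane" if "z \<in> closed_segment \<tau> (\<i> * of_real Y)" for z
      using that seg half_strip_subset by auto
    have df: "((\<lambda>z. ?P z t) has_field_derivative f z * (z - t) powr of_real (r - 2)) (at z within closed_segment \<tau> (\<i> * of_real Y))"
      if "z \<in> closed_segment \<tau> (\<i> * of_real Y)" for z
      by (rule has_field_derivative_at_within[OF partial_cocycle_has_field_derivative_upper[OF hol seg'(2)[OF that] t]])
    have dn: "norm (f z * (z - t) powr of_real (r - 2)) \<le> 2 * C * (2 * B) powr ?m"
      if z: "z \<in> closed_segment \<tau> (\<i> * of_real Y)" for z
    proof -
      note zs = seg'(1)[OF z] and zH = seg'(2)[OF z]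
      have zi: "1/2 \<le> Im z" using zs by (simp add: half_strip_def)
      have "norm z \<le> norm \<tau> + Y"
      proof -
        have "closed_segment \<tau> (\<i> * of_real Y) \<subseteq> cball 0 (norm \<tau> + Y)"
          using KY(2) by (intro closed_segment_subset convex_cball) (auto simp: norm_mult)
        then show ?thesis using z by auto
      qed
      then have "norm (z - t) \<le> B"
        using norm_triangle_ineq4[of z t] by (simp add: nt B_def)
      then have "norm ((z - t) powr of_real (r - 2)) \<le> (2 * B) powr ?m"
        using norm_minus_ge_Im[OF zH t] zi B(1) by (intro norm_powr_le) auto
      moreover have "norm (f z) \<le> 2 * C"
      proof -
        have "norm (f z) \<le> C * Im z powr (- 1)" by (rule C(2)[OF zs])
        also have "Im z powr (- 1) = 1 / Im z" using zi by (simp add: powr_minus_divide)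
        also have "C * (1 / Im z) \<le> C * 2"
          using zi C(1) by (intro mult_left_mono) (auto simp: divide_le_eq)
        finally show ?thesis by simp
      qed
      ultimately show ?thesis
        unfolding norm_mult using C(1) by (intro mult_mono) auto
    qed
    have "norm (?P (\<i> * of_real Y) t - ?P \<tau> t) \<le> (2 * C * (2 * B) powr ?m) * norm (\<i> * of_real Y - \<tau>)"
      by (rule field_differentiable_bound[OF convex_closed_segment df dn ends_in_segment(2,1)])
    also have "norm (\<i> * of_real Y - \<tau>) \<le> B"
      using norm_triangle_ineq4[of "\<i> * of_real Y" \<tau>] KY(2) by (simp add: norm_mult B_def) (use norm_ge_zero[of \<tau>] in linarith)
    finally have "norm (?P (\<i> * of_real Y) t - ?P \<tau> t) \<le> (2 * C * (2 * B) powr ?m) * B"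
      using C(1) by (simp add: mult_left_mono)
    also have "\<dots> \<le> (2 * C * (2 * (D * y)) powr ?m) * (D * y)"
      using C(1) B by (intro mult_mono mult_left_mono powr_mono2) auto
    also have "\<dots> = 2 * C * (2 * D) powr ?m * D * y powr (?m + 1)"
      using y KY(2) by (simp add: pw powr_mult D_def mult_ac)
    finally have 2: "norm (?P (\<i> * of_real Y) t - ?P \<tau> t) \<le> 2 * C * (2 * D) powr ?m * D * y powr (?m + 1)" .
    have "norm (cusp_cocycle r f t - ?P \<tau> t) \<le>
        norm (?P (\<i> * of_real Y) t - cusp_cocycle r f t) + norm (?P (\<i> * of_real Y) t - ?P \<tau> t)"
      using norm_triangle_ineq4[of "?P (\<i> * of_real Y) t - ?P \<tau> t" "?P (\<i> * of_real Y) t - cusp_cocycle r f t"]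
      by simp
    with 1 2 show "norm (cusp_cocycle r f (cnj \<tau>) - ?P \<tau> (cnj \<tau>))
        \<le> (K * 6 powr ?m * 2 + 2 * C * (2 * D) powr ?m * D) * Im \<tau> powr (?m + 1)"
      unfolding t_def[symmetric] y_def[symmetric] by (simp add: algebra_simps)
  qed (use KY C in \<open>auto simp: D_def\<close>)
qed

section \<open>The Petersson scalar product\<close>

text \<open>On the unit circle -1/\<tau> = -\<open>cnj \<tau>\<close>, so inversion is x to -x. The
  second identity is d(-1/\<tau>) = d\<tau> / \<tau>^2 in this parameter, with the sign of the
  reversed direction.\<close>

lemma unit_arc_minus:
  assumes "x \<in> {-1/2..1/2}"
  shows "unit_arc (- x) = - 1 / unit_arc x"
    and "(unit_arc x)\<^sup>2 * unit_arc_deriv (- x) = - unit_arc_deriv x"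
proof -
  let ?y = "sqrt (1 - x\<^sup>2)"
  have y: "?y > 0" "?y\<^sup>2 = 1 - x\<^sup>2" using one_minus_square_ge[OF assms] by auto
  have "unit_arc x * unit_arc (- x) = - 1"
    using y(2) by (simp add: unit_arc_def complex_eq_iff power2_eq_square)
  then show "unit_arc (- x) = - 1 / unit_arc x"
    by (metis mult_zero_left neg_equal_0_iff_equal nonzero_eq_divide_eq mult.commute zero_neq_one)
  have "?y * ?y = 1 - x * x" using y(2) by (simp add: power2_eq_square)
  then show "(unit_arc x)\<^sup>2 * unit_arc_deriv (- x) = - unit_arc_deriv x"
    using y(1) by (simp add: unit_arc_def unit_arc_deriv_def complex_eq_iff power2_eq_square field_simps)
qed

lemma rho_eq_unit_arc: "rho = unit_arc (1/2)" "rho - 1 = unit_arc (- 1/2)"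
proof -
  have "rho = cis (pi / 3)" by (simp add: rho_def cis_conv_exp mult_ac)
  then have "rho = Complex (1/2) (sqrt 3 / 2)" by (simp add: cis.ctr cos_60 sin_60)
  moreover have "sqrt (1 - (1/2)\<^sup>2) = sqrt 3 / 2"
    by (simp add: power2_eq_square real_sqrt_divide)
  ultimately show "rho = unit_arc (1/2)" "rho - 1 = unit_arc (- 1/2)"
    by (simp_all add: unit_arc_def complex_eq_iff)
qed

lemma unit_arc_in_upper_half_plane: "x \<in> {-1/2..1/2} \<Longrightarrow> unit_arc x \<in> upper_half_plane"
  using unit_arc_add_in_upper_half_plane[of x 0] by simp

lemma rho_in_upper_half_plane: "rho \<in> upper_half_plane" "rho - 1 \<in> upper_half_plane"
  unfolding rho_eq_unit_arc(2) unfolding rho_eq_unit_arc(1)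
  by (rule unit_arc_in_upper_half_plane; simp)+

lemma cnj_in_lower_half_plane: "z \<in> upper_half_plane \<Longrightarrow> cnj z \<in> lower_half_plane"
  by (simp add: upper_half_plane_def lower_half_plane_def)

lemma unit_norm_mult_cnj: "norm u = 1 \<Longrightarrow> u * cnj u = 1"
  using complex_norm_square[of u] by simp

text \<open>The conjugated base is y (-2\<i>), and a positive real factor splits off from a
  principal power.\<close>

lemma cnj_upper_minus_cnj_powr:
  assumes "\<tau> \<in> upper_half_plane"
  shows "cnj ((\<tau> - cnj \<tau>) powr of_real q) = of_real (Im \<tau> powr q) * (- 2 * \<i>) powr of_real q"
proof -
  have im: "Im \<tau> > 0" using assms by (simp add: upper_half_plane_def)
  have "cnj ((\<tau> - cnj \<tau>) powr of_real q) = (cnj \<tau> - \<tau>) powr of_real q"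
    using im by (subst cnj_powr) auto
  also have "cnj \<tau> - \<tau> = of_real (Im \<tau>) * (- 2 * \<i>)" by (simp add: complex_eq_iff)
  also have "\<dots> powr of_real q = of_real (Im \<tau>) powr of_real q * (- 2 * \<i>) powr of_real q"
    using im by (intro powr_times_real_left) auto
  also have "of_real (Im \<tau>) powr of_real q = (of_real (Im \<tau> powr q) :: complex)"
    using im by (simp add: powr_of_real)
  finally show ?thesis .
qed

section \<open>The potential of the Petersson density\<close>

context
  fixes r :: real and v :: "int^2^2 \<Rightarrow> complex" and f1 f2 :: "complex \<Rightarrow> complex"
  assumes r: "r > 0" and v: "multiplier_system r v"
    and f1: "f1 \<in> cusp_forms r v" and f2: "f2 \<in> cusp_forms r v"
begin

abbreviation (input) "f2_cocycle \<equiv> knopp_cocycle r f2 (Interior \<i>) Cusp_Infinity"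

text \<open>The Knopp integral from \<i> to \<tau>, evaluated at \<tau> itself. Subtracting it from
  \<open>f2_cocycle\<close> leaves the integral from \<tau> to infinity, the E of the
  overview.\<close>

definition diagonal_part :: "complex \<Rightarrow> complex" where
  "diagonal_part \<tau> = cnj (partial_cocycle f2 (r - 2) \<tau> (cnj \<tau>))"

definition stokes_potential :: "complex \<Rightarrow> complex" where
  "stokes_potential \<tau> = f1 \<tau> * (f2_cocycle \<tau> - diagonal_part \<tau>)"

text \<open>Up to sign the derivative of \<open>stokes_potential\<close> in
  \<open>cnj \<tau>\<close>: that variable occurs only in \<open>diagonal_part\<close>, through its
  moving endpoint.\<close>

definition petersson_integrand :: "complex \<Rightarrow> complex" where
  "petersson_integrand \<tau> = f1 \<tau> * cnj (f2 \<tau>) * cnj ((\<tau> - cnj \<tau>) powr of_real (r - 2))"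

lemma cusp_forms_holomorphic: "f1 holomorphic_on upper_half_plane" "f2 holomorphic_on upper_half_plane"
    "f2_cocycle holomorphic_on upper_half_plane"
  using f1 f2 knopp_cocycle_holomorphic[OF f2] by (auto simp: cusp_forms_def)

lemma diagonal_part_has_derivative:
  assumes "\<tau> \<in> upper_half_plane"
  shows "(diagonal_part has_derivative (\<lambda>x. cnj (f2 \<tau> * (\<tau> - cnj \<tau>) powr of_real (r - 2)) * cnj x
     - of_real (r - 2) * cnj (partial_cocycle f2 (r - 2 - 1) \<tau> (cnj \<tau>)) * x)) (at \<tau>)"
  using bounded_linear.has_derivative[OF bounded_linear_cnj
      partial_cocycle_diagonal_has_derivative[OF cusp_forms_holomorphic(2) assms, of "r - 2"]]
  by (simp add: diagonal_part_def[abs_def])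

definition holomorphic_partial :: "complex \<Rightarrow> complex" where
  "holomorphic_partial \<tau> = deriv f1 \<tau> * (f2_cocycle \<tau> - diagonal_part \<tau>) +
     f1 \<tau> * (deriv f2_cocycle \<tau> + of_real (r - 2) * cnj (partial_cocycle f2 (r - 2 - 1) \<tau> (cnj \<tau>)))"

lemma stokes_potential_has_derivative:
  assumes \<tau>: "\<tau> \<in> upper_half_plane"
  shows "(stokes_potential has_derivative
    (\<lambda>x. holomorphic_partial \<tau> * x + - petersson_integrand \<tau> * cnj x)) (at \<tau>)"
proof -
  have d: "(f1 has_derivative (*) (deriv f1 \<tau>)) (at \<tau>)" "(f2_cocycle has_derivative (*) (deriv f2_cocycle \<tau>)) (at \<tau>)"
    using holomorphic_derivI[OF cusp_forms_holomorphic(1) open_upper_half_plane \<tau>]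
      holomorphic_derivI[OF cusp_forms_holomorphic(3) open_upper_half_plane \<tau>]
    unfolding has_field_derivative_def by auto
  have "(stokes_potential has_derivative
    (\<lambda>x. f1 \<tau> * (deriv f2_cocycle \<tau> * x - (cnj (f2 \<tau> * (\<tau> - cnj \<tau>) powr of_real (r - 2)) * cnj x
       - of_real (r - 2) * cnj (partial_cocycle f2 (r - 2 - 1) \<tau> (cnj \<tau>)) * x))
      + deriv f1 \<tau> * x * (f2_cocycle \<tau> - diagonal_part \<tau>))) (at \<tau>)"
    unfolding stokes_potential_def[abs_def]
    by (intro has_derivative_mult has_derivative_diff d diagonal_part_has_derivative \<tau>)
  then show ?thesis
    by (rule has_derivative_eq_rhs)
       (auto simp: holomorphic_partial_def petersson_integrand_def fun_eq_iff algebra_simps)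
qed

lemma continuous_on_diagonal_part: "continuous_on upper_half_plane diagonal_part"
  using diagonal_part_has_derivative by (meson continuous_at_imp_continuous_on has_derivative_continuous)

lemma continuous_on_partial_derivatives:
  "continuous_on upper_half_plane holomorphic_partial"
  "continuous_on upper_half_plane petersson_integrand"
proof -
  have "continuous_on upper_half_plane (\<lambda>\<tau>. (\<lambda>(s, t). partial_cocycle f2 (r - 2 - 1) s t) (\<tau>, cnj \<tau>))"
    by (rule continuous_on_compose2[OF continuous_on_partial_cocycle[OF cusp_forms_holomorphic(2)]])
       (auto intro!: continuous_intros cnj_in_lower_half_plane)
  then have p: "continuous_on upper_half_plane (\<lambda>\<tau>. partial_cocycle f2 (r - 2 - 1) \<tau> (cnj \<tau>))" by simp
  have d: "continuous_on upper_half_plane (deriv f1)" "continuous_on upper_half_plane (deriv f2_cocycle)"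
    by (intro holomorphic_on_imp_continuous_on holomorphic_deriv cusp_forms_holomorphic open_upper_half_plane)+
  show "continuous_on upper_half_plane holomorphic_partial"
    unfolding holomorphic_partial_def[abs_def]
    by (intro continuous_on_add continuous_on_mult continuous_on_diff continuous_on_const continuous_on_cnj p d
          continuous_on_diagonal_part holomorphic_on_imp_continuous_on cusp_forms_holomorphic)
  have c: "continuous_on upper_half_plane (\<lambda>\<tau>. (\<tau> - cnj \<tau>) powr of_real (r - 2))"
    by (intro continuous_on_powr_complex continuous_intros) (auto simp: upper_half_plane_def complex_eq_iff)
  show "continuous_on upper_half_plane petersson_integrand"
    unfolding petersson_integrand_def[abs_def]
    by (intro continuous_on_mult continuous_on_cnj c holomorphic_on_imp_continuous_on[OF cusp_forms_holomorphic(1)]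
         holomorphic_on_imp_continuous_on[OF cusp_forms_holomorphic(2)])
qed

lemma stokes_potential_periodic:
  assumes "y > 0"
  shows "stokes_potential (Complex (1/2) y) = stokes_potential (Complex (-1/2) y)"
proof -
  obtain u where u: "norm u = 1"
    "\<And>f z. \<lbrakk>f \<in> cusp_forms r v; z \<in> upper_half_plane\<rbrakk> \<Longrightarrow> f (z + 1) = u * f z"
    using multiplier_system_translation[OF v] by blast
  define \<tau> where "\<tau> = Complex (-1/2) y"
  have \<tau>: "\<tau> \<in> upper_half_plane" using assms by (simp add: \<tau>_def upper_half_plane_def)
  have \<tau>1: "Complex (1/2) y = \<tau> + 1" by (simp add: \<tau>_def complex_eq_iff)
  have "cnj (f2_cocycle (\<tau> + 1) - diagonal_part (\<tau> + 1)) = u * cnj (f2_cocycle \<tau> - diagonal_part \<tau>)"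
    using cusp_cocycle_translation[OF f2 u(2)[OF f2] \<tau> cnj_in_lower_half_plane[OF \<tau>]]
    by (simp add: knopp_cocycle_def diagonal_part_def)
  then have "f2_cocycle (\<tau> + 1) - diagonal_part (\<tau> + 1) = cnj u * (f2_cocycle \<tau> - diagonal_part \<tau>)"
    by (metis complex_cnj_cnj complex_cnj_mult)
  \<comment> \<open>The factor u comes from f1 and \<open>cnj u\<close> from E; their product is
    1.\<close>
  then have "stokes_potential (\<tau> + 1) = (u * cnj u) * stokes_potential \<tau>"
    by (simp add: stokes_potential_def u(2)[OF f1 \<tau>])
  then show ?thesis unfolding \<tau>1 by (simp add: unit_norm_mult_cnj[OF u(1)] \<tau>_def)
qed

lemma stokes_potential_bound:
  obtains M where "\<And>\<tau>. \<tau> \<in> fundamental_domain \<Longrightarrow> norm (stokes_potential \<tau>) \<le> M / Im \<tau>"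
proof -
  let ?m = "\<bar>r - 2\<bar>"
  obtain K where K: "K \<ge> 0"
    "\<And>\<tau>. \<tau> \<in> half_strip \<Longrightarrow> norm (cusp_cocycle r f2 (cnj \<tau>) - partial_cocycle f2 (r - 2) \<tau> (cnj \<tau>))
       \<le> K * Im \<tau> powr (?m + 1)"
    using cusp_cocycle_remainder_growth[OF f2] by blast
  \<comment> \<open>One more than the growth exponent |r - 2| + 1 of E, which leaves the decay 1 /
    y.\<close>
  have "0 < ?m + 2" by simp
  then obtain C where C: "C \<ge> 0" "\<And>z. z \<in> half_strip \<Longrightarrow> norm (f1 z) \<le> C * Im z powr (- (?m + 2))"
    using cusp_form_bound_half_strip[OF f1] by blast
  show ?thesis
  proof (rule that)
    fix \<tau> assume "\<tau> \<in> fundamental_domain"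
    then have \<tau>: "\<tau> \<in> half_strip" using fundamental_domain_subset_half_strip by blast
    then have im: "Im \<tau> > 0" by (simp add: half_strip_def)
    have "norm (f2_cocycle \<tau> - diagonal_part \<tau>) = norm (cnj (cusp_cocycle r f2 (cnj \<tau>) - partial_cocycle f2 (r - 2) \<tau> (cnj \<tau>)))"
      by (simp add: knopp_cocycle_def diagonal_part_def)
    also have "\<dots> \<le> K * Im \<tau> powr (?m + 1)"
      unfolding complex_mod_cnj by (rule K(2)[OF \<tau>])
    finally have "norm (stokes_potential \<tau>) \<le> (C * Im \<tau> powr (- (?m + 2))) * (K * Im \<tau> powr (?m + 1))"
      unfolding stokes_potential_def norm_mult using C by (intro mult_mono C(2) \<tau>) auto
    also have "\<dots> = C * K * (Im \<tau> powr (- (?m + 2)) * Im \<tau> powr (?m + 1))" by simp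
    also have "Im \<tau> powr (- (?m + 2)) * Im \<tau> powr (?m + 1) = 1 / Im \<tau>"
      using im by (simp add: powr_add[symmetric] powr_minus_divide)
    finally show "norm (stokes_potential \<tau>) \<le> C * K / Im \<tau>" by simp
  qed
qed

lemma petersson_integrand_bound:
  obtains M where "\<And>\<tau>. \<tau> \<in> fundamental_domain \<Longrightarrow> norm (petersson_integrand \<tau>) \<le> M / (Im \<tau>)\<^sup>2"
proof -
  \<comment> \<open>The positivity of r enters here, as r is the decay exponent chosen for f1;
    together with y^(r-2) it gives y^(-2), while f2 is just bounded.\<close>
  obtain C where C: "C \<ge> 0" "\<And>z. z \<in> half_strip \<Longrightarrow> norm (f1 z) \<le> C * Im z powr (- r)"
    using cusp_form_bound_half_strip[OF f1 r] by blast
  obtain D where D: "D \<ge> 0" "\<And>z. z \<in> half_strip \<Longrightarrow> norm (f2 z) \<le> D * Im z powr (- 1)"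
    using cusp_form_bound_half_strip[OF f2 zero_less_one] by blast
  let ?c = "norm ((- 2 * \<i>) powr of_real (r - 2) :: complex)"
  show ?thesis
  proof (rule that)
    fix \<tau> assume "\<tau> \<in> fundamental_domain"
    then have \<tau>: "\<tau> \<in> half_strip" using fundamental_domain_subset_half_strip by blast
    then have im: "Im \<tau> \<ge> 1/2" by (simp add: half_strip_def)
    have "D * Im \<tau> powr (- 1) = D * (1 / Im \<tau>)" using im by (simp add: powr_minus_divide)
    also have "\<dots> \<le> D * 2" using im D(1) by (intro mult_left_mono) (auto simp: divide_le_eq)
    finally have f2': "norm (f2 \<tau>) \<le> D * 2" using D(2)[OF \<tau>] by simp
    have "norm (petersson_integrand \<tau>) = norm (f1 \<tau>) * norm (f2 \<tau>) * (Im \<tau> powr (r - 2) * ?c)"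
      unfolding petersson_integrand_def cnj_upper_minus_cnj_powr[OF subsetD[OF half_strip_subset \<tau>]]
      by (simp add: norm_mult)
    also have "\<dots> \<le> (C * Im \<tau> powr (- r)) * (D * 2) * (Im \<tau> powr (r - 2) * ?c)"
      using C(1) D(1) by (intro mult_mono C(2) \<tau> f2') auto
    also have "\<dots> = C * D * 2 * ?c * (Im \<tau> powr (- r) * Im \<tau> powr (r - 2))" by simp
    also have "Im \<tau> powr (- r) * Im \<tau> powr (r - 2) = Im \<tau> powr (- r + (r - 2))"
      by (rule powr_add[symmetric])
    also have "\<dots> = 1 / (Im \<tau>)\<^sup>2"
      using im by (simp add: powr_minus_divide)
    finally show "norm (petersson_integrand \<tau>) \<le> C * D * 2 * ?c / (Im \<tau>)\<^sup>2" by simp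
  qed
qed

lemma integral_petersson_integrand:
  "set_lebesgue_integral lborel fundamental_domain petersson_integrand =
   (- 2 * \<i>) powr of_real (r - 2) * petersson r f1 f2"
proof -
  have "set_lebesgue_integral lborel fundamental_domain petersson_integrand =
      set_lebesgue_integral lborel fundamental_domain (\<lambda>\<tau>. (- 2 * \<i>) powr of_real (r - 2) *
        (f1 \<tau> * cnj (f2 \<tau>) * of_real (Im \<tau> powr r) / of_real ((Im \<tau>)\<^sup>2)))"
  proof (rule set_lebesgue_integral_cong)
    show "fundamental_domain \<in> sets lborel" using closed_fundamental_domain by simp
    show "\<forall>\<tau>. \<tau> \<in> fundamental_domain \<longrightarrow> petersson_integrand \<tau> = (- 2 * \<i>) powr of_real (r - 2) *
        (f1 \<tau> * cnj (f2 \<tau>) * of_real (Im \<tau> powr r) / of_real ((Im \<tau>)\<^sup>2))"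
    proof (intro allI impI)
      fix \<tau> assume "\<tau> \<in> fundamental_domain"
      then have \<tau>: "\<tau> \<in> upper_half_plane" using fundamental_domain_subset by blast
      then have "Im \<tau> powr (r - 2) = Im \<tau> powr r / (Im \<tau>)\<^sup>2"
        by (simp add: powr_diff upper_half_plane_def)
      then show "petersson_integrand \<tau> = (- 2 * \<i>) powr of_real (r - 2) *
        (f1 \<tau> * cnj (f2 \<tau>) * of_real (Im \<tau> powr r) / of_real ((Im \<tau>)\<^sup>2))"
        unfolding petersson_integrand_def cnj_upper_minus_cnj_powr[OF \<tau>] by simp
    qed
  qed
  also have "\<dots> = (- 2 * \<i>) powr of_real (r - 2) * petersson r f1 f2"
    unfolding petersson_def by (rule set_integral_mult_right)
  finally show ?thesis .
qed

text \<open>The inversion \<open>\<tau> \<mapsto> -1/\<tau>\<close> reverses the arc and preserves \<open>f1 \<tau> * diagonal_part \<tau> d\<tau>\<close>.\<close>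

lemma integral_diagonal_part:
  "integral {-1/2..1/2} (\<lambda>x. f1 (unit_arc x) * diagonal_part (unit_arc x) * unit_arc_deriv x) = 0"
proof -
  let ?g = "\<lambda>x. f1 (unit_arc x) * diagonal_part (unit_arc x) * unit_arc_deriv x"
  obtain u where u: "norm u = 1"
    "\<And>f z. \<lbrakk>f \<in> cusp_forms r v; z \<in> upper_half_plane\<rbrakk> \<Longrightarrow> f (- 1 / z) = u * z powr of_real r * f z"
    using multiplier_system_inversion[OF v] by blast
  have odd: "?g (- x) = - ?g x" if x: "x \<in> {-1/2..1/2}" for x
  proof -
    define \<tau> where "\<tau> = unit_arc x"
    have \<tau>: "\<tau> \<in> upper_half_plane" unfolding \<tau>_def by (rule unit_arc_in_upper_half_plane[OF x])
    then have nz: "\<tau> \<noteq> 0" and im: "Im \<tau> > 0" by (auto simp: upper_half_plane_def)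
    have "diagonal_part (- 1 / \<tau>) = cnj (partial_cocycle f2 (r - 2) (- 1 / \<tau>) (- 1 / cnj \<tau>))"
      by (simp add: diagonal_part_def)
    also have "\<dots> = cnj (u / cnj \<tau> powr of_real (r - 2)) * diagonal_part \<tau>"
      using partial_cocycle_inversion[OF f2 u(2)[OF f2] \<tau> cnj_in_lower_half_plane[OF \<tau>]]
      by (simp only: diagonal_part_def complex_cnj_mult)
    also have "cnj (cnj \<tau> powr of_real (r - 2)) = \<tau> powr of_real (r - 2)"
      using im by (subst cnj_powr) auto
    then have "cnj (u / cnj \<tau> powr of_real (r - 2)) = cnj u / \<tau> powr of_real (r - 2)"
      by (simp only: complex_cnj_divide)
    finally have K: "diagonal_part (- 1 / \<tau>) = cnj u / \<tau> powr of_real (r - 2) * diagonal_part \<tau>" .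
    \<comment> \<open>The weight r of f1 against r - 2 of the diagonal part leaves \<tau>^2, which
      the differential on the inverted arc absorbs.\<close>
    have p: "\<tau> powr of_real r = \<tau> powr of_real (r - 2) * \<tau>\<^sup>2" using nz by (simp add: powr_diff)
    have "\<tau> powr of_real (r - 2) \<noteq> 0" using nz by (simp add: powr_def)
    then have "f1 (- 1 / \<tau>) * diagonal_part (- 1 / \<tau>) = (u * cnj u) * \<tau>\<^sup>2 * (f1 \<tau> * diagonal_part \<tau>)"
      unfolding u(2)[OF f1 \<tau>] K p by simp
    then have "f1 (- 1 / \<tau>) * diagonal_part (- 1 / \<tau>) * unit_arc_deriv (- x) =
        (\<tau>\<^sup>2 * unit_arc_deriv (- x)) * (f1 \<tau> * diagonal_part \<tau>)"
      by (simp add: unit_norm_mult_cnj[OF u(1)])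
    then show ?thesis
      unfolding unit_arc_minus(1)[OF x] \<tau>_def unit_arc_minus(2)[OF x] by simp
  qed
  have "integral {-1/2..1/2} ?g = integral {-1/2..1/2} (\<lambda>x. ?g (- x))"
    using Henstock_Kurzweil_Integration.integral_reflect_real[of "1/2" "-1/2" ?g] by simp
  also have "\<dots> = integral {-1/2..1/2} (\<lambda>x. - ?g x)"
    by (intro Henstock_Kurzweil_Integration.integral_cong odd)
  also have "\<dots> = - integral {-1/2..1/2} ?g" by simp
  finally show ?thesis by simp
qed

text \<open>The integrand is holomorphic, so the chord from rho - 1 to rho may be replaced by the
  arc, where it differs from \<open>stokes_potential\<close> only by the part that integrates to
  0.\<close>

lemma contour_integral_knopp_cocycle:
  "contour_integral (linepath (rho - 1) rho) (\<lambda>\<tau>. f1 \<tau> * f2_cocycle \<tau>) =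
   - 2 * \<i> * ((- 2 * \<i>) powr of_real (r - 2) * petersson r f1 f2)"
proof -
  let ?I = "{-1/2..1/2 :: real}"
  have arc: "unit_arc ` ?I \<subseteq> upper_half_plane" using unit_arc_in_upper_half_plane by blast
  obtain M1 where M1: "\<And>\<tau>. \<tau> \<in> fundamental_domain \<Longrightarrow> norm (stokes_potential \<tau>) \<le> M1 / Im \<tau>"
    using stokes_potential_bound by blast
  obtain M2 where M2: "\<And>\<tau>. \<tau> \<in> fundamental_domain \<Longrightarrow> norm (petersson_integrand \<tau>) \<le> M2 / (Im \<tau>)\<^sup>2"
    using petersson_integrand_bound by blast
  have pos: "Im \<tau> > 0" if "\<tau> \<in> fundamental_domain" for \<tau> using that by (simp add: fundamental_domain_def)
  have "integral ?I (\<lambda>x. stokes_potential (unit_arc x) * unit_arc_deriv x) =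
      2 * \<i> * set_lebesgue_integral lborel fundamental_domain (\<lambda>\<tau>. - petersson_integrand \<tau>)"
  proof (rule stokes_fundamental_domain[where a = holomorphic_partial and M = "max M1 M2"])
    show "norm (stokes_potential \<tau>) \<le> max M1 M2 / Im \<tau>" if "\<tau> \<in> fundamental_domain" for \<tau>
      by (rule order_trans[OF M1[OF that] divide_right_mono]) (use pos[OF that] in auto)
    show "norm (- petersson_integrand \<tau>) \<le> max M1 M2 / (Im \<tau>)\<^sup>2" if "\<tau> \<in> fundamental_domain" for \<tau>
      unfolding norm_minus_cancel by (rule order_trans[OF M2[OF that] divide_right_mono]) auto
    show "continuous_on upper_half_plane (\<lambda>\<tau>. - petersson_integrand \<tau>)"
      by (intro continuous_intros continuous_on_partial_derivatives)
  qed (use stokes_potential_has_derivative continuous_on_partial_derivatives stokes_potential_periodic in auto)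
  also have "\<dots> = - 2 * \<i> * ((- 2 * \<i>) powr of_real (r - 2) * petersson r f1 f2)"
    unfolding integral_petersson_integrand[symmetric]
    by (simp add: set_lebesgue_integral_def scaleR_minus_right)
  finally have stokes: "integral ?I (\<lambda>x. stokes_potential (unit_arc x) * unit_arc_deriv x) =
      - 2 * \<i> * ((- 2 * \<i>) powr of_real (r - 2) * petersson r f1 f2)" .
  have fh: "(\<lambda>\<tau>. f1 \<tau> * f2_cocycle \<tau>) holomorphic_on upper_half_plane" by (intro holomorphic_intros cusp_forms_holomorphic)
  \<comment> \<open>One primitive evaluates both the chord and the arc, as they share their
    endpoints.\<close>
  obtain G where G: "\<And>\<tau>. \<tau> \<in> upper_half_plane \<Longrightarrow> (G has_field_derivative f1 \<tau> * f2_cocycle \<tau>) (at \<tau> within upper_half_plane)"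
    using holomorphic_convex_primitive'[OF convex_upper_half_plane open_upper_half_plane fh] by blast
  have "((\<lambda>\<tau>. f1 \<tau> * f2_cocycle \<tau>) has_contour_integral G rho - G (rho - 1)) (linepath (rho - 1) rho)"
  proof -
    have "path_image (linepath (rho - 1) rho) \<subseteq> upper_half_plane"
      by (simp add: closed_segment_in_upper_half_plane rho_in_upper_half_plane)
    from contour_integral_primitive[OF G _ this] show ?thesis by simp
  qed
  then have "contour_integral (linepath (rho - 1) rho) (\<lambda>\<tau>. f1 \<tau> * f2_cocycle \<tau>) = G (unit_arc (1/2)) - G (unit_arc (- 1/2))"
    unfolding rho_eq_unit_arc[symmetric] by (rule contour_integral_unique)
  moreover have ftc: "((\<lambda>x. f1 (unit_arc x) * f2_cocycle (unit_arc x) * unit_arc_deriv x) has_integral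
      G (unit_arc (1/2)) - G (unit_arc (- 1/2))) ?I"
  proof (rule fundamental_theorem_of_calculus)
    fix x assume x: "x \<in> ?I"
    have "(G has_field_derivative f1 (unit_arc x) * f2_cocycle (unit_arc x)) (at (unit_arc x) within unit_arc ` ?I)"
      using G[OF unit_arc_in_upper_half_plane[OF x]] arc by (rule DERIV_subset)
    from field_vector_diff_chain_within[OF unit_arc_has_vector_derivative[OF x] this]
    show "((\<lambda>x. G (unit_arc x)) has_vector_derivative f1 (unit_arc x) * f2_cocycle (unit_arc x) * unit_arc_deriv x) (at x within ?I)"
      by (simp add: o_def mult_ac)
  qed simp
  moreover have "(\<lambda>x. f1 (unit_arc x) * diagonal_part (unit_arc x) * unit_arc_deriv x) integrable_on ?I"
  proof (rule integrable_continuous_interval)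
    have "continuous_on ?I (\<lambda>x. F (unit_arc x))" if "continuous_on upper_half_plane F" for F :: "complex \<Rightarrow> complex"
      by (rule continuous_on_compose2[OF that continuous_on_unit_arc arc])
    then show "continuous_on ?I (\<lambda>x. f1 (unit_arc x) * diagonal_part (unit_arc x) * unit_arc_deriv x)"
      using continuous_on_diagonal_part holomorphic_on_imp_continuous_on[OF cusp_forms_holomorphic(1)]
      by (intro continuous_on_mult continuous_on_unit_arc_deriv)
  qed
  then have "((\<lambda>x. f1 (unit_arc x) * diagonal_part (unit_arc x) * unit_arc_deriv x) has_integral 0) ?I"
    using integral_diagonal_part by (metis integrable_integral)
  from has_integral_diff[OF ftc this]
  have "((\<lambda>x. stokes_potential (unit_arc x) * unit_arc_deriv x) has_integral
      G (unit_arc (1/2)) - G (unit_arc (- 1/2))) ?I"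
    by (simp add: stokes_potential_def algebra_simps)
  then have "integral ?I (\<lambda>x. stokes_potential (unit_arc x) * unit_arc_deriv x) = G (unit_arc (1/2)) - G (unit_arc (- 1/2))"
    by (rule integral_unique)
  ultimately show ?thesis using stokes by simp
qed

end

theorem theorem5p1:
  fixes r :: real and v :: "int^2^2 \<Rightarrow> complex" and f1 f2 :: "complex \<Rightarrow> complex"
  assumes "r > 0"
    and "multiplier_system r v"
    and "f1 \<in> cusp_forms r v"
    and "f2 \<in> cusp_forms r v"
  shows "bracket_defined (2 - r)
           (knopp_cocycle r f2 (Interior \<i>) Cusp_Infinity)
           (eichler_cocycle r f1 (Interior (rho - 1)) (Interior rho)) \<and>
         bracket (2 - r)
           (knopp_cocycle r f2 (Interior \<i>) Cusp_Infinity)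
           (eichler_cocycle r f1 (Interior (rho - 1)) (Interior rho))
         = - 2 * \<i> * petersson r f1 f2"
proof -
  let ?f = "eichler_cocycle r f1 (Interior (rho - 1)) (Interior rho)"
  let ?h = "knopp_cocycle r f2 (Interior \<i>) Cusp_Infinity"
  note rho = rho_in_upper_half_plane(2,1)
  have "f1 holomorphic_on upper_half_plane" using assms(3) by (simp add: cusp_forms_def)
  then have cont: "continuous_on (closed_segment (rho - 1) rho) f1"
    by (rule continuous_on_subset[OF holomorphic_on_imp_continuous_on closed_segment_in_upper_half_plane[OF rho]])
  have f: "?f t = contour_integral (linepath (rho - 1) rho) (\<lambda>\<tau>. f1 \<tau> * (\<tau> - t) powr of_real (- (2 - r)))" for t
    by (simp add: eichler_cocycle_Interior)
  have f_hol: "?f holomorphic_on lower_half_plane"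
    unfolding holomorphic_on_open[OF open_lower_half_plane] eichler_cocycle_Interior
    using segment_cocycle_has_field_derivative[OF cont rho] by blast
  note br = bracket_of_segment_integral[where f = ?f and h = ?h and \<phi> = f1, OF rho cont f f_hol
      knopp_cocycle_holomorphic[OF assms(4)] higher_deriv_plus_part_knopp_cocycle[OF assms(4)]]
  have "bracket (2 - r) ?h ?f = (- 2 * \<i>) powr complex_of_real (2 - r) *
      (- 2 * \<i> * ((- 2 * \<i>) powr complex_of_real (r - 2) * petersson r f1 f2))"
    using br(2) unfolding contour_integral_knopp_cocycle[OF assms] .
  also have "\<dots> = ((- 2 * \<i>) powr complex_of_real (2 - r) * (- 2 * \<i>) powr complex_of_real (r - 2)) *
      (- 2 * \<i> * petersson r f1 f2)"
    by (simp only: mult_ac)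
  \<comment> \<open>Both powers have the same base, so they cancel for every real r, whatever the
    branch.\<close>
  also have "(- 2 * \<i>) powr complex_of_real (2 - r) * (- 2 * \<i>) powr complex_of_real (r - 2) = 1"
    unfolding powr_add[symmetric] by simp
  finally show ?thesis using br(1) by simp
qed

end
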